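(* Let $q$ be an odd prime, $n\ge k\ge1$, let $A\in\mathbb F_q^{n\times k}$ have rank $k$, let $r\in\{-1,1\}^n$ and $u=A^{\mathsf T}r\in\mathbb F_q^k$. Let $P$ be an $n\times n$ permutation matrix, $D=\operatorname{diag}(d_1,\dots,d_n)$ with $d_i\in\{-1,1\}$, $U\in\mathrm{GL}_k(\mathbb F_q)$, $H=DPAU$ and $r^*=DPr$. There is a deterministic algorithm which, given $A,u,H,r^*$ and $P$ (but not $r$, $D$, $U$), uses $O(k^3+nk^2)$ field operations and outputs (i) a vector $r'\in\{-1,1\}^n$ with $A^{\mathsf T}r'=u$, i.e. a valid old decryption key; and (ii) a diagonal matrix $D'$ with diagonal entries in $\{-1,1\}$ and a matrix $U'\in\mathrm{GL}_k(\mathbb F_q)$ with $H=D'PAU'$. Moreover, for every old-key ciphertext $c_0=Ax+e$, $c_1=\langle u,x\rangle+e_0+\lfloor q/p\rceil m$ one has $$c_1-\langle r',c_0\rangle=e_0-\langle r',e\rangle+\lfloor q/p\rceil m ,$$ so, since $r'\in\{-1,1\}^n$ satisfies the same norm bound as an honestly generated key, the scheme's decryption with key $r'$ returns $m$ under the scheme's correctness condition.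
   Context: This concerns an updatable public-key encryption scheme over $\mathbb F_q$. The old public key is $(A,u)$ with secret key $r\in\{-1,1\}^n$, $A^{\mathsf T}r=u$. An update publishes $H=DPAU$ (a signed permutation $DP$ and a basis change $U$) and changes the secret to $r^*=DPr$; the adversary is given the old public key, the updated public key and the exposed updated secret $r^*$. Encryption under the old key of a message $m\in\mathbb Z_p$ (for a plaintext modulus $p$) is $(c_0,c_1)$ with $c_0=Ax+e\in\mathbb F_q^n$, $c_1=\langle u,x\rangle+e_0+\lfloor q/p\rceil m\in\mathbb F_q$, where $x\in\mathbb F_q^k$ and $e,e_0$ are small errors. Decryption with key $r$ computes $c_1-\langle r,c_0\rangle$ and rounds to the nearest multiple of $\lfloor q/p\rceil$; the correctness condition is that $e_0-\langle \rho,e\rangle$ is small enough for this rounding to return $m$ for every $\rho\in\{-1,1\}^n$ (guaranteed by a norm bound on $e,e_0$ and the key). The permutation $P$ is assumed known to the adversary. *)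

theory Defs
  imports
    "HOL-Number_Theory.Residues"
    "HOL-Library.Centered_Division"
    "Jordan_Normal_Form.Matrix"
begin

section \<open>Vectors and matrices over the prime field\<close>

text \<open>
  The prime \<open>q\<close> is quantified inside the statement (one algorithm and one constant have to serve
  all \<open>q\<close>), so \<open>F\<^sub>q\<close> cannot be a type.  It is \<^term>\<open>residue_ring (int q)\<close>, whose carrier
  is \<open>{0..q-1}\<close>; vectors and matrices over it are integer ones with entries in that range, and
  their operations are the integer operations followed by reduction.  Sign vectors and sign
  matrices are kept as genuine integer objects with entries \<open>1\<close> and \<open>-1\<close>.
\<close>

definition Fq :: "nat \<Rightarrow> int set" where
  "Fq q = carrier (residue_ring (int q))"

definition Fq_vec :: "nat \<Rightarrow> nat \<Rightarrow> int vec set" where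
  "Fq_vec q n = {v \<in> carrier_vec n. \<forall>i<n. v $ i \<in> Fq q}"

definition Fq_mat :: "nat \<Rightarrow> nat \<Rightarrow> nat \<Rightarrow> int mat set" where
  "Fq_mat q n k = {M \<in> carrier_mat n k. \<forall>i<n. \<forall>j<k. M $$ (i, j) \<in> Fq q}"

definition vec_mod :: "nat \<Rightarrow> int vec \<Rightarrow> int vec" where
  "vec_mod q = map_vec (\<lambda>x. x mod int q)"

definition mat_mod :: "nat \<Rightarrow> int mat \<Rightarrow> int mat" where
  "mat_mod q = map_mat (\<lambda>x. x mod int q)"

definition cols_indep :: "nat \<Rightarrow> int mat \<Rightarrow> nat set \<Rightarrow> bool" where
  "cols_indep q M J \<longleftrightarrow>
     (\<forall>c. (\<forall>j\<in>J. c j \<in> Fq q) \<and> (\<forall>i<dim_row M. (\<Sum>j\<in>J. c j * M $$ (i, j)) mod int q = 0)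
          \<longrightarrow> (\<forall>j\<in>J. c j = 0))"

definition Fq_rank :: "nat \<Rightarrow> int mat \<Rightarrow> nat" where
  "Fq_rank q M = Max {card J | J. J \<subseteq> {..<dim_col M} \<and> cols_indep q M J}"

definition GL :: "nat \<Rightarrow> nat \<Rightarrow> int mat set" where
  "GL q k = {U \<in> Fq_mat q k k.
     \<exists>V\<in>Fq_mat q k k. mat_mod q (U * V) = 1\<^sub>m k \<and> mat_mod q (V * U) = 1\<^sub>m k}"

definition sign_vecs :: "nat \<Rightarrow> int vec set" where
  "sign_vecs n = {v \<in> carrier_vec n. \<forall>i<n. v $ i \<in> {-1, 1}}"

definition sign_diags :: "nat \<Rightarrow> int mat set" where
  "sign_diags n = {mat_diag n d | d. \<forall>i<n. d i \<in> {-1, 1}}"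

definition perm_mat :: "nat \<Rightarrow> (nat \<Rightarrow> nat) \<Rightarrow> int mat" where
  "perm_mat n \<pi> = mat n n (\<lambda>(i, j). if j = \<pi> i then 1 else 0)"


section \<open>Decryption\<close>

definition scale :: "nat \<Rightarrow> nat \<Rightarrow> int" where
  "scale q p = round (real q / real p)"

text \<open>
  Messages are the representatives \<open>0, ..., p-1\<close>.  Distances in \<open>F\<^sub>q\<close> are absolute values of
  centered representatives.
\<close>

definition decode :: "nat \<Rightarrow> nat \<Rightarrow> int \<Rightarrow> nat" where
  "decode q p w = arg_min_on (\<lambda>m. \<bar>(w - scale q p * int m) cmod int q\<bar>) {..<p}"

definition decrypt :: "nat \<Rightarrow> nat \<Rightarrow> int vec \<Rightarrow> int vec \<Rightarrow> int \<Rightarrow> nat" where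
  "decrypt q p r c0 c1 = decode q p ((c1 - r \<bullet> c0) mod int q)"

definition correctness_condition :: "nat \<Rightarrow> nat \<Rightarrow> nat \<Rightarrow> int vec \<Rightarrow> int \<Rightarrow> nat \<Rightarrow> bool" where
  "correctness_condition q p n e e0 m \<longleftrightarrow>
     (\<forall>\<rho>\<in>sign_vecs n. decode q p ((e0 - \<rho> \<bullet> e + scale q p * int m) mod int q) = m)"


text \<open>
  The condition follows from an explicit norm bound: the noise has to stay below half the distance
  between neighbouring codewords, including the wrap-around from \<open>p-1\<close> to \<open>0\<close>.
\<close>

lemma abs_cmod_le:
  fixes x q t :: int
  assumes "q > 0"
  shows "\<bar>x cmod q\<bar> \<le> \<bar>x + q * t\<bar>"
proof -
  define y where "y = x cmod q"
  define a where "a = (x + q div 2) mod q"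
  have a: "0 \<le> a" "a < q" using assms by (simp_all add: a_def)
  have y1: "y = a - q div 2" using assms by (simp add: y_def a_def centered_modulo_def)
  have "2 * (q div 2) \<le> q" "q \<le> 2 * (q div 2) + 1" by presburger+
  then have "2 * y \<le> q" "- (2 * y) \<le> q" using a unfolding y1 by (simp_all add: algebra_simps)
  then have y: "2 * \<bar>y\<bar> \<le> q" by (simp add: abs_if)
  obtain s where s: "x + q * t = y + q * s"
    using mult_cdiv_cmod_eq[of q x] by (metis y_def add.assoc add.commute distrib_left)
  show ?thesis
  proof (cases "s = 0")
    case True
    then show ?thesis using s by (simp add: y_def)
  next
    case False
    then have "q * 1 \<le> q * \<bar>s\<bar>" using assms by (intro mult_left_mono) auto
    then have "q \<le> \<bar>q * s\<bar>" using assms by (simp add: abs_mult)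
    then show ?thesis using s y by (simp add: y_def[symmetric]) 
  qed
qed

lemma decode_close:
  assumes "q > 0" "m < p" "2 * \<bar>\<eta>\<bar> < scale q p" "2 * \<bar>\<eta>\<bar> < int q - (int p - 1) * scale q p"
  shows "decode q p ((\<eta> + scale q p * int m) mod int q) = m"
proof -
  define S where "S = scale q p"
  define f where "f m' = \<bar>((\<eta> + S * int m) mod int q - S * int m') cmod int q\<bar>" for m'
  have f_mod: "f m' = \<bar>(\<eta> + S * (int m - int m')) cmod int q\<bar>" for m'
  proof -
    define h where "h = int q div 2"
    have "((\<eta> + S * int m) mod int q - S * int m' + h) mod int q
        = ((\<eta> + S * int m) mod int q + (h - S * int m')) mod int q"
      by (simp add: algebra_simps)
    also have "\<dots> = ((\<eta> + S * int m) + (h - S * int m')) mod int q"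
      by (rule mod_add_left_eq)
    also have "(\<eta> + S * int m) + (h - S * int m') = \<eta> + S * (int m - int m') + h"
      by (simp add: algebra_simps)
    finally show ?thesis by (simp add: f_def centered_modulo_def h_def)
  qed
  have fm: "f m \<le> \<bar>\<eta>\<bar>" using abs_cmod_le[of "int q" \<eta> 0] assms(1) by (simp add: f_mod)
  have far: "\<bar>\<eta>\<bar> < f m'" if "m' < p" "m' \<noteq> m" for m'
  proof -
    define d where "d = int m - int m'"
    have d: "1 \<le> \<bar>d\<bar>" "\<bar>d\<bar> \<le> int p - 1" using that assms(2) by (auto simp: d_def)
    have S: "0 < S" using assms(3) by (simp add: S_def)
    define x where "x = \<eta> + S * d"
    define c where "c = x cdiv int q"
    have x: "x cmod int q = \<eta> + S * d - int q * c"
      using mult_cdiv_cmod_eq[of "int q" x] by (simp add: x_def c_def)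
    have lo: "S \<le> \<bar>S * d\<bar>" using mult_left_mono[OF d(1), of S] S by (simp add: abs_mult)
    have hi: "\<bar>S * d\<bar> \<le> (int p - 1) * S"
      using mult_left_mono[OF d(2), of S] S by (simp add: abs_mult algebra_simps)
    have hq: "c = 0 \<or> int q \<le> \<bar>int q * c\<bar>"
    proof (cases "c = 0")
      case False
      then have "int q * 1 \<le> int q * \<bar>c\<bar>" by (intro mult_left_mono) auto
      then show ?thesis by (simp add: abs_mult)
    qed simp
    have "2 * \<bar>\<eta>\<bar> < \<bar>S * d - int q * c\<bar>"
      using hq lo hi assms(3,4) unfolding S_def[symmetric] by (elim disjE) auto
    then have "\<bar>\<eta>\<bar> < \<bar>x cmod int q\<bar>" unfolding x by linarith
    then show ?thesis by (simp add: f_mod x_def d_def)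
  qed
  have "finite {..<p}" "{..<p} \<noteq> {}" using assms(2) by auto
  note arg = arg_min_if_finite[OF this, of f]
  have "arg_min_on f {..<p} = m"
    using arg far fm assms(2) by (metis lessThan_iff order.strict_trans1)
  then show ?thesis by (simp add: decode_def f_def[abs_def] S_def)
qed

lemma correctness_condition_if_small:
  assumes "q > 0" "m < p" "e \<in> carrier_vec n"
    and "2 * (\<bar>e0\<bar> + (\<Sum>i<n. \<bar>e $ i\<bar>)) < scale q p"
    and "2 * (\<bar>e0\<bar> + (\<Sum>i<n. \<bar>e $ i\<bar>)) < int q - (int p - 1) * scale q p"
  shows "correctness_condition q p n e e0 m"
  unfolding correctness_condition_def
proof
  fix \<rho> assume "\<rho> \<in> sign_vecs n"
  then have \<rho>: "\<And>i. i < n \<Longrightarrow> \<bar>\<rho> $ i\<bar> = 1" by (auto simp: sign_vecs_def)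
  have "\<bar>\<rho> \<bullet> e\<bar> \<le> (\<Sum>i<n. \<bar>\<rho> $ i * e $ i\<bar>)"
    using assms(3) sum_abs[of "\<lambda>i. \<rho> $ i * e $ i" "{..<n}"]
    by (simp add: scalar_prod_def atLeast0LessThan)
  also have "\<dots> = (\<Sum>i<n. \<bar>e $ i\<bar>)" by (rule sum.cong) (auto simp: abs_mult \<rho>)
  finally have "2 * \<bar>e0 - \<rho> \<bullet> e\<bar> \<le> 2 * (\<bar>e0\<bar> + (\<Sum>i<n. \<bar>e $ i\<bar>))"
    using abs_triangle_ineq4[of e0 "\<rho> \<bullet> e"] by simp
  then show "decode q p ((e0 - \<rho> \<bullet> e + scale q p * int m) mod int q) = m"
    using assms(1,2,4,5) by (blast intro: decode_close order.strict_trans1)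
qed


section \<open>Algorithms over a field\<close>

text \<open>
  A deterministic while language.  Its memory consists of named arrays of natural numbers and
  named two-dimensional arrays of field elements.  Natural numbers serve for indices and
  combinatorial data.  Field elements are accessible only through the arithmetic operations and
  equality tests, each of which costs one unit; everything else is free.  Dividing by \<open>0\<close>
  yields \<open>0\<close>.
\<close>

datatype nexp =
    NConst nat
  | NGet string nexp
  | NAdd nexp nexp
  | NSub nexp nexp
  | NMul nexp nexp

datatype fexp =
    FZero
  | FOne
  | FGet string nexp nexp
  | FAdd fexp fexp
  | FSub fexp fexp
  | FMul fexp fexp
  | FDiv fexp fexp

datatype bexp =
    NLess nexp nexp
  | FEq fexp fexp
  | BNot bexp
  | BAnd bexp bexp

datatype com =
    Skip
  | NAssign string nexp nexp
  | FAssign string nexp nexp fexp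
  | Seq com com
  | IfElse bexp com com
  | While bexp com

record 'a memory =
  nmem :: "string \<Rightarrow> nat \<Rightarrow> nat"
  fmem :: "string \<Rightarrow> nat \<Rightarrow> nat \<Rightarrow> 'a"

fun nval :: "nexp \<Rightarrow> 'a memory \<Rightarrow> nat" where
  "nval (NConst c) s = c"
| "nval (NGet x a) s = nmem s x (nval a s)"
| "nval (NAdd a b) s = nval a s + nval b s"
| "nval (NSub a b) s = nval a s - nval b s"
| "nval (NMul a b) s = nval a s * nval b s"

fun fval :: "('a, 'b) ring_scheme \<Rightarrow> fexp \<Rightarrow> 'a memory \<Rightarrow> 'a" where
  "fval R FZero s = \<zero>\<^bsub>R\<^esub>"
| "fval R FOne s = \<one>\<^bsub>R\<^esub>"
| "fval R (FGet x a b) s = fmem s x (nval a s) (nval b s)"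
| "fval R (FAdd f g) s = fval R f s \<oplus>\<^bsub>R\<^esub> fval R g s"
| "fval R (FSub f g) s = fval R f s \<ominus>\<^bsub>R\<^esub> fval R g s"
| "fval R (FMul f g) s = fval R f s \<otimes>\<^bsub>R\<^esub> fval R g s"
| "fval R (FDiv f g) s =
     (if fval R g s = \<zero>\<^bsub>R\<^esub> then \<zero>\<^bsub>R\<^esub> else fval R f s \<otimes>\<^bsub>R\<^esub> inv\<^bsub>R\<^esub> (fval R g s))"

fun fcost :: "fexp \<Rightarrow> nat" where
  "fcost FZero = 0"
| "fcost FOne = 0"
| "fcost (FGet x a b) = 0"
| "fcost (FAdd f g) = fcost f + fcost g + 1"
| "fcost (FSub f g) = fcost f + fcost g + 1"
| "fcost (FMul f g) = fcost f + fcost g + 1"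
| "fcost (FDiv f g) = fcost f + fcost g + 1"

fun bval :: "('a, 'b) ring_scheme \<Rightarrow> bexp \<Rightarrow> 'a memory \<Rightarrow> bool" where
  "bval R (NLess a b) s \<longleftrightarrow> nval a s < nval b s"
| "bval R (FEq f g) s \<longleftrightarrow> fval R f s = fval R g s"
| "bval R (BNot b) s \<longleftrightarrow> \<not> bval R b s"
| "bval R (BAnd b c) s \<longleftrightarrow> bval R b s \<and> bval R c s"

fun bcost :: "bexp \<Rightarrow> nat" where
  "bcost (NLess a b) = 0"
| "bcost (FEq f g) = fcost f + fcost g + 1"
| "bcost (BNot b) = bcost b"
| "bcost (BAnd b c) = bcost b + bcost c"

definition nupd :: "string \<Rightarrow> nat \<Rightarrow> nat \<Rightarrow> 'a memory \<Rightarrow> 'a memory" where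
  "nupd x i v s = s\<lparr>nmem := (nmem s)(x := (nmem s x)(i := v))\<rparr>"

definition fupd :: "string \<Rightarrow> nat \<Rightarrow> nat \<Rightarrow> 'a \<Rightarrow> 'a memory \<Rightarrow> 'a memory" where
  "fupd x i j v s =
     s\<lparr>fmem := (fmem s)(x := (fmem s x)(i := (fmem s x i)(j := v)))\<rparr>"

text \<open>
  \<open>exec R c s w t\<close>: program \<open>c\<close>, started in \<open>s\<close> over the field \<open>R\<close>, terminates in \<open>t\<close> after
  \<open>w\<close> field operations.
\<close>

inductive exec ::
  "('a, 'b) ring_scheme \<Rightarrow> com \<Rightarrow> 'a memory \<Rightarrow> nat \<Rightarrow> 'a memory \<Rightarrow> bool"
  for R where
  Skip: "exec R Skip s 0 s"
| NAssign: "exec R (NAssign x a b) s 0 (nupd x (nval a s) (nval b s) s)"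
| FAssign: "exec R (FAssign x a b f) s (fcost f) (fupd x (nval a s) (nval b s) (fval R f s) s)"
| Seq: "\<lbrakk>exec R c s v s'; exec R d s' w t\<rbrakk> \<Longrightarrow> exec R (Seq c d) s (v + w) t"
| IfTrue: "\<lbrakk>bval R b s; exec R c s w t\<rbrakk> \<Longrightarrow> exec R (IfElse b c d) s (bcost b + w) t"
| IfFalse: "\<lbrakk>\<not> bval R b s; exec R d s w t\<rbrakk> \<Longrightarrow> exec R (IfElse b c d) s (bcost b + w) t"
| WhileFalse: "\<not> bval R b s \<Longrightarrow> exec R (While b c) s (bcost b) s"
| WhileTrue: "\<lbrakk>bval R b s; exec R c s v s'; exec R (While b c) s' w t\<rbrakk>
    \<Longrightarrow> exec R (While b c) s (bcost b + v + w) t"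

lemma exec_deterministic:
  "exec R c s w t \<Longrightarrow> exec R c s w' t' \<Longrightarrow> w = w' \<and> t = t'"
proof (induction arbitrary: w' t' rule: exec.induct)
  case (Seq c s v s' d w t)
  from Seq.prems show ?case by cases (use Seq.IH in blast)
next
  case (IfTrue b s c w t d)
  from IfTrue.prems IfTrue.hyps(1) show ?case by cases (use IfTrue.IH in blast)+
next
  case (IfFalse b s d w t c)
  from IfFalse.prems IfFalse.hyps(1) show ?case by cases (use IfFalse.IH in blast)+
next
  case (WhileTrue b s c v s' w t)
  from WhileTrue.prems WhileTrue.hyps(1) show ?case by cases (use WhileTrue.IH in blast)+
qed (erule exec.cases; simp)+


section \<open>Input and output of the key recovery attack\<close>

text \<open>
  The permutation is given as an index array: row \<open>i\<close> of \<open>P\<close> has its entry \<open>1\<close> in column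
  \<open>\<pi> i\<close>.  All memory cells not mentioned contain \<open>0\<close>.
\<close>

definition attack_input ::
  "nat \<Rightarrow> nat \<Rightarrow> nat \<Rightarrow> int mat \<Rightarrow> int vec \<Rightarrow> int mat \<Rightarrow> int vec \<Rightarrow> (nat \<Rightarrow> nat) \<Rightarrow> int memory" where
  "attack_input q n k A u H rs \<pi> =
     \<lparr>nmem = (\<lambda>x i.
        if x = ''n'' \<and> i = 0 then n
        else if x = ''k'' \<and> i = 0 then k
        else if x = ''P'' \<and> i < n then \<pi> i
        else 0),
      fmem = (\<lambda>x i j.
        if x = ''A'' \<and> i < n \<and> j < k then A $$ (i, j)
        else if x = ''u'' \<and> i < k \<and> j = 0 then u $ i
        else if x = ''H'' \<and> i < n \<and> j < k then H $$ (i, j)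
        else if x = ''rs'' \<and> i < n \<and> j = 0 then rs $ i mod int q
        else 0)\<rparr>"

text \<open>
  The centered representative turns the field elements \<open>1\<close> and \<open>q-1\<close> into the integers \<open>1\<close>
  and \<open>-1\<close>.
\<close>

definition out_key :: "nat \<Rightarrow> nat \<Rightarrow> int memory \<Rightarrow> int vec" where
  "out_key q n t = vec n (\<lambda>i. fmem t ''r'' i 0 cmod int q)"

definition out_diag :: "nat \<Rightarrow> nat \<Rightarrow> int memory \<Rightarrow> int mat" where
  "out_diag q n t = mat_diag n (\<lambda>i. fmem t ''D'' i 0 cmod int q)"

definition out_basis :: "nat \<Rightarrow> int memory \<Rightarrow> int mat" where
  "out_basis k t = mat k k (\<lambda>(i, j). fmem t ''U'' i j)"

end

(*
The secret signs are determined by A and H up to one global sign for each connected component of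
the linear matroid on the rows of PA, and u together with r* removes the remaining ambiguity.
Stack u below PA, and r*^T H below H.  Since u = A^T r and r* = DPr, the rows of the second stack
are the rows of the first one times U with signs d_1, ..., d_n, 1.  Reduced column echelon forms
of the two stacks have the same pivot rows, by uniqueness, and corresponding entries in row i and
the column with pivot row b differ by the factor d_i d_b.  Hence every nonzero entry reveals
d_i d_b; choosing signs e_i with e_i e_b = d_i d_b on all nonzero entries, normalised to 1 on the
row u, is possible by merging connected components, which costs no field operations.  Any such
choice gives diag(e) PA U' = H and u U' = r*^T H for the matrix U' determined on the pivot rows,
and r' = (diag(e) P)^T r* satisfies r'^T A U' = r*^T H = u U', so A^T r' = u.  Rows of the identity
matrix below the first stack record the column operations, which yields U' without a further
inversion.
*)

theory Submission
  imports Defs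
begin

section \<open>Program logic\<close>

text \<open>The secret signs \<open>d\<close> themselves need not be found. If \<open>e\<close>
  agrees with \<open>d\<close> along all edges, then e_i d_i = e_b d_b whenever row i is nonzero in
  the column with pivot row b, so every column of the reduced form, on the rows that carry signs, is
  an eigenvector of diag(e d). Hence diag(e d) preserves the column space of the first stack, which
  is why \<open>e\<close> serves as well as \<open>d\<close>. Oddness of q enters where a sign is
  read off: a nonzero residue must differ from its negative. Both pivot searches are confined to the
  first n rows; rank k guarantees k pivots there, so that neither the key row nor an identity row
  becomes a pivot row, and the basis can be rebuilt from rows of H. Elimination does not sort the
  columns, so uniqueness holds up to their order, and columns are paired by comparing recorded pivot
  rows over all k^2 pairs. Each row of a paired column costs at most two equality tests, which stays
  within O(n k^2).\<close>

primrec writes :: "com \<Rightarrow> string set" where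
  "writes Skip = {}"
| "writes (NAssign x a b) = {x}"
| "writes (FAssign x a b f) = {x}"
| "writes (Seq c d) = writes c \<union> writes d"
| "writes (IfElse b c d) = writes c \<union> writes d"
| "writes (While b c) = writes c"

text \<open>A name denotes both a natural-number array and a field array, and a write to either
  releases both. This suits the elimination, where one name holds a matrix and its list of
  pivots.\<close>

definition same :: "string set \<Rightarrow> 'a memory \<Rightarrow> 'a memory \<Rightarrow> bool" where
  "same V s t \<longleftrightarrow> (\<forall>x. x \<notin> V \<longrightarrow> nmem t x = nmem s x \<and> fmem t x = fmem s x)"

lemma same_refl [simp]: "same V s s"
  by (simp add: same_def)

lemma nmem_nupd [simp]: "nmem (nupd x i v s) = (nmem s)(x := (nmem s x)(i := v))"
  and fmem_nupd [simp]: "fmem (nupd x i v s) = fmem s"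
  and nmem_fupd [simp]: "nmem (fupd x i j w s) = nmem s"
  and fmem_fupd [simp]: "fmem (fupd x i j w s) = (fmem s)(x := (fmem s x)(i := (fmem s x i)(j := w)))"
  by (simp_all add: nupd_def fupd_def)

lemma exec_frame: "exec R c s w t \<Longrightarrow> same (writes c) s t"
  by (induction rule: exec.induct) (auto simp: same_def)

text \<open>Total correctness with a budget: \<open>w\<close> is an upper bound for the cost, so
  bounds can be rounded up and added. Since execution is deterministic, exhibiting one run describes
  the only run.\<close>

definition wp :: "('a, 'b) ring_scheme \<Rightarrow> com \<Rightarrow> nat \<Rightarrow> ('a memory \<Rightarrow> bool) \<Rightarrow> 'a memory \<Rightarrow> bool"
  where "wp R c w Q s \<longleftrightarrow> (\<exists>v t. exec R c s v t \<and> v \<le> w \<and> Q t)"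

text \<open>The frame is supplied here: the weakened postcondition may assume that names outside
  \<open>writes c\<close> are unchanged, so specifications of subprograms need not list
  them.\<close>

lemma wp_mono:
  "\<lbrakk>wp R c v Q s; v \<le> w; \<And>t. \<lbrakk>Q t; same (writes c) s t\<rbrakk> \<Longrightarrow> Q' t\<rbrakk> \<Longrightarrow> wp R c w Q' s"
  unfolding wp_def using exec_frame le_trans by blast

inductive_cases exec_SkipE: "exec R Skip s w t"
inductive_cases exec_NAssignE: "exec R (NAssign x a b) s w t"
inductive_cases exec_FAssignE: "exec R (FAssign x a b f) s w t"
inductive_cases exec_SeqE: "exec R (Seq c d) s w t"
inductive_cases exec_IfElseE: "exec R (IfElse b c d) s w t"

lemma wp_Skip [simp]: "wp R Skip w Q s \<longleftrightarrow> Q s"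
  unfolding wp_def by (auto intro: exec.Skip elim: exec_SkipE)

lemma wp_NAssign [simp]: "wp R (NAssign x a b) w Q s \<longleftrightarrow> Q (nupd x (nval a s) (nval b s) s)"
  unfolding wp_def by (auto intro: exec.NAssign elim: exec_NAssignE)

lemma wp_FAssign [simp]:
  "wp R (FAssign x a b f) w Q s \<longleftrightarrow> fcost f \<le> w \<and> Q (fupd x (nval a s) (nval b s) (fval R f s) s)"
  unfolding wp_def by (auto intro: exec.FAssign elim: exec_FAssignE)

lemma wp_IfElse [simp]:
  "wp R (IfElse b c d) w Q s \<longleftrightarrow>
     bcost b \<le> w \<and> wp R (if bval R b s then c else d) (w - bcost b) Q s"
proof
  assume "wp R (IfElse b c d) w Q s"
  then obtain v t where e: "exec R (IfElse b c d) s v t" "v \<le> w" "Q t" by (auto simp: wp_def)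
  from e(1) obtain v' where "exec R (if bval R b s then c else d) s v' t" "v = bcost b + v'"
    by (rule exec_IfElseE) auto
  with e(2,3) show "bcost b \<le> w \<and> wp R (if bval R b s then c else d) (w - bcost b) Q s"
    unfolding wp_def by (intro conjI exI[of _ v'] exI[of _ t]) simp_all
next
  assume *: "bcost b \<le> w \<and> wp R (if bval R b s then c else d) (w - bcost b) Q s"
  then obtain v t where "exec R (if bval R b s then c else d) s v t" "v \<le> w - bcost b" "Q t"
    by (auto simp: wp_def)
  with * show "wp R (IfElse b c d) w Q s"
    unfolding wp_def
    by (intro exI[of _ "bcost b + v"] exI[of _ t])
      (auto split: if_splits intro: exec.IfTrue exec.IfFalse)
qed

lemma wp_Seq: "\<lbrakk>wp R c v (wp R d v' Q) s; v + v' \<le> w\<rbrakk> \<Longrightarrow> wp R (Seq c d) w Q s"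
  unfolding wp_def by (meson add_mono exec.Seq order_trans)

text \<open>As an equivalence for the simplifier this executes straight-line code symbolically;
  where a budget has to be split by hand, \<open>wp_Seq\<close> is used instead.\<close>

lemma wp_Seq_NAssign [simp]:
  "wp R (Seq (NAssign x a b) d) w Q s \<longleftrightarrow> wp R d w Q (nupd x (nval a s) (nval b s) s)"
proof
  assume "wp R (Seq (NAssign x a b) d) w Q s"
  then obtain v t where e: "exec R (Seq (NAssign x a b) d) s v t" "v \<le> w" "Q t" by (auto simp: wp_def)
  from e(1) have "exec R d (nupd x (nval a s) (nval b s) s) v t"
    by (rule exec_SeqE) (erule exec_NAssignE, simp)
  with e show "wp R d w Q (nupd x (nval a s) (nval b s) s)" unfolding wp_def by blast
qed (rule wp_Seq[of _ _ 0 _ w], simp_all)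

lemma wp_Seq_FAssign [simp]:
  "wp R (Seq (FAssign x a b f) d) w Q s \<longleftrightarrow>
     fcost f \<le> w \<and> wp R d (w - fcost f) Q (fupd x (nval a s) (nval b s) (fval R f s) s)"
proof
  assume "wp R (Seq (FAssign x a b f) d) w Q s"
  then obtain v t where e: "exec R (Seq (FAssign x a b f) d) s v t" "v \<le> w" "Q t"
    by (auto simp: wp_def)
  from e(1) obtain v2 where
    v2: "exec R d (fupd x (nval a s) (nval b s) (fval R f s) s) v2 t" "v = fcost f + v2"
    by (rule exec_SeqE) (erule exec_FAssignE, simp)
  from v2(2) e(2) have "fcost f \<le> w" "v2 \<le> w - fcost f" by simp_all
  with v2(1) e(3)
  show "fcost f \<le> w \<and> wp R d (w - fcost f) Q (fupd x (nval a s) (nval b s) (fval R f s) s)"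
    unfolding wp_def by blast
qed (rule wp_Seq[of _ _ "fcost f" _ "w - fcost f"], simp_all)

abbreviation NVar :: "string \<Rightarrow> nexp" where
  "NVar x \<equiv> NGet x (NConst 0)"

definition For :: "string \<Rightarrow> nexp \<Rightarrow> com \<Rightarrow> com" where
  "For x e c = Seq (NAssign x (NConst 0) (NConst 0))
     (While (NLess (NVar x) e) (Seq c (NAssign x (NConst 0) (NAdd (NVar x) (NConst 1)))))"

lemma writes_For [simp]: "writes (For x e c) = insert x (writes c)"
  by (auto simp: For_def)

text \<open>The invariant takes the iteration number as an argument instead of reading the counter,
  and \<open>stable\<close> lets it survive updates of the counter. The loop bound is reevaluated in
  every round, hence \<open>bound\<close> demands one value throughout the frame. Loop control uses
  natural numbers only and adds nothing to \<open>N * v\<close>.\<close>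

lemma wp_For:
  assumes bound: "\<And>t. same (insert x (writes c)) s t \<Longrightarrow> nval e t = N"
    and x: "x \<notin> writes c"
    and init: "I 0 s"
    and stable: "\<And>j t v. I j t \<Longrightarrow> I j (nupd x 0 v t)"
    and step: "\<And>j t. \<lbrakk>j < N; same (insert x (writes c)) s t; nmem t x 0 = j; I j t\<rbrakk>
                  \<Longrightarrow> wp R c v (I (Suc j)) t"
    and post: "\<And>t. \<lbrakk>same (insert x (writes c)) s t; I N t\<rbrakk> \<Longrightarrow> Q t"
    and cost: "N * v \<le> w"
  shows "wp R (For x e c) w Q s"
proof -
  let ?V = "insert x (writes c)"
  let ?c = "Seq c (NAssign x (NConst 0) (NAdd (NVar x) (NConst 1)))"
  let ?W = "While (NLess (NVar x) e) ?c"
  \<comment> \<open>Induction on the number \<open>m\<close> of remaining rounds, since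
    \<open>While\<close> unfolds at its first iteration.\<close>
  have W: "\<exists>t' v'. exec R ?W t v' t' \<and> v' \<le> m * v \<and> same ?V s t' \<and> I N t'"
    if "m = N - j" "j \<le> N" "same ?V s t" "nmem t x 0 = j" "I j t" for m j t
    using that
  proof (induction m arbitrary: j t)
    case 0
    then have "j = N" by simp
    moreover have "exec R ?W t (bcost (NLess (NVar x) e)) t"
      using 0 bound[of t] by (intro exec.WhileFalse) simp
    ultimately show ?case using 0 by auto
  next
    case (Suc m)
    then have j: "j < N" by simp
    then obtain v1 t1 where 1: "exec R c t v1 t1" "v1 \<le> v" "I (Suc j) t1"
      using step[of j t] Suc.prems by (auto simp: wp_def)
    let ?t = "nupd x 0 (Suc j) t1"
    have sm: "same (writes c) t t1" using 1 exec_frame by blast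
    then have "nmem t1 x 0 = j" using x Suc.prems by (simp add: same_def)
    then have e: "exec R ?c t (v1 + 0) ?t"
      using exec.NAssign[of R x "NConst 0" "NAdd (NVar x) (NConst 1)" t1]
      by (intro exec.Seq[OF 1(1)]) simp
    have "same ?V s ?t" using sm Suc.prems(3) by (auto simp: same_def)
    then obtain t' v' where 2: "exec R ?W ?t v' t'" "v' \<le> m * v" "same ?V s t'" "I N t'"
      using Suc.IH[of "Suc j" ?t, OF _ _ _ _ stable[OF 1(3)]] Suc.prems(1) j by fastforce
    have "bval R (NLess (NVar x) e) t" using j bound[of t] Suc.prems by simp
    from exec.WhileTrue[OF this e 2(1)] show ?case using 1(2) 2 by (auto intro!: exI[of _ t'])
  qed
  have "same ?V s (nupd x 0 0 s)" by (auto simp: same_def)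
  from W[of N 0, OF _ _ this _ stable[OF init]] obtain t' v' where
    *: "exec R ?W (nupd x 0 0 s) v' t'" "v' \<le> N * v" "same ?V s t'" "I N t'" by auto
  have "exec R (For x e c) s (0 + v') t'"
    unfolding For_def using exec.NAssign[of R x "NConst 0" "NConst 0" s]
    by (intro exec.Seq[OF _ *(1)]) simp
  then show ?thesis using * post cost unfolding wp_def by (auto intro!: exI[of _ "0 + v'"] exI[of _ t'])
qed

section \<open>Arithmetic modulo a prime\<close>

lemma residue_ring_simps [simp]:
  "\<zero>\<^bsub>residue_ring m\<^esub> = 0" "\<one>\<^bsub>residue_ring m\<^esub> = 1"
  "x \<oplus>\<^bsub>residue_ring m\<^esub> y = (x + y) mod m" "x \<otimes>\<^bsub>residue_ring m\<^esub> y = (x * y) mod m"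
  "carrier (residue_ring m) = {0..m - 1}"
  by (simp_all add: residue_ring_def)

lemma residue_ring_minus:
  assumes "1 < m"
  shows "x \<ominus>\<^bsub>residue_ring m\<^esub> y = (x - y) mod m"
proof -
  interpret residues m "residue_ring m" by unfold_locales (rule assms)
  show ?thesis by (simp add: a_minus_def res_neg_eq mod_add_right_eq)
qed

text \<open>Everything strictly between 0 and a prime is a unit. The left factor has the form in
  which \<open>FDiv\<close> computes a quotient, reduction included.\<close>

lemma residue_ring_inv_cong:
  assumes "prime q" "0 < y" "y < int q"
  shows "[(x * inv\<^bsub>residue_ring (int q)\<^esub> y) mod int q * y = x] (mod int q)"
proof -
  interpret residues_prime q "residue_ring (int q)" by unfold_locales (rule assms)
  have "y \<in> Units (residue_ring (int q))" using assms by (simp add: res_prime_units_eq)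
  then have "(inv\<^bsub>residue_ring (int q)\<^esub> y * y) mod int q = 1" using Units_l_inv by simp
  then have "[inv\<^bsub>residue_ring (int q)\<^esub> y * y = 1] (mod int q)"
    using prime_gt_1_nat[OF assms(1)] by (simp add: cong_def)
  from cong_scalar_left[OF this, of x] show ?thesis
    by (metis cong_def mod_mult_left_eq mult.assoc mult.right_neutral)
qed

lemma prime_cong_0_mult:
  assumes "prime q" "[a * b = 0] (mod int q)"
  shows "[a = 0] (mod int q) \<or> [b = 0] (mod int q)"
  using assms by (simp add: cong_0_iff prime_dvd_mult_iff)

lemma cong_reduced_eq:
  assumes "[x = y] (mod int q)" "0 \<le> x" "x < int q" "0 \<le> y" "y < int q"
  shows "x = y"
  using assms by (simp add: cong_def)

lemma prime_cong_inverse: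
  assumes "prime q" "\<not> [a = 0] (mod int q)"
  obtains b where "[a * b = 1] (mod int q)"
proof -
  have "coprime a (int q)"
    using assms by (metis cong_0_iff coprime_commute prime_imp_coprime prime_nat_int_transfer)
  then show thesis using cong_solve_coprime_int that by blast
qed

section \<open>Reduced column echelon form\<close>

text \<open>Vectors are functions of which only the first \<open>N\<close> values count, up to
  congruence; the same function can thus be viewed on fewer rows.\<close>

definition colspan :: "nat \<Rightarrow> nat \<Rightarrow> nat \<Rightarrow> (nat \<Rightarrow> nat \<Rightarrow> int) \<Rightarrow> (nat \<Rightarrow> int) set" where
  "colspan q N k X = {v. \<exists>y. \<forall>i<N. [v i = (\<Sum>j<k. X i j * y j)] (mod int q)}"

text \<open>Full column rank of the first \<open>n\<close> rows, put as a trivial kernel: in this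
  form it passes through column operations by substituting coordinates.\<close>

definition col_inj :: "nat \<Rightarrow> nat \<Rightarrow> nat \<Rightarrow> (nat \<Rightarrow> nat \<Rightarrow> int) \<Rightarrow> bool" where
  "col_inj q n k X \<longleftrightarrow>
     (\<forall>y. (\<forall>i<n. [(\<Sum>j<k. X i j * y j) = 0] (mod int q)) \<longrightarrow> (\<forall>j<k. [y j = 0] (mod int q)))"

text \<open>\<open>pv j = 0\<close> marks a column without pivot; otherwise its pivot is in row \<open>pv j - 1\<close>.\<close>

definition echelon ::
  "nat \<Rightarrow> nat \<Rightarrow> nat \<Rightarrow> nat \<Rightarrow> (nat \<Rightarrow> nat \<Rightarrow> int) \<Rightarrow> nat \<Rightarrow> (nat \<Rightarrow> nat \<Rightarrow> int) \<Rightarrow> (nat \<Rightarrow> nat) \<Rightarrow> bool"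
  where
  "echelon q n N k X0 t X pv \<longleftrightarrow>
     (\<forall>i<N. \<forall>j<k. 0 \<le> X i j \<and> X i j < int q) \<and>
     colspan q N k X = colspan q N k X0 \<and> col_inj q n k X \<and>
     card {j. j < k \<and> 0 < pv j} = t \<and>
     (\<forall>j<k. 0 < pv j \<longrightarrow> pv j \<le> n \<and> X (pv j - 1) j = 1 \<and>
        (\<forall>j'<k. j' \<noteq> j \<longrightarrow> X (pv j - 1) j' = 0) \<and> (\<forall>i<pv j - 1. X i j = 0))"

lemma sum_split_at:
  fixes f :: "nat \<Rightarrow> int"
  assumes "p < k"
  shows "(\<Sum>j<k. f j) = f p + (\<Sum>j\<in>{..<k} - {p}. f j)"
  using assms by (simp add: sum.remove)

text \<open>One elimination step is right multiplication by an invertible matrix; \<open>y \<mapsto> z\<close> and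
  \<open>z \<mapsto> y\<close> are the two directions of the corresponding change of coordinates.\<close>

lemma eliminate_coords:
  fixes X X' :: "nat \<Rightarrow> nat \<Rightarrow> int" and c y z :: "nat \<Rightarrow> int" and N :: nat
  assumes q: "prime q" and p: "p < k" and c: "\<And>i. i < N \<Longrightarrow> [c i * X r p = X i p] (mod int q)"
    and a: "\<not> [X r p = 0] (mod int q)"
    and X': "\<And>i j. \<lbrakk>i < N; j < k\<rbrakk> \<Longrightarrow>
      [X' i j = (if j = p then c i else X i j - c i * X r j)] (mod int q)"
  shows "\<exists>z. (\<forall>i<N. [(\<Sum>j<k. X' i j * y j) = (\<Sum>j<k. X i j * z j)] (mod int q)) \<and>
             ((\<forall>j<k. [z j = 0] (mod int q)) \<longrightarrow> (\<forall>j<k. [y j = 0] (mod int q)))"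
    and "\<exists>y. \<forall>i<N. [(\<Sum>j<k. X i j * z j) = (\<Sum>j<k. X' i j * y j)] (mod int q)"
proof -
  obtain b where b: "[X r p * b = 1] (mod int q)" using prime_cong_inverse[OF q a] .
  let ?S = "{..<k} - {p}"
  have X'sum: "[(\<Sum>j<k. X' i j * y j) = c i * (y p - (\<Sum>j\<in>?S. X r j * y j)) + (\<Sum>j\<in>?S. X i j * y j)] (mod int q)"
    if "i < N" for i and y :: "nat \<Rightarrow> int"
  proof -
    have "[(\<Sum>j<k. X' i j * y j) = (\<Sum>j<k. (if j = p then c i else X i j - c i * X r j) * y j)] (mod int q)"
      by (intro cong_sum cong_scalar_right X' that) auto
    also have "(\<Sum>j<k. (if j = p then c i else X i j - c i * X r j) * y j)
       = c i * y p + (\<Sum>j\<in>?S. (X i j - c i * X r j) * y j)"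
      unfolding sum_split_at[OF p] by simp
    also have "\<dots> = c i * (y p - (\<Sum>j\<in>?S. X r j * y j)) + (\<Sum>j\<in>?S. X i j * y j)"
      by (simp add: algebra_simps sum_distrib_left sum.distrib sum_subtractf)
    finally show ?thesis .
  qed
  \<comment> \<open>\<open>b\<close> inverts the pivot, so \<open>c i\<close> stands for
    \<open>X i p * b\<close> modulo q.\<close>
  have cX: "[c i * w = X i p * (b * w)] (mod int q)" if "i < N" for i w
  proof -
    have "c i * w - X i p * (b * w) = (c i * X r p - X i p) * (b * w) - (X r p * b - 1) * (c i * w)"
      by (simp add: algebra_simps)
    moreover have "int q dvd (c i * X r p - X i p) * (b * w) - (X r p * b - 1) * (c i * w)"
      using c[OF that] b unfolding cong_iff_dvd_diff by (rule dvd_diff[OF dvd_mult2 dvd_mult2])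
    ultimately show ?thesis by (simp add: cong_iff_dvd_diff)
  qed
  show "\<exists>z. (\<forall>i<N. [(\<Sum>j<k. X' i j * y j) = (\<Sum>j<k. X i j * z j)] (mod int q)) \<and>
             ((\<forall>j<k. [z j = 0] (mod int q)) \<longrightarrow> (\<forall>j<k. [y j = 0] (mod int q)))"
  proof (intro exI conjI allI impI)
    let ?w = "y p - (\<Sum>j\<in>?S. X r j * y j)"
    \<comment> \<open>The new column \<open>p\<close> is the old one times \<open>b\<close>, and the
      other columns have multiples of it subtracted; collecting the coefficient of the old column
      \<open>p\<close> gives \<open>b * ?w\<close>.\<close>
    let ?z = "y(p := b * ?w)"
    show "[(\<Sum>j<k. X' i j * y j) = (\<Sum>j<k. X i j * ?z j)] (mod int q)" if "i < N" for i
      using cong_trans[OF X'sum[OF that] cong_add[OF cX[OF that] cong_refl]]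
      unfolding sum_split_at[OF p] by simp
    fix j assume z: "\<forall>j<k. [?z j = 0] (mod int q)" and j: "j < k"
    have off: "[y j = 0] (mod int q)" if "j \<in> ?S" for j
      using z[rule_format, of j] that by simp
    then have s: "[(\<Sum>j\<in>?S. X r j * y j) = 0] (mod int q)"
      unfolding cong_0_iff by (intro dvd_sum dvd_mult) (simp add: cong_0_iff)
    have bw: "[b * ?w = 0] (mod int q)" using z[rule_format, OF p] by simp
    have "y p = X r p * (b * ?w) - (X r p * b - 1) * ?w + (\<Sum>j\<in>?S. X r j * y j)"
      by (simp add: algebra_simps)
    moreover have "int q dvd X r p * (b * ?w) - (X r p * b - 1) * ?w + (\<Sum>j\<in>?S. X r j * y j)"
      using b bw s unfolding cong_0_iff cong_iff_dvd_diff diff_zero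
      by (intro dvd_add[OF dvd_diff[OF dvd_mult dvd_mult2]])
    ultimately have "[y p = 0] (mod int q)" by (simp add: cong_0_iff)
    then show "[y j = 0] (mod int q)" using off j by (cases "j = p") auto
  qed
  show "\<exists>y. \<forall>i<N. [(\<Sum>j<k. X i j * z j) = (\<Sum>j<k. X' i j * y j)] (mod int q)"
  proof (intro exI allI impI)
    \<comment> \<open>The new coordinate at \<open>p\<close> is the entry of the old combination in
      row \<open>r\<close>, because elimination turns the pivot row into a unit row.\<close>
    let ?y = "z(p := X r p * z p + (\<Sum>j\<in>?S. X r j * z j))"
    fix i assume i: "i < N"
    have "[c i * (X r p * z p) + (\<Sum>j\<in>?S. X i j * z j) = X i p * z p + (\<Sum>j\<in>?S. X i j * z j)] (mod int q)"
      using cong_scalar_right[OF c[OF i], of "z p"] by (intro cong_add) (auto simp: mult.assoc)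
    moreover have "(\<Sum>j\<in>?S. X i j * ?y j) = (\<Sum>j\<in>?S. X i j * z j)" "(\<Sum>j\<in>?S. X r j * ?y j) = (\<Sum>j\<in>?S. X r j * z j)"
      by (auto intro: sum.cong)
    ultimately show "[(\<Sum>j<k. X i j * z j) = (\<Sum>j<k. X' i j * ?y j)] (mod int q)"
      using X'sum[OF i, of ?y] unfolding sum_split_at[OF p, of "\<lambda>j. X i j * z j"]
      by (simp add: cong_def)
  qed
qed

text \<open>\<open>first\<close> makes \<open>r\<close> the topmost row in which a column without
  pivot is nonzero, which keeps columns zero above their pivots. Rows with a zero in column
  \<open>p\<close> do not change; these include the earlier pivot rows and all rows above
  \<open>r\<close>.\<close>

lemma echelon_step:
  assumes q: "prime q" and nN: "n \<le> N"
    and E: "echelon q n N k X0 t X pv"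
    and p: "p < k" "pv p = 0" and r: "r < n" "X r p \<noteq> 0"
    and first: "\<And>i j. \<lbrakk>i < r; j < k; pv j = 0\<rbrakk> \<Longrightarrow> X i j = 0"
    and c: "\<And>i. i < N \<Longrightarrow> [c i * X r p = X i p] (mod int q)"
    and X': "\<And>i j. \<lbrakk>i < N; j < k\<rbrakk> \<Longrightarrow>
      [X' i j = (if j = p then c i else X i j - c i * X r j)] (mod int q)"
    and red: "\<And>i j. \<lbrakk>i < N; j < k\<rbrakk> \<Longrightarrow> 0 \<le> X' i j \<and> X' i j < int q"
  shows "echelon q n N k X0 (Suc t) X' (pv(p := Suc r))"
proof -
  have redX: "0 \<le> X i j" "X i j < int q" if "i < N" "j < k" for i j
    using E that by (auto simp: echelon_def)
  have q1: "1 < int q" using prime_gt_1_nat[OF q] by simp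
  have rN: "r < N" using r nN by simp
  have a: "\<not> [X r p = 0] (mod int q)"
    using cong_reduced_eq[of "X r p" 0 q] redX[OF rN p(1)] r by auto
  note co = eliminate_coords[where N = N and c = c and X = X and X' = X' and r = r, OF q p(1) c a X']
  have cinj: "col_inj q n k X'" unfolding col_inj_def
  proof (intro allI impI)
    fix y j assume y: "\<forall>i<n. [(\<Sum>j<k. X' i j * y j) = 0] (mod int q)" and j: "j < k"
    obtain z where z: "\<And>i. i < N \<Longrightarrow> [(\<Sum>j<k. X' i j * y j) = (\<Sum>j<k. X i j * z j)] (mod int q)"
      "(\<forall>j<k. [z j = 0] (mod int q)) \<longrightarrow> (\<forall>j<k. [y j = 0] (mod int q))"
      using co(1) by blast
    have "\<forall>i<n. [(\<Sum>j<k. X i j * z j) = 0] (mod int q)"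
      using y z(1) nN by (meson cong_sym cong_trans less_le_trans)
    then have "\<forall>j<k. [z j = 0] (mod int q)" using E by (auto simp: echelon_def col_inj_def)
    then show "[y j = 0] (mod int q)" using z(2) j by blast
  qed
  have "colspan q N k X' \<subseteq> colspan q N k X"
  proof
    fix v assume "v \<in> colspan q N k X'"
    then obtain y where y: "\<And>i. i < N \<Longrightarrow> [v i = (\<Sum>j<k. X' i j * y j)] (mod int q)"
      by (auto simp: colspan_def)
    obtain z where "\<And>i. i < N \<Longrightarrow> [(\<Sum>j<k. X' i j * y j) = (\<Sum>j<k. X i j * z j)] (mod int q)"
      using co(1) by blast
    then show "v \<in> colspan q N k X" using y cong_trans unfolding colspan_def by blast
  qed
  moreover have "colspan q N k X \<subseteq> colspan q N k X'"
  proof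
    fix v assume "v \<in> colspan q N k X"
    then obtain y where y: "\<And>i. i < N \<Longrightarrow> [v i = (\<Sum>j<k. X i j * y j)] (mod int q)"
      by (auto simp: colspan_def)
    obtain z where "\<And>i. i < N \<Longrightarrow> [(\<Sum>j<k. X i j * y j) = (\<Sum>j<k. X' i j * z j)] (mod int q)"
      using co(2) by blast
    then show "v \<in> colspan q N k X'" using y cong_trans unfolding colspan_def by blast
  qed
  ultimately have span: "colspan q N k X' = colspan q N k X0" using E by (auto simp: echelon_def)
  have "{j. j < k \<and> 0 < (pv(p := Suc r)) j} = insert p {j. j < k \<and> 0 < pv j}" using p by auto
  then have card: "card {j. j < k \<and> 0 < (pv(p := Suc r)) j} = Suc t"
    using E p by (simp add: echelon_def)
  have unused: "X' i j = X i j" if "i < N" "j < k" "X i p = 0" for i j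
  proof -
    have "[c i * X r p = 0] (mod int q)" using c[OF that(1)] that by simp
    then have "[c i = 0] (mod int q)" using prime_cong_0_mult[OF q] a by blast
    then have "[(if j = p then c i else X i j - c i * X r j) = X i j] (mod int q)"
      using that by (auto simp: cong_iff_dvd_diff)
    from cong_trans[OF X'[OF that(1,2)] this] show ?thesis
      using red[OF that(1,2)] redX[OF that(1,2)] by (intro cong_reduced_eq[of _ _ q]) auto
  qed
  have "(c r - 1) * X r p = c r * X r p - X r p" by (simp add: algebra_simps)
  then have "[(c r - 1) * X r p = 0] (mod int q)"
    using c[OF rN] by (simp add: cong_iff_dvd_diff)
  then have cr: "[c r = 1] (mod int q)"
    using prime_cong_0_mult[OF q, of "c r - 1"] a by (auto simp: cong_iff_dvd_diff)
  have "[X' r j = (if j = p then 1 else 0)] (mod int q)" if "j < k" for j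
  proof -
    have "(1 - c r) * X r j = X r j - c r * X r j" by (simp add: algebra_simps)
    moreover have "[(1 - c r) * X r j = 0] (mod int q)"
      using cr by (simp add: cong_iff_dvd_diff dvd_diff_commute)
    ultimately have "[X r j - c r * X r j = 0] (mod int q)" by simp
    then show ?thesis using cong_trans[OF X'[OF rN that]] cr by (cases "j = p") auto
  qed
  then have row_r: "X' r j = (if j = p then 1 else 0)" if "j < k" for j
    using red[OF rN that] that q1 by (intro cong_reduced_eq[of _ _ q]) (auto split: if_splits)
  \<comment> \<open>\<open>echelon\<close> does not order the pivots. Above \<open>r\<close> nothing
    changes; a row \<open>i\<close> from \<open>r\<close> on can lie above the pivot of
    \<open>j\<close> only if \<open>r\<close> does too, and then the subtracted multiple of
    \<open>X r j\<close> is zero.\<close>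
  have zero: "X' i j = 0" if "j < k" "0 < pv j" "i < pv j - 1" for i j
  proof -
    have *: "X i j = 0" "i < N" "j \<noteq> p" using E that p nN by (auto simp: echelon_def)
    show ?thesis
    proof (cases "i < r")
      case True
      then show ?thesis using unused[of i j] first[of i p] * that p by simp
    next
      case False
      then have "X r j = 0" using E that by (auto simp: echelon_def)
      then have "[X' i j = 0] (mod int q)" using X'[of i j] * that by simp
      then show ?thesis using red[of i j] * that q1 by (intro cong_reduced_eq[of _ _ q]) auto
    qed
  qed
  show ?thesis
    unfolding echelon_def
  proof (intro conjI allI impI)
    fix j assume j: "j < k" "0 < (pv(p := Suc r)) j"
    show "(pv(p := Suc r)) j \<le> n" using E r j by (cases "j = p") (auto simp: echelon_def)
    let ?r = "(pv(p := Suc r)) j - 1"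
    have old: "X' ?r j' = X ?r j'" if "j \<noteq> p" "j' < k" for j'
      using E j that p nN by (intro unused) (auto simp: echelon_def)
    show "X' ?r j = 1" using E j row_r old by (cases "j = p") (auto simp: echelon_def)
    show "X' ?r j' = 0" if "j' < k" "j' \<noteq> j" for j'
      using E j row_r old[of j'] that by (cases "j = p") (auto simp: echelon_def)
    show "X' i j = 0" if "i < ?r" for i
      using that j zero[of j i] unused[of i p] first[of i p] rN p by (cases "j = p") auto
  qed (use cinj span card red in auto)
qed

text \<open>Fewer than \<open>k\<close> pivots leave a column without one. If it vanished in the
  first \<open>n\<close> rows, its unit vector would lie in the kernel.\<close>

lemma echelon_exists_pivot:
  assumes q: "prime q" and E: "echelon q n N k X0 t X pv" and "t < k"
  shows "\<exists>i<n. \<exists>j<k. pv j = 0 \<and> X i j \<noteq> 0"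
proof (rule ccontr)
  assume *: "\<not> ?thesis"
  have "\<exists>j<k. pv j = 0"
  proof (rule ccontr)
    assume "\<not> ?thesis"
    then have "{j. j < k \<and> 0 < pv j} = {..<k}" by auto
    then show False using E \<open>t < k\<close> by (simp add: echelon_def)
  qed
  then obtain j where j: "j < k" "pv j = 0" by blast
  have "\<forall>i<n. [(\<Sum>l<k. X i l * (if l = j then 1 else 0)) = 0] (mod int q)"
    using * j by (force simp: if_distrib[of "\<lambda>x. _ * x"] cong: if_cong)
  moreover have "col_inj q n k X" using E by (simp add: echelon_def)
  ultimately have "[(if j = j then 1 else 0) = (0::int)] (mod int q)"
    using j(1) unfolding col_inj_def by (elim allE[of _ "\<lambda>l. if l = j then 1 else 0"]) blast
  then show False using prime_gt_1_nat[OF q] by (simp add: cong_def)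
qed

section \<open>Gauss--Jordan elimination as a program\<close>

text \<open>The loops visit every entry, and \<open>found\<close> freezes the first hit in row-major
  order, that is in the topmost row. The cost of \<open>BAnd\<close> counts all conjuncts, so each
  visit costs one equality test.\<close>

definition search_step :: "string \<Rightarrow> com" where
  "search_step X =
     IfElse (BAnd (BNot (NLess (NConst 0) (NVar ''found'')))
              (BAnd (BNot (NLess (NConst 0) (NGet X (NVar ''j''))))
                (BNot (FEq (FGet X (NVar ''i'') (NVar ''j'')) FZero))))
       (Seq (NAssign ''row'' (NConst 0) (NVar ''i''))
         (Seq (NAssign ''col'' (NConst 0) (NVar ''j''))
           (NAssign ''found'' (NConst 0) (NConst 1))))
       Skip"

definition search :: "string \<Rightarrow> com" where
  "search X =
     Seq (NAssign ''found'' (NConst 0) (NConst 0))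
       (For ''i'' (NVar ''n'') (For ''j'' (NVar ''k'') (search_step X)))"

text \<open>The inner loop also spoils column \<open>col\<close>, whose entry is replaced by the
  quotient afterwards. For the pivot row itself the quotient is 1, so it becomes a unit row without
  a special case.\<close>

definition eliminate_row :: "string \<Rightarrow> com" where
  "eliminate_row X =
     Seq (FAssign ''quot'' (NConst 0) (NConst 0)
           (FDiv (FGet X (NVar ''i'') (NVar ''col'')) (FGet ''tmp'' (NVar ''col'') (NConst 0))))
       (Seq (For ''j'' (NVar ''k'')
              (FAssign X (NVar ''i'') (NVar ''j'')
                (FSub (FGet X (NVar ''i'') (NVar ''j''))
                  (FMul (FGet ''quot'' (NConst 0) (NConst 0)) (FGet ''tmp'' (NVar ''j'') (NConst 0))))))
         (FAssign X (NVar ''i'') (NVar ''col'') (FGet ''quot'' (NConst 0) (NConst 0))))"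

text \<open>The pivot row is copied to \<open>tmp\<close> because it is overwritten while later rows
  still refer to it.\<close>

definition eliminate :: "string \<Rightarrow> nexp \<Rightarrow> com" where
  "eliminate X e =
     Seq (For ''j'' (NVar ''k'')
           (FAssign ''tmp'' (NVar ''j'') (NConst 0) (FGet X (NVar ''row'') (NVar ''j''))))
       (For ''i'' e (eliminate_row X))"

definition gauss :: "string \<Rightarrow> nexp \<Rightarrow> com" where
  "gauss X e =
     For ''t'' (NVar ''k'')
       (Seq (search X)
         (Seq (NAssign X (NVar ''col'') (NAdd (NVar ''row'') (NConst 1)))
           (eliminate X e)))"

lemma writes_search_step [simp]: "writes (search_step X) = {''found'', ''row'', ''col''}"
  by (auto simp: search_step_def)

lemma writes_search [simp]: "writes (search X) = {''found'', ''i'', ''j'', ''row'', ''col''}"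
  by (auto simp: search_def)

lemma writes_eliminate_row [simp]: "writes (eliminate_row X) = {''j'', ''quot'', X}"
  by (auto simp: eliminate_row_def)

lemma writes_eliminate [simp]: "writes (eliminate X e) = {''i'', ''j'', ''tmp'', ''quot'', X}"
  by (auto simp: eliminate_def)

lemma writes_gauss [simp]:
  "writes (gauss X e) = {''t'', ''found'', ''i'', ''j'', ''row'', ''col'', ''tmp'', ''quot'', X}"
  by (auto simp: gauss_def)

definition is_pivot :: "nat \<Rightarrow> nat \<Rightarrow> (nat \<Rightarrow> nat \<Rightarrow> int) \<Rightarrow> (nat \<Rightarrow> nat) \<Rightarrow> nat \<Rightarrow> nat \<Rightarrow> bool" where
  "is_pivot n k X pv r p \<longleftrightarrow> r < n \<and> p < k \<and> pv p = 0 \<and> X r p \<noteq> 0 \<and>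
     (\<forall>i<r. \<forall>j<k. pv j = 0 \<longrightarrow> X i j = 0)"

lemma wp_search:
  fixes s :: "int memory"
  assumes X: "X \<notin> {''found'', ''i'', ''j'', ''row'', ''col''}"
    and n: "nmem s ''n'' 0 = n" and k: "nmem s ''k'' 0 = k"
    and ex: "\<exists>i<n. \<exists>j<k. nmem s X j = 0 \<and> fmem s X i j \<noteq> 0"
  shows "wp (residue_ring (int q)) (search X) (n * k)
    (\<lambda>t. is_pivot n k (fmem s X) (nmem s X) (nmem t ''row'' 0) (nmem t ''col'' 0)) s"
proof -
  let ?R = "residue_ring (int q)"
  have X': "X \<noteq> ''found''" "X \<noteq> ''i''" "X \<noteq> ''j''" "X \<noteq> ''row''" "X \<noteq> ''col''" using X by auto
  note [simp] = X' X'[symmetric]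
  define ok where "ok t \<longleftrightarrow> is_pivot n k (fmem s X) (nmem s X) (nmem t ''row'' 0) (nmem t ''col'' 0)"
    for t :: "int memory"
  define J where "J i j t \<longleftrightarrow> nmem t X = nmem s X \<and> fmem t X = fmem s X \<and>
      (if nmem t ''found'' 0 = 0
       then (\<forall>i'<i. \<forall>j<k. nmem s X j = 0 \<longrightarrow> fmem s X i' j = 0) \<and>
            (\<forall>j'<j. nmem s X j' = 0 \<longrightarrow> fmem s X i j' = 0)
       else ok t)" for i j and t :: "int memory"
  have J_stable: "J i j (nupd ''i'' 0 v t) = J i j t" "J i j (nupd ''j'' 0 v t) = J i j t" for i j v t
    by (auto simp: J_def ok_def)
  have inner: "wp ?R (search_step X) 1 (\<lambda>t'. J i (Suc j) t') t"
    if "i < n" "j < k" "nmem t ''i'' 0 = i" "nmem t ''j'' 0 = j" "J i j t" for i j t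
    using that by (auto simp: search_step_def J_def ok_def is_pivot_def less_Suc_eq split: if_splits)
  have row: "wp ?R (For ''j'' (NVar ''k'') (search_step X)) k (J (Suc i) 0) t"
    if "i < n" "nmem t ''i'' 0 = i" "nmem t ''k'' 0 = k" "J i 0 t" for i t
  proof (rule wp_For[where I = "J i" and N = k and v = 1])
    fix t' assume "J i k t'"
    then show "J (Suc i) 0 t'" by (auto simp: J_def less_Suc_eq split: if_splits)
  qed (use that inner in \<open>auto simp: J_stable same_def\<close>)
  show ?thesis
    unfolding search_def
  proof (simp, rule wp_For[where I = "\<lambda>i. J i 0" and N = n and v = k])
    fix t assume "J n 0 t"
    then show "is_pivot n k (fmem s X) (nmem s X) (nmem t ''row'' 0) (nmem t ''col'' 0)"
      using ex by (auto simp: J_def ok_def split: if_splits)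
  qed (use row n k in \<open>auto simp: J_stable same_def\<close>, auto simp: J_def)
qed

definition quot :: "nat \<Rightarrow> int \<Rightarrow> int \<Rightarrow> int" where
  "quot q x y = (if y = 0 then 0 else (x * inv\<^bsub>residue_ring (int q)\<^esub> y) mod int q)"

text \<open>The two reductions mirror the program, which reduces after \<open>FMul\<close> and again
  after \<open>FSub\<close>.\<close>

definition eliminated :: "nat \<Rightarrow> (nat \<Rightarrow> nat \<Rightarrow> int) \<Rightarrow> nat \<Rightarrow> nat \<Rightarrow> nat \<Rightarrow> nat \<Rightarrow> int" where
  "eliminated q X r p i j = (if j = p then quot q (X i p) (X r p)
     else (X i j - (quot q (X i p) (X r p) * X r j) mod int q) mod int q)"

text \<open>Each of the \<open>N\<close> rows costs one division, then one multiplication and one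
  subtraction per column.\<close>

lemma wp_eliminate:
  fixes s :: "int memory"
  assumes X: "X \<notin> {''n'', ''k'', ''row'', ''col'', ''i'', ''j'', ''tmp'', ''quot''}" and q: "1 < q"
    and e: "\<And>t. same {''i'', ''j'', ''tmp'', ''quot'', X} s t \<Longrightarrow> nval e t = N"
    and k: "nmem s ''k'' 0 = k"
    and r: "nmem s ''row'' 0 = r" and p: "nmem s ''col'' 0 = p" "p < k"
  shows "wp (residue_ring (int q)) (eliminate X e) (N * (2 * k + 1))
    (\<lambda>t. nmem t X = nmem s X \<and> (\<forall>i<N. \<forall>j<k. fmem t X i j = eliminated q (fmem s X) r p i j)) s"
proof -
  let ?R = "residue_ring (int q)"
  have X': "X \<noteq> ''n''" "X \<noteq> ''k''" "X \<noteq> ''row''" "X \<noteq> ''col''" "X \<noteq> ''i''" "X \<noteq> ''j''"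
    "X \<noteq> ''tmp''" "X \<noteq> ''quot''" using X by auto
  note [simp] = X' X'[symmetric]
  have sub: "x \<ominus>\<^bsub>?R\<^esub> y = (x - y) mod int q" for x y
    using q by (intro residue_ring_minus) simp
  define Y where "Y = fmem s X"
  define E where "E = eliminated q Y r p"
  define c where "c i = quot q (Y i p) (Y r p)" for i
  have Ep: "E i p = c i" and Ej: "j \<noteq> p \<Longrightarrow> E i j = (Y i j - (c i * Y r j) mod int q) mod int q" for i j
    by (simp_all add: E_def eliminated_def c_def)
  define T where "T i t \<longleftrightarrow> nmem t X = nmem s X \<and>
      (\<forall>j<k. fmem t ''tmp'' j 0 = Y r j) \<and>
      (\<forall>i'<i. \<forall>j<k. fmem t X i' j = E i' j) \<and> (\<forall>i'\<ge>i. fmem t X i' = Y i')"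
    for i and t :: "int memory"
  have row: "wp ?R (eliminate_row X) (2 * k + 1) (T (Suc i)) t"
    if i: "nmem t ''i'' 0 = i" "nmem t ''k'' 0 = k" "nmem t ''col'' 0 = p" and T: "T i t" for i t
  proof -
    let ?t = "fupd ''quot'' 0 0 (c i) t"
    \<comment> \<open>Column \<open>p\<close> is exempt: its entry becomes correct only with the
      final assignment of the quotient.\<close>
    define J where "J j t' \<longleftrightarrow> nmem t' X = nmem s X \<and> (\<forall>i'. i' \<noteq> i \<longrightarrow> fmem t' X i' = fmem t X i') \<and>
        (\<forall>j'<j. j' \<noteq> p \<longrightarrow> fmem t' X i j' = E i j') \<and> (\<forall>j'\<ge>j. fmem t' X i j' = Y i j')"
      for j and t' :: "int memory"
    have "wp ?R (For ''j'' (NVar ''k'')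
              (FAssign X (NVar ''i'') (NVar ''j'')
                (FSub (FGet X (NVar ''i'') (NVar ''j''))
                  (FMul (FGet ''quot'' (NConst 0) (NConst 0)) (FGet ''tmp'' (NVar ''j'') (NConst 0))))))
          (2 * k) (\<lambda>t'. J k t' \<and> same {''j'', X} ?t t') ?t"
    proof (rule wp_For[where I = J and N = k and v = 2])
      fix j t' assume j: "j < k" "nmem t' ''j'' 0 = j" "J j t'"
        and "same (insert ''j'' (writes (FAssign X (NVar ''i'') (NVar ''j'')
                (FSub (FGet X (NVar ''i'') (NVar ''j''))
                  (FMul (FGet ''quot'' (NConst 0) (NConst 0)) (FGet ''tmp'' (NVar ''j'') (NConst 0)))))))
          ?t t'"
      then have "nmem t' ''i'' 0 = i" "fmem t' ''quot'' 0 0 = c i" "fmem t' ''tmp'' j 0 = Y r j"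
        using i T by (auto simp: same_def T_def)
      with j show "wp ?R (FAssign X (NVar ''i'') (NVar ''j'')
                (FSub (FGet X (NVar ''i'') (NVar ''j''))
                  (FMul (FGet ''quot'' (NConst 0) (NConst 0)) (FGet ''tmp'' (NVar ''j'') (NConst 0)))))
          2 (J (Suc j)) t'"
        by (auto simp: J_def sub Ej less_Suc_eq)
    qed (use i T in \<open>auto simp: J_def T_def same_def\<close>)
    then have "wp ?R (Seq (For ''j'' (NVar ''k'')
              (FAssign X (NVar ''i'') (NVar ''j'')
                (FSub (FGet X (NVar ''i'') (NVar ''j''))
                  (FMul (FGet ''quot'' (NConst 0) (NConst 0)) (FGet ''tmp'' (NVar ''j'') (NConst 0))))))
          (FAssign X (NVar ''i'') (NVar ''col'') (FGet ''quot'' (NConst 0) (NConst 0))))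
          (2 * k) (T (Suc i)) ?t"
    proof (intro wp_Seq[where v = "2 * k" and v' = 0], rule wp_mono)
      fix t' :: "int memory"
      assume *: "J k t' \<and> same {''j'', X} ?t t'"
      then have "nmem t' ''i'' 0 = i" "fmem t' ''quot'' 0 0 = c i" "nmem t' ''col'' 0 = p"
        "fmem t' ''tmp'' = fmem t ''tmp''"
        using i T by (auto simp: same_def T_def)
      then show "wp ?R (FAssign X (NVar ''i'') (NVar ''col'') (FGet ''quot'' (NConst 0) (NConst 0))) 0
          (T (Suc i)) t'"
        using * T by (auto simp: T_def J_def Ep less_Suc_eq)
    qed auto
    moreover have "fval ?R (FDiv (FGet X (NVar ''i'') (NVar ''col'')) (FGet ''tmp'' (NVar ''col'') (NConst 0))) t = c i"
      using i T p by (auto simp: T_def c_def quot_def)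
    ultimately show ?thesis using i unfolding eliminate_row_def by (simp add: numeral_2_eq_2)
  qed
  show ?thesis unfolding eliminate_def
  proof (rule wp_Seq[where v = 0 and v' = "N * (2 * k + 1)"])
    show "wp ?R (For ''j'' (NVar ''k'')
           (FAssign ''tmp'' (NVar ''j'') (NConst 0) (FGet X (NVar ''row'') (NVar ''j''))))
        0 (wp ?R (For ''i'' e (eliminate_row X)) (N * (2 * k + 1))
            (\<lambda>t. nmem t X = nmem s X \<and> (\<forall>i<N. \<forall>j<k. fmem t X i j = eliminated q (fmem s X) r p i j))) s"
    proof (rule wp_For[where I = "\<lambda>j t. \<forall>j'<j. fmem t ''tmp'' j' 0 = Y r j'" and N = k and v = 0])
      fix t assume st: "same (insert ''j'' (writes
          (FAssign ''tmp'' (NVar ''j'') (NConst 0) (FGet X (NVar ''row'') (NVar ''j''))))) s t"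
        and tmp: "\<forall>j'<k. fmem t ''tmp'' j' 0 = Y r j'"
      show "wp ?R (For ''i'' e (eliminate_row X)) (N * (2 * k + 1))
          (\<lambda>t. nmem t X = nmem s X \<and> (\<forall>i<N. \<forall>j<k. fmem t X i j = eliminated q (fmem s X) r p i j)) t"
      proof (rule wp_For[where I = T and N = N and v = "2 * k + 1"])
        show "T 0 t" using st tmp by (auto simp: T_def Y_def same_def)
        show "nval e t' = N" if "same (insert ''i'' (writes (eliminate_row X))) t t'" for t'
          using st that by (intro e) (auto simp: same_def)
        show "wp ?R (eliminate_row X) (2 * k + 1) (T (Suc i)) t'"
          if "same (insert ''i'' (writes (eliminate_row X))) t t'" "nmem t' ''i'' 0 = i" "T i t'" for i t'
          using that st k p by (intro row) (auto simp: same_def)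
      qed (auto simp: T_def E_def Y_def)
    qed (use k r in \<open>auto simp: same_def less_Suc_eq Y_def\<close>)
  qed simp
qed

text \<open>A round costs at most \<open>n * k\<close> for the search and
  \<open>N * (2 * k + 1)\<close> for the elimination. Full column rank of the first \<open>n\<close>
  rows guarantees that each of the \<open>k\<close> rounds finds a pivot.\<close>

lemma wp_gauss:
  fixes s :: "int memory"
  assumes X: "X \<notin> {''n'', ''k'', ''t'', ''found'', ''i'', ''j'', ''row'', ''col'', ''tmp'', ''quot''}"
    and q: "prime q"
    and e: "\<And>t. same (writes (gauss X e)) s t \<Longrightarrow> nval e t = N"
    and n: "nmem s ''n'' 0 = n" and k: "nmem s ''k'' 0 = k" and nN: "n \<le> N"
    and pv0: "\<And>j. nmem s X j = 0"
    and red: "\<And>i j. \<lbrakk>i < N; j < k\<rbrakk> \<Longrightarrow> 0 \<le> fmem s X i j \<and> fmem s X i j < int q"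
    and inj: "col_inj q n k (fmem s X)"
  shows "wp (residue_ring (int q)) (gauss X e) (k * (n * k + N * (2 * k + 1)))
    (\<lambda>t. echelon q n N k (fmem s X) k (fmem t X) (nmem t X)) s"
proof -
  let ?R = "residue_ring (int q)"
  have X': "X \<noteq> ''n''" "X \<noteq> ''k''" "X \<noteq> ''t''" "X \<noteq> ''found''" "X \<noteq> ''row''" "X \<noteq> ''col''" "X \<noteq> ''i''"
    "X \<noteq> ''j''" "X \<noteq> ''tmp''" "X \<noteq> ''quot''" using X by auto
  note [simp] = X' X'[symmetric]
  define c where "c = Seq (search X)
         (Seq (NAssign X (NVar ''col'') (NAdd (NVar ''row'') (NConst 1)))
           (eliminate X e))"
  have wr: "insert ''t'' (writes c) = writes (gauss X e)" by (auto simp: c_def)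
  have q1: "1 < q" using prime_gt_1_nat[OF q] .
  define I where "I m t \<longleftrightarrow> echelon q n N k (fmem s X) m (fmem t X) (nmem t X)"
    for m and t :: "int memory"
  show ?thesis
    unfolding gauss_def c_def[symmetric]
  proof (rule wp_For[where I = I and N = k and v = "n * k + N * (2 * k + 1)"])
    show "I 0 s" using red inj pv0 by (auto simp: I_def echelon_def)
    show "wp ?R c (n * k + N * (2 * k + 1)) (I (Suc m)) t"
      if "m < k" and st: "same (insert ''t'' (writes c)) s t" and "I m t" for m t
    proof -
      let ?X = "fmem t X" and ?pv = "nmem t X"
      have n': "nmem t ''n'' 0 = n" "nmem t ''k'' 0 = k" using n k st by (auto simp: wr same_def)
      have E: "echelon q n N k (fmem s X) m ?X ?pv" using \<open>I m t\<close> by (simp add: I_def)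
      have sr: "wp ?R (search X) (n * k)
          (\<lambda>t'. is_pivot n k ?X ?pv (nmem t' ''row'' 0) (nmem t' ''col'' 0)) t"
        using echelon_exists_pivot[OF q E \<open>m < k\<close>] n' by (intro wp_search) auto
      show ?thesis unfolding c_def
      proof (rule wp_Seq[OF wp_mono[OF sr]], rule le_refl)
        fix t' :: "int memory"
        assume piv: "is_pivot n k ?X ?pv (nmem t' ''row'' 0) (nmem t' ''col'' 0)"
          and st': "same (writes (search X)) t t'"
        define r p where "r = nmem t' ''row'' 0" and "p = nmem t' ''col'' 0"
        note piv = piv[folded r_def p_def, unfolded is_pivot_def]
        have same: "nmem t' X = ?pv" "fmem t' X = ?X" "nmem t' ''k'' 0 = k"
          using st' n' by (auto simp: same_def)
        let ?t = "nupd X p (Suc r) t'"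
        have "wp ?R (eliminate X e) (N * (2 * k + 1))
           (\<lambda>u. nmem u X = nmem ?t X \<and> (\<forall>i<N. \<forall>j<k. fmem u X i j = eliminated q (fmem ?t X) r p i j)) ?t"
        proof (rule wp_eliminate)
          show "nval e u = N" if "same {''i'', ''j'', ''tmp'', ''quot'', X} ?t u" for u
            using that st st' unfolding wr by (intro e) (auto simp: same_def)
        qed (use piv q1 same in \<open>auto simp: r_def p_def\<close>)
        then have "wp ?R (eliminate X e) (N * (2 * k + 1)) (I (Suc m)) ?t"
        proof (rule wp_mono[OF _ le_refl])
          fix u :: "int memory"
          assume "nmem u X = nmem ?t X \<and> (\<forall>i<N. \<forall>j<k. fmem u X i j = eliminated q (fmem ?t X) r p i j)"
          then have u: "nmem u X = ?pv(p := Suc r)"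
            "\<And>i j. \<lbrakk>i < N; j < k\<rbrakk> \<Longrightarrow> fmem u X i j = eliminated q ?X r p i j" using same by auto
          have redX: "0 \<le> ?X i j" "?X i j < int q" if "i < N" "j < k" for i j
            using E that by (auto simp: echelon_def)
          define d where "d i = quot q (?X i p) (?X r p)" for i
          have d: "[d i * ?X r p = ?X i p] (mod int q)" for i
            using residue_ring_inv_cong[OF q, of "?X r p" "?X i p"] redX[of r p] piv nN
            by (auto simp: d_def quot_def)
          have d_red: "0 \<le> d i \<and> d i < int q" for i using q1 by (auto simp: d_def quot_def)
          have "echelon q n N k (fmem s X) (Suc m) (fmem u X) (?pv(p := Suc r))"
          proof (rule echelon_step[OF q nN E, where c = d])
            show "[fmem u X i j = (if j = p then d i else ?X i j - d i * ?X r j)] (mod int q)"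
              if "i < N" "j < k" for i j
              using u(2)[OF that] by (auto simp: eliminated_def d_def cong_def mod_simps)
            show "0 \<le> fmem u X i j \<and> fmem u X i j < int q" if "i < N" "j < k" for i j
              using u(2)[OF that] d_red[of i] q1 by (auto simp: eliminated_def d_def)
          qed (use piv d in auto)
          then show "I (Suc m) u" using u by (simp add: I_def)
        qed
        then show "wp ?R (Seq (NAssign X (NVar ''col'') (NAdd (NVar ''row'') (NConst 1))) (eliminate X e))
            (N * (2 * k + 1)) (I (Suc m)) t'"
          by (simp add: r_def p_def)
      qed simp
    qed
    show "nval (NVar ''k'') t = k" if "same (insert ''t'' (writes c)) s t" for t
      using that k unfolding wr by (auto simp: same_def)
  qed (auto simp: c_def I_def)
qed

section \<open>Stacking the inputs\<close>

definition load_rows :: com where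
  "load_rows =
     For ''i'' (NVar ''n'') (For ''j'' (NVar ''k'')
       (Seq (FAssign ''M'' (NVar ''i'') (NVar ''j'') (FGet ''A'' (NGet ''P'' (NVar ''i'')) (NVar ''j'')))
         (FAssign ''G'' (NVar ''i'') (NVar ''j'') (FGet ''H'' (NVar ''i'') (NVar ''j'')))))"

definition load_key_row :: com where
  "load_key_row =
     For ''j'' (NVar ''k'')
       (Seq (FAssign ''M'' (NVar ''n'') (NVar ''j'') (FGet ''u'' (NVar ''j'') (NConst 0)))
         (Seq (FAssign ''G'' (NVar ''n'') (NVar ''j'') FZero)
           (For ''i'' (NVar ''n'')
             (FAssign ''G'' (NVar ''n'') (NVar ''j'')
               (FAdd (FGet ''G'' (NVar ''n'') (NVar ''j''))
                 (FMul (FGet ''rs'' (NVar ''i'') (NConst 0)) (FGet ''H'' (NVar ''i'') (NVar ''j''))))))))"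

definition load_identity :: com where
  "load_identity =
     For ''i'' (NVar ''k'')
       (Seq (For ''j'' (NVar ''k'')
              (FAssign ''M'' (NAdd (NAdd (NVar ''n'') (NConst 1)) (NVar ''i'')) (NVar ''j'') FZero))
         (FAssign ''M'' (NAdd (NAdd (NVar ''n'') (NConst 1)) (NVar ''i'')) (NVar ''i'') FOne))"

text \<open>Layout of \<open>M\<close>: rows 0 to \<open>n - 1\<close> hold the permuted
  \<open>A\<close>, row \<open>n\<close> holds \<open>u\<close>, and row \<open>n + 1 + i\<close>
  the i-th unit row. \<open>G\<close> has no identity rows, because only the column operations on
  \<open>M\<close> enter the output. Copying is free; only the product in row \<open>n\<close> of
  \<open>G\<close> costs.\<close>

definition load :: com where
  "load = Seq load_rows (Seq load_key_row load_identity)"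

lemma writes_load [simp]: "writes load = {''i'', ''j'', ''M'', ''G''}"
  by (auto simp: load_def load_rows_def load_key_row_def load_identity_def)

lemma wp_load_rows:
  fixes s :: "int memory"
  assumes n: "nmem s ''n'' 0 = n" and k: "nmem s ''k'' 0 = k"
  shows "wp R load_rows 0
    (\<lambda>t. nmem t ''M'' = nmem s ''M'' \<and> nmem t ''G'' = nmem s ''G'' \<and>
      (\<forall>i<n. \<forall>j<k. fmem t ''M'' i j = fmem s ''A'' (nmem s ''P'' i) j) \<and>
      (\<forall>i<n. \<forall>j<k. fmem t ''G'' i j = fmem s ''H'' i j)) s"
proof -
  define I where "I i t \<longleftrightarrow> nmem t ''M'' = nmem s ''M'' \<and> nmem t ''G'' = nmem s ''G'' \<and>
      (\<forall>i'<i. \<forall>j<k. fmem t ''M'' i' j = fmem s ''A'' (nmem s ''P'' i') j) \<and>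
      (\<forall>i'<i. \<forall>j<k. fmem t ''G'' i' j = fmem s ''H'' i' j)" for i and t :: "int memory"
  show ?thesis
    unfolding load_rows_def
  proof (rule wp_For[where I = I and N = n and v = 0])
    fix i and t :: "int memory"
    assume i: "i < n" "nmem t ''i'' 0 = i" "I i t"
      and st: "same (insert ''i'' (writes (For ''j'' (NVar ''k'')
       (Seq (FAssign ''M'' (NVar ''i'') (NVar ''j'') (FGet ''A'' (NGet ''P'' (NVar ''i'')) (NVar ''j'')))
         (FAssign ''G'' (NVar ''i'') (NVar ''j'') (FGet ''H'' (NVar ''i'') (NVar ''j''))))))) s t"
    show "wp R (For ''j'' (NVar ''k'')
       (Seq (FAssign ''M'' (NVar ''i'') (NVar ''j'') (FGet ''A'' (NGet ''P'' (NVar ''i'')) (NVar ''j'')))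
         (FAssign ''G'' (NVar ''i'') (NVar ''j'') (FGet ''H'' (NVar ''i'') (NVar ''j''))))) 0 (I (Suc i)) t"
    proof (rule wp_For[where I = "\<lambda>j t. I i t \<and> (\<forall>j'<j. fmem t ''M'' i j' = fmem s ''A'' (nmem s ''P'' i) j')
           \<and> (\<forall>j'<j. fmem t ''G'' i j' = fmem s ''H'' i j')" and N = k and v = 0])
    qed (use i st k in \<open>auto simp: I_def same_def less_Suc_eq\<close>)
  qed (use n in \<open>auto simp: I_def same_def\<close>)
qed

lemma wp_load_key_row:
  fixes s :: "int memory"
  assumes n: "nmem s ''n'' 0 = n" and k: "nmem s ''k'' 0 = k"
  shows "wp (residue_ring (int q)) load_key_row (k * (n * 2))
    (\<lambda>t. nmem t ''M'' = nmem s ''M'' \<and> nmem t ''G'' = nmem s ''G'' \<and>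
      (\<forall>j<k. fmem t ''M'' n j = fmem s ''u'' j 0) \<and>
      (\<forall>j<k. fmem t ''G'' n j = (\<Sum>i<n. fmem s ''rs'' i 0 * fmem s ''H'' i j) mod int q) \<and>
      (\<forall>i. i \<noteq> n \<longrightarrow> fmem t ''M'' i = fmem s ''M'' i \<and> fmem t ''G'' i = fmem s ''G'' i)) s"
proof -
  define F where "F t \<longleftrightarrow> nmem t ''M'' = nmem s ''M'' \<and> nmem t ''G'' = nmem s ''G'' \<and>
      (\<forall>i. i \<noteq> n \<longrightarrow> fmem t ''M'' i = fmem s ''M'' i \<and> fmem t ''G'' i = fmem s ''G'' i)" for t :: "int memory"
  define I where "I j t \<longleftrightarrow> F t \<and>
      (\<forall>j'<j. fmem t ''M'' n j' = fmem s ''u'' j' 0) \<and>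
      (\<forall>j'<j. fmem t ''G'' n j' = (\<Sum>i<n. fmem s ''rs'' i 0 * fmem s ''H'' i j') mod int q)"
    for j and t :: "int memory"
  show ?thesis
    unfolding load_key_row_def
  proof (rule wp_For[where I = I and N = k and v = "n * 2"])
    fix j and t :: "int memory"
    let ?c = "FAssign ''G'' (NVar ''n'') (NVar ''j'')
               (FAdd (FGet ''G'' (NVar ''n'') (NVar ''j''))
                 (FMul (FGet ''rs'' (NVar ''i'') (NConst 0)) (FGet ''H'' (NVar ''i'') (NVar ''j''))))"
    assume j: "j < k" "nmem t ''j'' 0 = j" "I j t"
      and "same (insert ''j'' (writes (Seq (FAssign ''M'' (NVar ''n'') (NVar ''j'') (FGet ''u'' (NVar ''j'') (NConst 0)))
         (Seq (FAssign ''G'' (NVar ''n'') (NVar ''j'') FZero) (For ''i'' (NVar ''n'') ?c))))) s t"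
    then have st: "nmem t ''n'' 0 = n" "fmem t ''rs'' = fmem s ''rs''" "fmem t ''H'' = fmem s ''H''"
      "fmem t ''u'' = fmem s ''u''"
      using n by (auto simp: same_def)
    let ?t = "fupd ''G'' n j 0 (fupd ''M'' n j (fmem s ''u'' j 0) t)"
    have "wp (residue_ring (int q)) (For ''i'' (NVar ''n'') ?c) (n * 2) (I (Suc j)) ?t"
    proof (rule wp_For[where N = n and v = 2 and I = "\<lambda>i t. I j t \<and> fmem t ''M'' n j = fmem s ''u'' j 0 \<and>
         fmem t ''G'' n j = (\<Sum>i'<i. fmem s ''rs'' i' 0 * fmem s ''H'' i' j) mod int q"])
      show "wp (residue_ring (int q)) ?c 2 (\<lambda>t. I j t \<and> fmem t ''M'' n j = fmem s ''u'' j 0 \<and>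
         fmem t ''G'' n j = (\<Sum>i'<Suc i. fmem s ''rs'' i' 0 * fmem s ''H'' i' j) mod int q) t'"
        if "same (insert ''i'' (writes ?c)) ?t t'" "nmem t' ''i'' 0 = i" "I j t' \<and> fmem t' ''M'' n j = fmem s ''u'' j 0 \<and>
         fmem t' ''G'' n j = (\<Sum>i'<i. fmem s ''rs'' i' 0 * fmem s ''H'' i' j) mod int q" for i t'
      proof -
        have "nmem t' ''n'' 0 = n" "nmem t' ''j'' 0 = j" "fmem t' ''rs'' = fmem s ''rs''" "fmem t' ''H'' = fmem s ''H''"
          using that(1) st j by (auto simp: same_def)
        then show ?thesis using that(2,3) by (auto simp: I_def F_def mod_simps)
      qed
    qed (use st j in \<open>auto simp: I_def F_def same_def less_Suc_eq\<close>)
    then show "wp (residue_ring (int q)) (Seq (FAssign ''M'' (NVar ''n'') (NVar ''j'') (FGet ''u'' (NVar ''j'') (NConst 0)))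
         (Seq (FAssign ''G'' (NVar ''n'') (NVar ''j'') FZero) (For ''i'' (NVar ''n'') ?c))) (n * 2) (I (Suc j)) t"
      using st j by simp
  qed (use k in \<open>auto simp: I_def F_def same_def\<close>)
qed

lemma wp_load_identity:
  fixes s :: "int memory"
  assumes n: "nmem s ''n'' 0 = n" and k: "nmem s ''k'' 0 = k"
  shows "wp (residue_ring (int q)) load_identity 0
    (\<lambda>t. nmem t ''M'' = nmem s ''M'' \<and>
      (\<forall>i<k. \<forall>j<k. fmem t ''M'' (n + 1 + i) j = (if i = j then 1 else 0)) \<and>
      (\<forall>i\<le>n. fmem t ''M'' i = fmem s ''M'' i)) s"
proof -
  define F where "F t \<longleftrightarrow> nmem t ''M'' = nmem s ''M'' \<and>
      (\<forall>i\<le>n. fmem t ''M'' i = fmem s ''M'' i)" for t :: "int memory"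
  define I where "I i t \<longleftrightarrow> F t \<and> (\<forall>i'<i. \<forall>j<k. fmem t ''M'' (n + 1 + i') j = (if i' = j then 1 else 0))"
    for i and t :: "int memory"
  show ?thesis
    unfolding load_identity_def
  proof (rule wp_For[where I = I and N = k and v = 0])
    fix i and t :: "int memory"
    let ?c = "FAssign ''M'' (NAdd (NAdd (NVar ''n'') (NConst 1)) (NVar ''i'')) (NVar ''j'') FZero"
    let ?d = "FAssign ''M'' (NAdd (NAdd (NVar ''n'') (NConst 1)) (NVar ''i'')) (NVar ''i'') FOne"
    assume i: "i < k" "nmem t ''i'' 0 = i" "I i t"
      and "same (insert ''i'' (writes (Seq (For ''j'' (NVar ''k'') ?c) ?d))) s t"
    then have st: "nmem t ''n'' 0 = n" "nmem t ''k'' 0 = k" using n k by (auto simp: same_def)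
    have "wp (residue_ring (int q)) (For ''j'' (NVar ''k'') ?c) 0
        (wp (residue_ring (int q)) ?d 0 (I (Suc i))) t"
    proof (rule wp_For[where N = k and v = 0 and I = "\<lambda>j t. I i t \<and> (\<forall>j'<j. fmem t ''M'' (n + 1 + i) j' = 0)"])
    qed (use st i in \<open>auto simp: I_def F_def same_def less_Suc_eq\<close>)
    then show "wp (residue_ring (int q)) (Seq (For ''j'' (NVar ''k'') ?c) ?d) 0 (I (Suc i)) t"
      by (rule wp_Seq) simp
  qed (use k in \<open>auto simp: I_def F_def same_def\<close>)
qed

lemma wp_load:
  fixes s :: "int memory"
  assumes n: "nmem s ''n'' 0 = n" and k: "nmem s ''k'' 0 = k"
  shows "wp (residue_ring (int q)) load (k * (n * 2))
    (\<lambda>t. nmem t ''M'' = nmem s ''M'' \<and> nmem t ''G'' = nmem s ''G'' \<and>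
      (\<forall>i<n. \<forall>j<k. fmem t ''M'' i j = fmem s ''A'' (nmem s ''P'' i) j) \<and>
      (\<forall>j<k. fmem t ''M'' n j = fmem s ''u'' j 0) \<and>
      (\<forall>i<k. \<forall>j<k. fmem t ''M'' (n + 1 + i) j = (if i = j then 1 else 0)) \<and>
      (\<forall>i<n. \<forall>j<k. fmem t ''G'' i j = fmem s ''H'' i j) \<and>
      (\<forall>j<k. fmem t ''G'' n j = (\<Sum>i<n. fmem s ''rs'' i 0 * fmem s ''H'' i j) mod int q)) s"
  unfolding load_def
proof (rule wp_Seq[OF wp_mono[OF wp_load_rows[OF n k]]], rule le_refl)
  fix t :: "int memory"
  assume t: "nmem t ''M'' = nmem s ''M'' \<and> nmem t ''G'' = nmem s ''G'' \<and>
      (\<forall>i<n. \<forall>j<k. fmem t ''M'' i j = fmem s ''A'' (nmem s ''P'' i) j) \<and>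
      (\<forall>i<n. \<forall>j<k. fmem t ''G'' i j = fmem s ''H'' i j)" and "same (writes load_rows) s t"
  then have st: "nmem t ''n'' 0 = n" "nmem t ''k'' 0 = k" "fmem t ''u'' = fmem s ''u''"
    "fmem t ''rs'' = fmem s ''rs''" "fmem t ''H'' = fmem s ''H''"
    using n k by (auto simp: same_def load_rows_def)
  let ?R = "residue_ring (int q)"
  show "wp ?R (Seq load_key_row load_identity) (k * (n * 2)) (\<lambda>t. nmem t ''M'' = nmem s ''M'' \<and> nmem t ''G'' = nmem s ''G'' \<and>
      (\<forall>i<n. \<forall>j<k. fmem t ''M'' i j = fmem s ''A'' (nmem s ''P'' i) j) \<and>
      (\<forall>j<k. fmem t ''M'' n j = fmem s ''u'' j 0) \<and>
      (\<forall>i<k. \<forall>j<k. fmem t ''M'' (n + 1 + i) j = (if i = j then 1 else 0)) \<and>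
      (\<forall>i<n. \<forall>j<k. fmem t ''G'' i j = fmem s ''H'' i j) \<and>
      (\<forall>j<k. fmem t ''G'' n j = (\<Sum>i<n. fmem s ''rs'' i 0 * fmem s ''H'' i j) mod int q)) t"
  proof (rule wp_Seq[OF wp_mono[OF wp_load_key_row[OF st(1,2)]]], rule le_refl)
    fix t' :: "int memory"
    assume t': "nmem t' ''M'' = nmem t ''M'' \<and> nmem t' ''G'' = nmem t ''G'' \<and>
      (\<forall>j<k. fmem t' ''M'' n j = fmem t ''u'' j 0) \<and>
      (\<forall>j<k. fmem t' ''G'' n j = (\<Sum>i<n. fmem t ''rs'' i 0 * fmem t ''H'' i j) mod int q) \<and>
      (\<forall>i. i \<noteq> n \<longrightarrow> fmem t' ''M'' i = fmem t ''M'' i \<and> fmem t' ''G'' i = fmem t ''G'' i)"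
      and "same (writes load_key_row) t t'"
    then have st': "nmem t' ''n'' 0 = n" "nmem t' ''k'' 0 = k"
      using st by (auto simp: same_def load_key_row_def)
    show "wp ?R load_identity 0 (\<lambda>t. nmem t ''M'' = nmem s ''M'' \<and> nmem t ''G'' = nmem s ''G'' \<and>
      (\<forall>i<n. \<forall>j<k. fmem t ''M'' i j = fmem s ''A'' (nmem s ''P'' i) j) \<and>
      (\<forall>j<k. fmem t ''M'' n j = fmem s ''u'' j 0) \<and>
      (\<forall>i<k. \<forall>j<k. fmem t ''M'' (n + 1 + i) j = (if i = j then 1 else 0)) \<and>
      (\<forall>i<n. \<forall>j<k. fmem t ''G'' i j = fmem s ''H'' i j) \<and>
      (\<forall>j<k. fmem t ''G'' n j = (\<Sum>i<n. fmem s ''rs'' i 0 * fmem s ''H'' i j) mod int q)) t'"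
    proof (rule wp_mono[OF wp_load_identity[OF st'] le_refl])
      fix u :: "int memory"
      assume u: "nmem u ''M'' = nmem t' ''M'' \<and>
        (\<forall>i<k. \<forall>j<k. fmem u ''M'' (n + 1 + i) j = (if i = j then 1 else 0)) \<and>
        (\<forall>i\<le>n. fmem u ''M'' i = fmem t' ''M'' i)" and "same (writes load_identity) t' u"
      then have "nmem u ''G'' = nmem t' ''G''" "fmem u ''G'' = fmem t' ''G''"
        by (auto simp: same_def load_identity_def)
      then show "nmem u ''M'' = nmem s ''M'' \<and> nmem u ''G'' = nmem s ''G'' \<and>
      (\<forall>i<n. \<forall>j<k. fmem u ''M'' i j = fmem s ''A'' (nmem s ''P'' i) j) \<and>
      (\<forall>j<k. fmem u ''M'' n j = fmem s ''u'' j 0) \<and>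
      (\<forall>i<k. \<forall>j<k. fmem u ''M'' (n + 1 + i) j = (if i = j then 1 else 0)) \<and>
      (\<forall>i<n. \<forall>j<k. fmem u ''G'' i j = fmem s ''H'' i j) \<and>
      (\<forall>j<k. fmem u ''G'' n j = (\<Sum>i<n. fmem s ''rs'' i 0 * fmem s ''H'' i j) mod int q)"
        using u t t' st by simp
    qed
  qed simp
qed simp

section \<open>Propagating signs\<close>

definition NEq :: "nexp \<Rightarrow> nexp \<Rightarrow> bexp" where
  "NEq a b = BAnd (BNot (NLess a b)) (BNot (NLess b a))"

lemma NEq [simp]: "bval R (NEq a b) s \<longleftrightarrow> nval a s = nval b s" "bcost (NEq a b) = 0"
  by (auto simp: NEq_def)

text \<open>Exclusive or as a + b - 2ab; on bits the truncated subtraction is exact.\<close>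

definition NXor :: "nexp \<Rightarrow> nexp \<Rightarrow> nexp" where
  "NXor a b = NSub (NAdd a b) (NMul (NConst 2) (NMul a b))"

text \<open>Equals (-1)^b on bits, so that \<open>NXor\<close> becomes multiplication of
  signs.\<close>

definition bit_sign :: "nat \<Rightarrow> int" where
  "bit_sign b = 1 - 2 * int b"

lemma NXor:
  assumes "nval a s \<le> 1" "nval b s \<le> 1"
  shows "nval (NXor a b) s \<le> 1" "bit_sign (nval (NXor a b) s) = bit_sign (nval a s) * bit_sign (nval b s)"
proof -
  have "nval a s = 0 \<or> nval a s = 1" "nval b s = 0 \<or> nval b s = 1" using assms by auto
  then show "nval (NXor a b) s \<le> 1" "bit_sign (nval (NXor a b) s) = bit_sign (nval a s) * bit_sign (nval b s)"
    by (auto simp: NXor_def bit_sign_def)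
qed

definition relabel :: com where
  "relabel =
     For ''l'' (NAdd (NVar ''n'') (NConst 1))
       (IfElse (NEq (NGet ''comp'' (NVar ''l'')) (NVar ''old''))
         (Seq (NAssign ''comp'' (NVar ''l'') (NVar ''new''))
           (NAssign ''sign'' (NVar ''l'') (NXor (NGet ''sign'' (NVar ''l'')) (NVar ''flip''))))
         Skip)"

text \<open>Equal entries in both forms mean relative sign 1, different ones -1. With
  \<open>flip\<close> set to this sign times the current signs of \<open>i\<close> and of the pivot
  row, flipping the whole component of the pivot row corrects the relative sign across the edge and
  keeps all those inside that component.\<close>

definition join :: com where
  "join =
     IfElse (BNot (FEq (FGet ''M'' (NVar ''i'') (NVar ''j'')) FZero))
       (Seq (IfElse (FEq (FGet ''M'' (NVar ''i'') (NVar ''j'')) (FGet ''G'' (NVar ''i'') (NVar ''h'')))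
              (NAssign ''flip'' (NConst 0) (NConst 0)) (NAssign ''flip'' (NConst 0) (NConst 1)))
         (Seq (NAssign ''new'' (NConst 0) (NGet ''comp'' (NVar ''i'')))
           (Seq (NAssign ''old'' (NConst 0) (NGet ''comp'' (NSub (NGet ''M'' (NVar ''j'')) (NConst 1))))
             (Seq (NAssign ''flip'' (NConst 0)
                    (NXor (NVar ''flip'')
                      (NXor (NGet ''sign'' (NVar ''i''))
                        (NGet ''sign'' (NSub (NGet ''M'' (NVar ''j'')) (NConst 1))))))
               relabel))))
       Skip"

definition join_column :: com where
  "join_column =
     IfElse (NEq (NGet ''M'' (NVar ''j'')) (NGet ''G'' (NVar ''h'')))
       (For ''i'' (NAdd (NVar ''n'') (NConst 1)) join) Skip"

definition connect :: com where
  "connect =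
     Seq (For ''i'' (NAdd (NVar ''n'') (NConst 1))
           (Seq (NAssign ''comp'' (NVar ''i'') (NVar ''i'')) (NAssign ''sign'' (NVar ''i'') (NConst 0))))
       (For ''j'' (NVar ''k'') (For ''h'' (NVar ''k'') join_column))"

lemma writes_relabel [simp]: "writes relabel = {''l'', ''comp'', ''sign''}"
  by (auto simp: relabel_def)

lemma writes_join [simp]: "writes join = {''l'', ''comp'', ''sign'', ''flip'', ''new'', ''old''}"
  by (auto simp: join_def)

lemma writes_join_column [simp]:
  "writes join_column = {''i'', ''l'', ''comp'', ''sign'', ''flip'', ''new'', ''old''}"
  by (auto simp: join_column_def)

lemma writes_connect [simp]:
  "writes connect = {''i'', ''j'', ''h'', ''l'', ''comp'', ''sign'', ''flip'', ''new'', ''old''}"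
  by (auto simp: connect_def)

lemma wp_relabel:
  fixes s :: "int memory"
  assumes n: "nmem s ''n'' 0 = n" and old: "nmem s ''old'' 0 = b" and new: "nmem s ''new'' 0 = a"
    and flip: "nmem s ''flip'' 0 = f" "f \<le> 1" and sign: "\<And>l. l \<le> n \<Longrightarrow> nmem s ''sign'' l \<le> 1"
  shows "wp R relabel 0 (\<lambda>t. \<forall>l\<le>n.
      nmem t ''comp'' l = (if nmem s ''comp'' l = b then a else nmem s ''comp'' l) \<and>
      nmem t ''sign'' l \<le> 1 \<and> bit_sign (nmem t ''sign'' l) =
        (if nmem s ''comp'' l = b then bit_sign (nmem s ''sign'' l) * bit_sign f
         else bit_sign (nmem s ''sign'' l))) s"
proof -
  define I where "I m t \<longleftrightarrow> (\<forall>l<m. 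
      nmem t ''comp'' l = (if nmem s ''comp'' l = b then a else nmem s ''comp'' l) \<and>
      nmem t ''sign'' l \<le> 1 \<and> bit_sign (nmem t ''sign'' l) =
        (if nmem s ''comp'' l = b then bit_sign (nmem s ''sign'' l) * bit_sign f
         else bit_sign (nmem s ''sign'' l))) \<and>
      (\<forall>l\<ge>m. nmem t ''comp'' l = nmem s ''comp'' l \<and> nmem t ''sign'' l = nmem s ''sign'' l)"
    for m and t :: "int memory"
  show ?thesis
    unfolding relabel_def
  proof (rule wp_For[where I = I and N = "n + 1" and v = 0])
    fix l and t :: "int memory"
    let ?c = "IfElse (NEq (NGet ''comp'' (NVar ''l'')) (NVar ''old''))
         (Seq (NAssign ''comp'' (NVar ''l'') (NVar ''new''))
           (NAssign ''sign'' (NVar ''l'') (NXor (NGet ''sign'' (NVar ''l'')) (NVar ''flip''))))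
         Skip"
    assume l: "l < n + 1" "nmem t ''l'' 0 = l" "I l t"
      and "same (insert ''l'' (writes ?c)) s t"
    then have st: "nmem t ''old'' 0 = b" "nmem t ''new'' 0 = a" "nmem t ''flip'' 0 = f"
      using old new flip by (auto simp: same_def)
    let ?t = "nupd ''comp'' l a t"
    let ?x = "nval (NXor (NGet ''sign'' (NVar ''l'')) (NVar ''flip'')) ?t"
    have sg: "nmem t ''comp'' l = nmem s ''comp'' l" "nmem t ''sign'' l = nmem s ''sign'' l"
      using l by (auto simp: I_def)
    have x: "?x \<le> 1" "bit_sign ?x = bit_sign (nmem s ''sign'' l) * bit_sign f"
      using NXor[of "NGet ''sign'' (NVar ''l'')" ?t "NVar ''flip''"] st l sg sign[of l] flip by auto
    show "wp R ?c 0 (I (Suc l)) t"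
    proof (cases "nmem s ''comp'' l = b")
      case True
      have "I (Suc l) (nupd ''sign'' l ?x ?t)" using l True x by (auto simp: I_def less_Suc_eq)
      then show ?thesis using True st sg l by simp
    next
      case False
      then show ?thesis using st sg l sign[of l] by (auto simp: I_def less_Suc_eq)
    qed
  qed (use n in \<open>auto simp: I_def same_def\<close>)
qed

text \<open>\<open>L\<close> collects the edges processed so far; signs are determined up to one global sign per
  component, so only products within a component are meaningful.\<close>

definition coherent :: "nat \<Rightarrow> (nat \<Rightarrow> int) \<Rightarrow> (nat \<times> nat) set \<Rightarrow> int memory \<Rightarrow> bool" where
  "coherent n d L t \<longleftrightarrow> (\<forall>l\<le>n. nmem t ''sign'' l \<le> 1) \<and>
     (\<forall>l\<le>n. \<forall>l'\<le>n. nmem t ''comp'' l = nmem t ''comp'' l' \<longrightarrow>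
        bit_sign (nmem t ''sign'' l) * bit_sign (nmem t ''sign'' l') = d l * d l') \<and>
     (\<forall>(a, b)\<in>L. nmem t ''comp'' a = nmem t ''comp'' b)"

text \<open>The two units of cost are the test against zero and the comparison of the two echelon
  entries; the bookkeeping on labels is free.\<close>

lemma wp_join:
  fixes s :: "int memory"
  assumes n: "nmem s ''n'' 0 = n" and i: "nmem s ''i'' 0 = i" "i \<le> n" and j: "nmem s ''j'' 0 = j"
    and h: "nmem s ''h'' 0 = h" and b: "nmem s ''M'' j - 1 = b" "b \<le> n"
    and d: "\<And>l. l \<le> n \<Longrightarrow> d l * d l = 1"
    and L: "L \<subseteq> {..n} \<times> {..n}" and coh: "coherent n d L s"
    and edge: "fmem s ''M'' i j \<noteq> 0 \<Longrightarrow>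
      d i * d b = (if fmem s ''M'' i j = fmem s ''G'' i h then 1 else -1)"
  shows "wp (residue_ring (int q)) join 2
    (coherent n d (if fmem s ''M'' i j = 0 then L else insert (i, b) L)) s"
proof (cases "fmem s ''M'' i j = 0")
  case True
  then show ?thesis using i j coh by (simp add: join_def)
next
  case False
  let ?g = "if fmem s ''M'' i j = fmem s ''G'' i h then 0 else 1 :: nat"
  let ?sg = "nmem s ''sign''" and ?cm = "nmem s ''comp''"
  let ?s1 = "nupd ''flip'' 0 ?g s"
  let ?s2 = "nupd ''old'' 0 (?cm b) (nupd ''new'' 0 (?cm i) ?s1)"
  let ?e = "NXor (NGet ''sign'' (NVar ''i'')) (NGet ''sign'' (NSub (NGet ''M'' (NVar ''j'')) (NConst 1)))"
  let ?f = "nval (NXor (NVar ''flip'') ?e) ?s2"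
  let ?s3 = "nupd ''flip'' 0 ?f ?s2"
  have bits: "?sg l \<le> 1" if "l \<le> n" for l using coh that by (simp add: coherent_def)
  have e: "nval ?e ?s2 \<le> 1" "bit_sign (nval ?e ?s2) = bit_sign (?sg i) * bit_sign (?sg b)"
    using NXor[of "NGet ''sign'' (NVar ''i'')" ?s2 "NGet ''sign'' (NSub (NGet ''M'' (NVar ''j'')) (NConst 1))"]
      i j b bits by auto
  have f0: "bit_sign ?g = d i * d b" using edge[OF False] by (auto simp: bit_sign_def)
  have fv: "nval (NVar ''flip'') ?s2 = ?g" by simp
  have "?g \<le> 1" by simp
  note f = NXor[of "NVar ''flip''" ?s2 ?e, unfolded fv, OF this e(1), unfolded f0 e(2)]
  have "wp (residue_ring (int q)) relabel 0 (coherent n d (insert (i, b) L)) ?s3"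
  proof (rule wp_mono[OF wp_relabel])
    fix t :: "int memory"
    assume t: "\<forall>l\<le>n. nmem t ''comp'' l = (if nmem ?s3 ''comp'' l = ?cm b then ?cm i else nmem ?s3 ''comp'' l) \<and>
      nmem t ''sign'' l \<le> 1 \<and> bit_sign (nmem t ''sign'' l) =
        (if nmem ?s3 ''comp'' l = ?cm b then bit_sign (nmem ?s3 ''sign'' l) * bit_sign ?f
         else bit_sign (nmem ?s3 ''sign'' l))"
    have cm: "nmem t ''comp'' l = (if ?cm l = ?cm b then ?cm i else ?cm l)"
      and sg: "nmem t ''sign'' l \<le> 1"
      and sgn: "bit_sign (nmem t ''sign'' l) =
        (if ?cm l = ?cm b then bit_sign (?sg l) * bit_sign ?f else bit_sign (?sg l))" if "l \<le> n" for l
      using t that by auto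
    have prod: "bit_sign (?sg l) * bit_sign (?sg l') = d l * d l'" if "l \<le> n" "l' \<le> n" "?cm l = ?cm l'" for l l'
      using coh that by (simp add: coherent_def)
    have sq: "bit_sign (?sg l) * bit_sign (?sg l) = 1" if "l \<le> n" for l
      using prod[of l l] d that by simp
    \<comment> \<open>Two rows of the flipped component change together, so only the square of
      \<open>bit_sign ?f\<close> matters. This also covers an edge inside one component, where
      flipping is harmless.\<close>
    have ff: "bit_sign ?f * bit_sign ?f = 1"
    proof -
      have "bit_sign ?f * bit_sign ?f = (d i * d i) * (d b * d b) *
        ((bit_sign (?sg i) * bit_sign (?sg i)) * (bit_sign (?sg b) * bit_sign (?sg b)))"
        unfolding f(2) by (simp add: algebra_simps)
      then show ?thesis using d sq i b by simp
    qed
    \<comment> \<open>A newly joined pair is connected through the edge: the product is expanded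
      along \<open>l\<close>, \<open>b\<close>, \<open>i\<close>, \<open>l'\<close>, and the squares
      cancel.\<close>
    have mixed: "bit_sign (?sg l) * bit_sign ?f * bit_sign (?sg l') = d l * d l'"
      if "l \<le> n" "l' \<le> n" "?cm l = ?cm b" "?cm l' = ?cm i" for l l'
    proof -
      have "bit_sign (?sg l) * bit_sign ?f * bit_sign (?sg l') =
         d i * d b * ((bit_sign (?sg l) * bit_sign (?sg b)) * (bit_sign (?sg l') * bit_sign (?sg i)))"
        unfolding f(2) by (simp add: algebra_simps)
      also have "\<dots> = d i * d b * ((d l * d b) * (d l' * d i))" using prod that i b by simp
      also have "\<dots> = d l * d l' * ((d i * d i) * (d b * d b))" by (simp add: algebra_simps)
      finally show ?thesis using d i b by simp
    qed
    have "bit_sign (nmem t ''sign'' l) * bit_sign (nmem t ''sign'' l') = d l * d l'"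
      if l: "l \<le> n" "l' \<le> n" and c: "nmem t ''comp'' l = nmem t ''comp'' l'" for l l'
    proof -
      consider "?cm l = ?cm b" "?cm l' = ?cm b" | "?cm l = ?cm b" "?cm l' \<noteq> ?cm b" "?cm l' = ?cm i"
        | "?cm l \<noteq> ?cm b" "?cm l' = ?cm b" "?cm l = ?cm i" | "?cm l \<noteq> ?cm b" "?cm l' \<noteq> ?cm b" "?cm l = ?cm l'"
        using c cm l by (auto split: if_splits)
      then show ?thesis
      proof cases
        case 1
        then have "bit_sign (nmem t ''sign'' l) * bit_sign (nmem t ''sign'' l') =
          (bit_sign (?sg l) * bit_sign (?sg l')) * (bit_sign ?f * bit_sign ?f)"
          using sgn l by (simp only: if_True simp_thms) (simp only: ac_simps)
        then show ?thesis using prod l 1 ff by simp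
      next
        case 2
        then show ?thesis using sgn[OF l(1)] sgn[OF l(2)] mixed[OF l] by simp
      next
        case 3
        then show ?thesis using sgn[OF l(1)] sgn[OF l(2)] mixed[OF l(2,1)] by (simp add: mult.commute)
      next
        case 4
        then show ?thesis using sgn[OF l(1)] sgn[OF l(2)] prod[OF l] by simp
      qed
    qed
    moreover have "nmem t ''comp'' a = nmem t ''comp'' c" if "(a, c) \<in> insert (i, b) L" for a c
    proof -
      have "a \<le> n" "c \<le> n" "?cm a = ?cm c \<or> (a, c) = (i, b)"
        using that L i b coh by (auto simp: coherent_def)
      then show ?thesis using cm by auto
    qed
    ultimately show "coherent n d (insert (i, b) L) t" using sg by (auto simp: coherent_def)
  qed (use n f bits in auto)
  then show ?thesis
    using False i j h b unfolding join_def
    by simp (rule wp_Seq[where v = 1 and v' = 0], auto)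
qed

lemma wp_join_column:
  fixes s :: "int memory"
  assumes n: "nmem s ''n'' 0 = n" and j: "nmem s ''j'' 0 = j" and h: "nmem s ''h'' 0 = h"
    and b: "nmem s ''M'' j - 1 = b" "b \<le> n"
    and d: "\<And>l. l \<le> n \<Longrightarrow> d l * d l = 1"
    and L: "L \<subseteq> {..n} \<times> {..n}" and coh: "coherent n d L s"
    and edge: "\<And>i. \<lbrakk>i \<le> n; nmem s ''M'' j = nmem s ''G'' h; fmem s ''M'' i j \<noteq> 0\<rbrakk> \<Longrightarrow>
      d i * d b = (if fmem s ''M'' i j = fmem s ''G'' i h then 1 else -1)"
  shows "wp (residue_ring (int q)) join_column (Suc n * 2)
    (coherent n d (if nmem s ''M'' j = nmem s ''G'' h
       then L \<union> {(i, b) | i. i \<le> n \<and> fmem s ''M'' i j \<noteq> 0} else L)) s"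
proof (cases "nmem s ''M'' j = nmem s ''G'' h")
  case False
  then show ?thesis using j h coh by (simp add: join_column_def)
next
  case True
  define E where "E m = L \<union> {(i, b) | i. i < m \<and> fmem s ''M'' i j \<noteq> 0}" for m
  have "wp (residue_ring (int q)) (For ''i'' (NAdd (NVar ''n'') (NConst 1)) join) (Suc n * 2)
      (coherent n d (E (Suc n))) s"
  proof (rule wp_For[where I = "\<lambda>m. coherent n d (E m)" and N = "Suc n" and v = 2])
    fix i and t :: "int memory"
    assume i: "i < Suc n" "nmem t ''i'' 0 = i" "coherent n d (E i) t"
      and "same (insert ''i'' (writes join)) s t"
    then have st: "nmem t ''n'' 0 = n" "nmem t ''j'' 0 = j" "nmem t ''h'' 0 = h"
      "nmem t ''M'' = nmem s ''M''" "fmem t ''M'' = fmem s ''M''" "fmem t ''G'' = fmem s ''G''"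
      using n j h by (auto simp: same_def)
    have "E (Suc i) = (if fmem t ''M'' i j = 0 then E i else insert (i, b) (E i))"
      using st by (auto simp: E_def less_Suc_eq)
    moreover have "E i \<subseteq> {..n} \<times> {..n}" using L b i by (auto simp: E_def)
    ultimately show "wp (residue_ring (int q)) join 2 (coherent n d (E (Suc i))) t"
      using wp_join[of t n i j h b d "E i" q] i st b d edge[of i] True by simp
  qed (use n coh in \<open>auto simp: coherent_def E_def same_def\<close>)
  then show ?thesis using True j h by (simp add: join_column_def E_def less_Suc_eq_le)
qed

text \<open>\<open>partner\<close> ensures that every column of \<open>M\<close> meets a column of
  \<open>G\<close> with the same pivot row, so that all its edges are processed. The result speaks
  of products along edges because signs are fixed only up to one factor per component.\<close>

lemma wp_connect:
  fixes s :: "int memory"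
  assumes n: "nmem s ''n'' 0 = n" and k: "nmem s ''k'' 0 = k"
    and b: "\<And>j. j < k \<Longrightarrow> nmem s ''M'' j - 1 \<le> n"
    and d: "\<And>l. l \<le> n \<Longrightarrow> d l * d l = 1"
    and partner: "\<And>j. j < k \<Longrightarrow> \<exists>h<k. nmem s ''M'' j = nmem s ''G'' h"
    and edge: "\<And>i j h. \<lbrakk>i \<le> n; j < k; h < k; nmem s ''M'' j = nmem s ''G'' h; fmem s ''M'' i j \<noteq> 0\<rbrakk> \<Longrightarrow>
      d i * d (nmem s ''M'' j - 1) = (if fmem s ''M'' i j = fmem s ''G'' i h then 1 else -1)"
  shows "wp (residue_ring (int q)) connect (k * (k * (Suc n * 2)))
    (\<lambda>t. (\<forall>i\<le>n. nmem t ''sign'' i \<le> 1) \<and> (\<forall>i\<le>n. \<forall>j<k. fmem s ''M'' i j \<noteq> 0 \<longrightarrow>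
       bit_sign (nmem t ''sign'' i) * bit_sign (nmem t ''sign'' (nmem s ''M'' j - 1)) =
         d i * d (nmem s ''M'' j - 1))) s"
  (is "wp _ _ _ ?Q _")
proof -
  let ?R = "residue_ring (int q)"
  define B where "B j = nmem s ''M'' j - 1" for j
  define C where "C j = {(i, B j) | i. i \<le> n \<and> fmem s ''M'' i j \<noteq> 0}" for j
  \<comment> \<open>\<open>E m False\<close> contains the edges of the first \<open>m\<close>
    columns; the flag tells whether the inner loop has already met a partner of column
    \<open>m\<close>.\<close>
  define E where "E m j = (\<Union>(C ` {..<m})) \<union> (if j then C m else {})" for m j
  have C: "C j \<subseteq> {..n} \<times> {..n}" if "j < k" for j using b[OF that] by (auto simp: C_def B_def)
  have E: "E m x \<subseteq> {..n} \<times> {..n}" if "m < k" for m x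
    unfolding E_def using C[OF that] C[OF less_trans[OF _ that]]
    by (intro Un_least UN_least) (simp_all split: if_splits)
  have stable: "coherent n d L (nupd x 0 v t) = coherent n d L t"
    if "x \<in> {''i'', ''j'', ''h''}" for L x v t
    using that by (auto simp: coherent_def)
  show ?thesis
    unfolding connect_def
  proof (rule wp_Seq[where v = 0 and v' = "k * (k * (Suc n * 2))"])
    show "wp ?R (For ''i'' (NAdd (NVar ''n'') (NConst 1))
           (Seq (NAssign ''comp'' (NVar ''i'') (NVar ''i'')) (NAssign ''sign'' (NVar ''i'') (NConst 0)))) 0
        (wp ?R (For ''j'' (NVar ''k'') (For ''h'' (NVar ''k'') join_column)) (k * (k * (Suc n * 2))) ?Q) s"
    proof (rule wp_For[where N = "Suc n" and v = 0 and
          I = "\<lambda>m t. \<forall>l<m. nmem t ''comp'' l = l \<and> nmem t ''sign'' l = 0"])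
      fix t :: "int memory"
      assume init: "\<forall>l<Suc n. nmem t ''comp'' l = l \<and> nmem t ''sign'' l = 0"
        and "same (insert ''i'' (writes (Seq (NAssign ''comp'' (NVar ''i'') (NVar ''i''))
          (NAssign ''sign'' (NVar ''i'') (NConst 0))))) s t"
      then have st: "same {''i'', ''comp'', ''sign''} s t" by (auto simp: same_def)
      show "wp ?R (For ''j'' (NVar ''k'') (For ''h'' (NVar ''k'') join_column)) (k * (k * (Suc n * 2))) ?Q t"
      proof (rule wp_For[where N = k and v = "k * (Suc n * 2)" and I = "\<lambda>m. coherent n d (E m False)"])
        show "coherent n d (E 0 False) t"
          using init d by (auto simp: coherent_def E_def bit_sign_def)
        show "?Q u" if "coherent n d (E k False) u" for u
        proof (intro conjI allI impI)
          show "nmem u ''sign'' i \<le> 1" if "i \<le> n" for i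
            using that \<open>coherent n d (E k False) u\<close> by (simp add: coherent_def)
          fix i j assume "i \<le> n" "j < k" "fmem s ''M'' i j \<noteq> 0"
          then have "(i, B j) \<in> E k False" "B j \<le> n" using b by (auto simp: E_def C_def B_def)
          then show "bit_sign (nmem u ''sign'' i) * bit_sign (nmem u ''sign'' (nmem s ''M'' j - 1)) =
             d i * d (nmem s ''M'' j - 1)"
            using that \<open>i \<le> n\<close> unfolding coherent_def B_def by blast
        qed
        fix j and t1 :: "int memory"
        assume j: "j < k" "nmem t1 ''j'' 0 = j" "coherent n d (E j False) t1"
          and "same (insert ''j'' (writes (For ''h'' (NVar ''k'') join_column))) t t1"
        then have st1: "same {''i'', ''j'', ''h'', ''l'', ''comp'', ''sign'', ''flip'', ''new'', ''old''} s t1"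
          using st by (auto simp: same_def)
        define matched where "matched m \<longleftrightarrow> (\<exists>h<m. nmem s ''M'' j = nmem s ''G'' h)" for m
        show "wp ?R (For ''h'' (NVar ''k'') join_column) (k * (Suc n * 2)) (coherent n d (E (Suc j) False)) t1"
        proof (rule wp_For[where N = k and v = "Suc n * 2" and I = "\<lambda>m. coherent n d (E j (matched m))"])
          show "coherent n d (E j (matched 0)) t1" using j by (simp add: matched_def)
          show "coherent n d (E (Suc j) False) u" if "coherent n d (E j (matched k)) u" for u
            using that partner[OF j(1)] by (auto simp: matched_def E_def lessThan_Suc Un_commute)
          fix h and t2 :: "int memory"
          assume h: "h < k" "nmem t2 ''h'' 0 = h" "coherent n d (E j (matched h)) t2"
            and "same (insert ''h'' (writes join_column)) t1 t2"
          then have st2: "nmem t2 ''j'' 0 = j" "nmem t2 ''n'' 0 = n" "nmem t2 ''M'' = nmem s ''M''"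
              "nmem t2 ''G'' = nmem s ''G''" "fmem t2 ''M'' = fmem s ''M''" "fmem t2 ''G'' = fmem s ''G''"
            using st1 n j by (auto simp: same_def)
          have "E j (matched (Suc h)) = (if nmem t2 ''M'' j = nmem t2 ''G'' h
              then E j (matched h) \<union> {(i, B j) | i. i \<le> n \<and> fmem t2 ''M'' i j \<noteq> 0} else E j (matched h))"
            using st2 by (auto simp: E_def C_def matched_def less_Suc_eq)
          then show "wp ?R join_column (Suc n * 2) (coherent n d (E j (matched (Suc h)))) t2"
            using wp_join_column[of t2 n j h "B j" d "E j (matched h)" q] st2 h j b[of j] d E[of j] edge[of _ j h]
            by (simp add: B_def)
        qed (use j k st1 in \<open>auto simp: stable same_def\<close>)
      qed (use st k in \<open>auto simp: stable same_def\<close>)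
    qed (use n in \<open>auto simp: same_def less_Suc_eq\<close>)
  qed simp
qed

section \<open>Producing the output\<close>

text \<open>Comparing with the sign of row \<open>n\<close> multiplies all signs by that of the key
  row, which thereby is normalised to 1.\<close>

definition write_diag :: com where
  "write_diag =
     For ''i'' (NVar ''n'')
       (IfElse (NEq (NGet ''sign'' (NVar ''i'')) (NGet ''sign'' (NVar ''n'')))
         (FAssign ''D'' (NVar ''i'') (NConst 0) FOne)
         (FAssign ''D'' (NVar ''i'') (NConst 0) (FSub FZero FOne)))"

text \<open>Assigning through \<open>P\<close> applies the transposed permutation: r' = P^T D'
  r*.\<close>

definition write_key :: com where
  "write_key =
     For ''i'' (NVar ''n'')
       (FAssign ''r'' (NGet ''P'' (NVar ''i'')) (NConst 0)
         (FMul (FGet ''D'' (NVar ''i'') (NConst 0)) (FGet ''rs'' (NVar ''i'') (NConst 0))))"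

text \<open>The product of the identity rows of the reduced \<open>M\<close>, the signs at the pivot
  rows, and the original second stack at the pivot rows. The latter is read from \<open>H\<close>,
  because \<open>G\<close> was reduced in place; all pivot rows have index less than
  \<open>n\<close>.\<close>

definition write_basis :: com where
  "write_basis =
     For ''i'' (NVar ''k'') (For ''j'' (NVar ''k'')
       (Seq (FAssign ''U'' (NVar ''i'') (NVar ''j'') FZero)
         (For ''h'' (NVar ''k'')
           (FAssign ''U'' (NVar ''i'') (NVar ''j'')
             (FAdd (FGet ''U'' (NVar ''i'') (NVar ''j''))
               (FMul
                 (FMul (FGet ''M'' (NAdd (NAdd (NVar ''n'') (NConst 1)) (NVar ''i'')) (NVar ''h''))
                   (FGet ''D'' (NSub (NGet ''M'' (NVar ''h'')) (NConst 1)) (NConst 0)))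
                 (FGet ''H'' (NSub (NGet ''M'' (NVar ''h'')) (NConst 1)) (NVar ''j''))))))))"

definition write_output :: com where
  "write_output = Seq write_diag (Seq write_key write_basis)"

lemma wp_write_diag:
  fixes s :: "int memory"
  assumes q: "1 < q" and n: "nmem s ''n'' 0 = n"
  shows "wp (residue_ring (int q)) write_diag n
    (\<lambda>t. \<forall>i<n. fmem t ''D'' i 0 = (if nmem s ''sign'' i = nmem s ''sign'' n then 1 else -1) mod int q) s"
  unfolding write_diag_def
proof (rule wp_For[where N = n and v = 1 and I = "\<lambda>m t. \<forall>i<m. fmem t ''D'' i 0 =
        (if nmem s ''sign'' i = nmem s ''sign'' n then 1 else -1) mod int q"])
qed (use q n in \<open>auto simp: same_def less_Suc_eq residue_ring_minus\<close>)

lemma wp_write_key: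
  fixes s :: "int memory"
  assumes n: "nmem s ''n'' 0 = n" and inj: "inj_on (nmem s ''P'') {..<n}"
  shows "wp (residue_ring (int q)) write_key n
    (\<lambda>t. \<forall>i<n. fmem t ''r'' (nmem s ''P'' i) 0 = (fmem s ''D'' i 0 * fmem s ''rs'' i 0) mod int q) s"
proof -
  \<comment> \<open>Distinct targets: a later assignment never overwrites an earlier one.\<close>
  have neq: "nmem s ''P'' i \<noteq> nmem s ''P'' j" if "i < j" "j < n" for i j
    using that inj_onD[OF inj, of i j] by auto
  show ?thesis
    unfolding write_key_def
  proof (rule wp_For[where N = n and v = 1 and I = "\<lambda>m t. \<forall>i<m. fmem t ''r'' (nmem s ''P'' i) 0 =
        (fmem s ''D'' i 0 * fmem s ''rs'' i 0) mod int q"])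
  qed (use n neq in \<open>auto simp: same_def less_Suc_eq\<close>)
qed

lemma wp_write_basis:
  fixes s :: "int memory"
  assumes n: "nmem s ''n'' 0 = n" and k: "nmem s ''k'' 0 = k"
  shows "wp (residue_ring (int q)) write_basis (k * (k * (k * 3)))
    (\<lambda>t. \<forall>i<k. \<forall>j<k. fmem t ''U'' i j =
       (\<Sum>h<k. fmem s ''M'' (n + 1 + i) h * fmem s ''D'' (nmem s ''M'' h - 1) 0 *
          fmem s ''H'' (nmem s ''M'' h - 1) j) mod int q) s"
proof -
  let ?R = "residue_ring (int q)"
  define T where "T i j h = fmem s ''M'' (n + 1 + i) h * fmem s ''D'' (nmem s ''M'' h - 1) 0 *
          fmem s ''H'' (nmem s ''M'' h - 1) j" for i j h
  define I where "I m t \<longleftrightarrow> (\<forall>i<m. \<forall>j<k. fmem t ''U'' i j = (\<Sum>h<k. T i j h) mod int q)"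
    for m and t :: "int memory"
  define J where "J i m t \<longleftrightarrow> I i t \<and> (\<forall>j<m. fmem t ''U'' i j = (\<Sum>h<k. T i j h) mod int q)"
    for i m and t :: "int memory"
  let ?c = "FAssign ''U'' (NVar ''i'') (NVar ''j'')
             (FAdd (FGet ''U'' (NVar ''i'') (NVar ''j''))
               (FMul
                 (FMul (FGet ''M'' (NAdd (NAdd (NVar ''n'') (NConst 1)) (NVar ''i'')) (NVar ''h''))
                   (FGet ''D'' (NSub (NGet ''M'' (NVar ''h'')) (NConst 1)) (NConst 0)))
                 (FGet ''H'' (NSub (NGet ''M'' (NVar ''h'')) (NConst 1)) (NVar ''j''))))"
  let ?d = "Seq (FAssign ''U'' (NVar ''i'') (NVar ''j'') FZero) (For ''h'' (NVar ''k'') ?c)"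
  have entry: "wp ?R ?d (k * 3) (J i (Suc j)) t"
    if "i < k" "j < k" "nmem t ''i'' 0 = i" "nmem t ''j'' 0 = j" "J i j t"
      and st: "same {''i'', ''j'', ''h'', ''U''} s t" for i j t
  proof -
    let ?t = "fupd ''U'' i j 0 t"
    have "wp ?R (For ''h'' (NVar ''k'') ?c) (k * 3) (J i (Suc j)) ?t"
    proof (rule wp_For[where N = k and v = 3 and
          I = "\<lambda>m t. J i j t \<and> fmem t ''U'' i j = (\<Sum>h<m. T i j h) mod int q"])
      fix h and t' :: "int memory"
      assume h: "h < k" "nmem t' ''h'' 0 = h" "J i j t' \<and> fmem t' ''U'' i j = (\<Sum>h<h. T i j h) mod int q"
        and "same (insert ''h'' (writes ?c)) ?t t'"
      then have "nmem t' ''i'' 0 = i" "nmem t' ''j'' 0 = j" "nmem t' ''n'' 0 = n" "fmem t' ''M'' = fmem s ''M''"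
        "nmem t' ''M'' = nmem s ''M''" "fmem t' ''D'' = fmem s ''D''" "fmem t' ''H'' = fmem s ''H''"
        using that st n by (auto simp: same_def)
      then show "wp ?R ?c 3 (\<lambda>t. J i j t \<and> fmem t ''U'' i j = (\<Sum>h<Suc h. T i j h) mod int q) t'"
        using h by (auto simp: J_def I_def T_def mod_simps)
    qed (use that k in \<open>auto simp: J_def I_def same_def less_Suc_eq\<close>)
    then show ?thesis using that by simp
  qed
  show ?thesis
    unfolding write_basis_def
  proof (rule wp_For[where N = k and v = "k * (k * 3)" and I = I])
    fix i and t :: "int memory"
    assume i: "i < k" "nmem t ''i'' 0 = i" "I i t"
      and "same (insert ''i'' (writes (For ''j'' (NVar ''k'') ?d))) s t"
    then have st: "same {''i'', ''j'', ''h'', ''U''} s t" by (auto simp: same_def)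
    show "wp ?R (For ''j'' (NVar ''k'') ?d) (k * (k * 3)) (I (Suc i)) t"
    proof (rule wp_For[where N = k and v = "k * 3" and I = "J i"])
      fix j and t' :: "int memory"
      assume j: "j < k" "nmem t' ''j'' 0 = j" "J i j t'"
        and "same (insert ''j'' (writes ?d)) t t'"
      then have "same {''i'', ''j'', ''h'', ''U''} s t'" "nmem t' ''i'' 0 = i"
        using st i by (auto simp: same_def)
      then show "wp ?R ?d (k * 3) (J i (Suc j)) t'" using entry i j by blast
    qed (use i st k in \<open>auto simp: J_def I_def same_def less_Suc_eq\<close>)
  qed (use k in \<open>auto simp: I_def T_def same_def\<close>)
qed

lemma wp_write_output:
  fixes s :: "int memory"
  assumes q: "1 < q" and n: "nmem s ''n'' 0 = n" and k: "nmem s ''k'' 0 = k"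
    and inj: "inj_on (nmem s ''P'') {..<n}" and pv: "\<And>h. h < k \<Longrightarrow> nmem s ''M'' h - 1 < n"
  defines "D \<equiv> \<lambda>i. (if nmem s ''sign'' i = nmem s ''sign'' n then 1 else -1) mod int q"
  shows "wp (residue_ring (int q)) write_output (2 * n + k * (k * (k * 3)))
    (\<lambda>t. (\<forall>i<n. fmem t ''D'' i 0 = D i) \<and>
      (\<forall>i<n. fmem t ''r'' (nmem s ''P'' i) 0 = (D i * fmem s ''rs'' i 0) mod int q) \<and>
      (\<forall>i<k. \<forall>j<k. fmem t ''U'' i j = (\<Sum>h<k. fmem s ''M'' (n + 1 + i) h * D (nmem s ''M'' h - 1) *
          fmem s ''H'' (nmem s ''M'' h - 1) j) mod int q)) s"
  unfolding write_output_def
proof (rule wp_Seq[OF wp_mono[OF wp_write_diag[OF q n]]], rule le_refl)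
  fix t :: "int memory"
  assume t: "\<forall>i<n. fmem t ''D'' i 0 = (if nmem s ''sign'' i = nmem s ''sign'' n then 1 else -1) mod int q"
    and "same (writes write_diag) s t"
  then have st: "nmem t ''n'' 0 = n" "nmem t ''k'' 0 = k" "nmem t ''P'' = nmem s ''P''"
     "nmem t ''M'' = nmem s ''M''" "fmem t ''M'' = fmem s ''M''" "fmem t ''rs'' = fmem s ''rs''"
     "fmem t ''H'' = fmem s ''H''"
    using n k by (auto simp: same_def write_diag_def)
  let ?R = "residue_ring (int q)"
  have D: "fmem t ''D'' i 0 = D i" if "i < n" for i using t that by (simp add: D_def)
  have inj': "inj_on (nmem t ''P'') {..<n}" using inj st by simp
  show "wp ?R (Seq write_key write_basis) (n + k * (k * (k * 3)))
    (\<lambda>t. (\<forall>i<n. fmem t ''D'' i 0 = D i) \<and>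
      (\<forall>i<n. fmem t ''r'' (nmem s ''P'' i) 0 = (D i * fmem s ''rs'' i 0) mod int q) \<and>
      (\<forall>i<k. \<forall>j<k. fmem t ''U'' i j = (\<Sum>h<k. fmem s ''M'' (n + 1 + i) h * D (nmem s ''M'' h - 1) *
          fmem s ''H'' (nmem s ''M'' h - 1) j) mod int q)) t"
  proof (rule wp_Seq[OF wp_mono[OF wp_write_key[OF st(1) inj']]], rule le_refl)
    fix t' :: "int memory"
    assume t': "\<forall>i<n. fmem t' ''r'' (nmem t ''P'' i) 0 = (fmem t ''D'' i 0 * fmem t ''rs'' i 0) mod int q"
      and "same (writes write_key) t t'"
    then have st': "nmem t' ''n'' 0 = n" "nmem t' ''k'' 0 = k"
       "nmem t' ''M'' = nmem s ''M''" "fmem t' ''M'' = fmem s ''M''" "fmem t' ''H'' = fmem s ''H''"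
       "fmem t' ''D'' = fmem t ''D''"
      using st by (auto simp: same_def write_key_def)
    show "wp ?R write_basis (k * (k * (k * 3)))
    (\<lambda>t. (\<forall>i<n. fmem t ''D'' i 0 = D i) \<and>
      (\<forall>i<n. fmem t ''r'' (nmem s ''P'' i) 0 = (D i * fmem s ''rs'' i 0) mod int q) \<and>
      (\<forall>i<k. \<forall>j<k. fmem t ''U'' i j = (\<Sum>h<k. fmem s ''M'' (n + 1 + i) h * D (nmem s ''M'' h - 1) *
          fmem s ''H'' (nmem s ''M'' h - 1) j) mod int q)) t'"
    proof (rule wp_mono[OF wp_write_basis[OF st'(1,2)] le_refl])
      fix u :: "int memory"
      assume u: "\<forall>i<k. \<forall>j<k. fmem u ''U'' i j =
       (\<Sum>h<k. fmem t' ''M'' (n + 1 + i) h * fmem t' ''D'' (nmem t' ''M'' h - 1) 0 *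
          fmem t' ''H'' (nmem t' ''M'' h - 1) j) mod int q"
        and "same (writes write_basis) t' u"
      then have "fmem u ''D'' = fmem t ''D''" "fmem u ''r'' = fmem t' ''r''"
        using st' by (auto simp: same_def write_basis_def)
      moreover have "(\<Sum>h<k. fmem t' ''M'' (n + 1 + i) h * fmem t' ''D'' (nmem t' ''M'' h - 1) 0 *
          fmem t' ''H'' (nmem t' ''M'' h - 1) j) = (\<Sum>h<k. fmem s ''M'' (n + 1 + i) h * D (nmem s ''M'' h - 1) *
          fmem s ''H'' (nmem s ''M'' h - 1) j)" for i j
        using st' D pv by (intro sum.cong) auto
      ultimately show "(\<forall>i<n. fmem u ''D'' i 0 = D i) \<and>
      (\<forall>i<n. fmem u ''r'' (nmem s ''P'' i) 0 = (D i * fmem s ''rs'' i 0) mod int q) \<and>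
      (\<forall>i<k. \<forall>j<k. fmem u ''U'' i j = (\<Sum>h<k. fmem s ''M'' (n + 1 + i) h * D (nmem s ''M'' h - 1) *
          fmem s ''H'' (nmem s ''M'' h - 1) j) mod int q)"
        using u t' D st by auto
    qed
  qed simp
qed simp

section \<open>Comparing the two echelon forms\<close>

text \<open>With \<open>k\<close> pivots among \<open>k\<close> columns every column has one, so the
  conditional clauses of \<open>echelon\<close> become unconditional.\<close>

lemma echelon_full:
  assumes E: "echelon q n N k X0 k X pv" and j: "j < k"
  shows "0 < pv j" "pv j - 1 < n"
    and "\<And>j'. j' < k \<Longrightarrow> X (pv j - 1) j' = (if j' = j then 1 else 0)"
    and "\<And>i. i < pv j - 1 \<Longrightarrow> X i j = 0"
proof -
  have "card {j. j < k \<and> 0 < pv j} = card {..<k}" using E by (simp add: echelon_def)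
  then have "{j. j < k \<and> 0 < pv j} = {..<k}" by (intro card_subset_eq) auto
  then have pos: "0 < pv j" using j by auto
  then show "0 < pv j" .
  have "pv j \<le> n" using E j pos by (simp add: echelon_def)
  with pos show "pv j - 1 < n" by simp
  show "X (pv j - 1) j' = (if j' = j then 1 else 0)" if "j' < k" for j'
    using E j pos that by (auto simp: echelon_def)
  show "X i j = 0" if "i < pv j - 1" for i
    using E j pos that by (auto simp: echelon_def)
qed

lemma echelon_pivot_inj:
  assumes E: "echelon q n N k X0 k X pv"
  shows "inj_on pv {..<k}"
proof (rule inj_onI)
  fix j j' assume *: "j \<in> {..<k}" "j' \<in> {..<k}" "pv j = pv j'"
  then have "X (pv j - 1) j' = 1" using echelon_full(3)[OF E, of j' j'] by simp
  then show "j = j'" using echelon_full(3)[OF E, of j j'] * by (auto split: if_splits)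
qed

lemma column_in_colspan:
  assumes "j < k"
  shows "(\<lambda>i. X i j) \<in> colspan q N k X"
  unfolding colspan_def
proof (intro CollectI exI allI impI)
  fix i
  show "[X i j = (\<Sum>l<k. X i l * (if l = j then 1 else 0))] (mod int q)"
    using assms by (simp add: if_distrib[of "\<lambda>x. _ * x"] cong: if_cong)
qed

text \<open>Coordinates that express a vector on all rows do so on the first rows. This serves to
  drop the identity rows of \<open>M\<close> before comparing with \<open>G\<close>.\<close>

lemma colspan_fewer_rows:
  assumes "colspan q N k X = colspan q N k Y" "N' \<le> N"
  shows "colspan q N' k X = colspan q N' k Y"
proof -
  have "colspan q N' k X \<subseteq> colspan q N' k Y" if "colspan q N k X = colspan q N k Y"
    for X Y :: "nat \<Rightarrow> nat \<Rightarrow> int"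
  proof
    fix v assume "v \<in> colspan q N' k X"
    then obtain y where y: "\<And>i. i < N' \<Longrightarrow> [v i = (\<Sum>j<k. X i j * y j)] (mod int q)"
      by (auto simp: colspan_def)
    have "(\<lambda>i. \<Sum>j<k. X i j * y j) \<in> colspan q N k X"
      unfolding colspan_def by (intro CollectI exI[of _ y]) simp
    then have "(\<lambda>i. \<Sum>j<k. X i j * y j) \<in> colspan q N k Y" using that by simp
    then obtain z where "\<And>i. i < N \<Longrightarrow> [(\<Sum>j<k. X i j * y j) = (\<Sum>j<k. Y i j * z j)] (mod int q)"
      unfolding colspan_def by blast
    with y show "v \<in> colspan q N' k Y"
      using assms(2) unfolding colspan_def by (blast intro: cong_trans less_le_trans)
  qed
  then show ?thesis using assms(1) by (metis subset_antisym)
qed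

text \<open>Pivot rows are unit rows, so the coefficients of a combination of columns stand in its
  pivot entries. \<open>N'\<close> may differ from \<open>N\<close> to allow for dropped
  rows.\<close>

lemma echelon_coordinates:
  assumes E: "echelon q n N k X0 k X pv" and v: "v \<in> colspan q N' k X" and N': "n \<le> N'" and i: "i < N'"
  shows "[v i = (\<Sum>j<k. X i j * v (pv j - 1))] (mod int q)"
proof -
  obtain y where y: "\<And>i. i < N' \<Longrightarrow> [v i = (\<Sum>j<k. X i j * y j)] (mod int q)"
    using v by (auto simp: colspan_def)
  have "[v (pv j - 1) = y j] (mod int q)" if "j < k" for j
  proof -
    have "(\<Sum>l<k. X (pv j - 1) l * y l) = (\<Sum>l<k. (if l = j then 1 else 0) * y l)"
      using echelon_full(3)[OF E that] by (intro sum.cong) auto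
    also have "\<dots> = y j" using that by (simp add: if_distrib[of "\<lambda>x. x * _"] cong: if_cong)
    finally show ?thesis using y[of "pv j - 1"] echelon_full(2)[OF E that] N' by simp
  qed
  then have "[(\<Sum>j<k. X i j * y j) = (\<Sum>j<k. X i j * v (pv j - 1))] (mod int q)"
    by (intro cong_sum cong_scalar_left) (auto intro: cong_sym)
  then show ?thesis using y[OF i] cong_trans by blast
qed

text \<open>\<open>M\<close> and \<open>G\<close> are the stacks as loaded, \<open>M'\<close> and
  \<open>G'\<close> their reduced forms with pivot lists \<open>pv\<close> and \<open>pw\<close>.
  Index \<open>n\<close> is the key row, for which \<open>d\<close> carries a sign as well.\<close>

locale equivalent_up_to_signs =
  fixes q n k :: nat and M G M' G' U :: "nat \<Rightarrow> nat \<Rightarrow> int" and d :: "nat \<Rightarrow> int"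
    and pv pw :: "nat \<Rightarrow> nat"
  assumes q: "prime q" "odd q"
    and d: "\<And>i. i \<le> n \<Longrightarrow> d i \<in> {-1, 1}"
    and rel: "\<And>i c. \<lbrakk>i \<le> n; c < k\<rbrakk> \<Longrightarrow> [G i c = d i * (\<Sum>a<k. M i a * U a c)] (mod int q)"
    and ident: "\<And>a c. \<lbrakk>a < k; c < k\<rbrakk> \<Longrightarrow> M (n + 1 + a) c = (if a = c then 1 else 0)"
    and EM: "echelon q n (n + 1 + k) k M k M' pv"
    and EG: "echelon q n (n + 1) k G k G' pw"
begin

lemma q_gt_2: "2 < q"
  using q prime_ge_2_nat[OF q(1)] by (metis dvd_refl le_neq_implies_less)

lemma d_square: "i \<le> n \<Longrightarrow> d i * d i = 1"
  using d by force

lemma not_cong_1_0: "\<not> [1 = (0 :: int)] (mod int q)"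
  using q_gt_2 by (simp add: cong_def)

text \<open>Signs square to 1, so applying \<open>d\<close> to G = diag(d) M U leaves a combination
  of columns of \<open>M\<close>.\<close>

lemma colspan_G_M:
  assumes "v \<in> colspan q (n + 1) k G'"
  shows "(\<lambda>i. d i * v i) \<in> colspan q (n + 1) k M'"
proof -
  have "colspan q (n + 1) k G' = colspan q (n + 1) k G" using EG by (simp add: echelon_def)
  then obtain y where y: "\<And>i. i < n + 1 \<Longrightarrow> [v i = (\<Sum>c<k. G i c * y c)] (mod int q)"
    using assms by (auto simp: colspan_def)
  have "[d i * v i = (\<Sum>a<k. M i a * (\<Sum>c<k. U a c * y c))] (mod int q)" if i: "i < n + 1" for i
  proof -
    have "[d i * v i = d i * (\<Sum>c<k. (d i * (\<Sum>a<k. M i a * U a c)) * y c)] (mod int q)"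
      using i rel[of i]
      by (intro cong_scalar_left cong_trans[OF y[OF i]] cong_sum cong_scalar_right) auto
    also have "d i * (\<Sum>c<k. (d i * (\<Sum>a<k. M i a * U a c)) * y c)
        = (d i * d i) * (\<Sum>c<k. \<Sum>a<k. M i a * (U a c * y c))"
      by (simp add: sum_distrib_left sum_distrib_right mult_ac)
    also have "d i * d i = 1" using d_square[of i] i by simp
    also have "1 * (\<Sum>c<k. \<Sum>a<k. M i a * (U a c * y c)) = (\<Sum>a<k. M i a * (\<Sum>c<k. U a c * y c))"
      unfolding sum_distrib_left mult_1_left by (rule sum.swap)
    finally show ?thesis .
  qed
  then have "(\<lambda>i. d i * v i) \<in> colspan q (n + 1) k M"
    unfolding colspan_def by (intro CollectI exI allI impI)
  moreover have "colspan q (n + 1) k M' = colspan q (n + 1) k M"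
    by (rule colspan_fewer_rows[where N = "n + 1 + k"]) (use EM in \<open>simp_all add: echelon_def\<close>)
  ultimately show ?thesis by (simp only:)
qed

lemma column_G_coordinates:
  assumes "h < k" "i \<le> n"
  shows "[d i * G' i h = (\<Sum>j<k. M' i j * (d (pv j - 1) * G' (pv j - 1) h))] (mod int q)"
  using echelon_coordinates[OF EM colspan_G_M[OF column_in_colspan[OF assms(1)]]] assms by simp

text \<open>Suppose the pivot row \<open>p\<close> of column \<open>h\<close> of \<open>G'\<close>
  is no pivot row of \<open>M'\<close>, and expand the signed column in the columns of
  \<open>M'\<close>. For a pivot of \<open>M'\<close> above \<open>p\<close> the coefficient is an
  entry of \<open>G'\<close> above its pivot; for one below \<open>p\<close> the entry of
  \<open>M'\<close> in row \<open>p\<close> lies above its pivot. So all terms vanish, although the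
  expanded entry is a sign. Equal cardinality turns this one inclusion into equality.\<close>

lemma same_pivots: "pv ` {..<k} = pw ` {..<k}"
proof (rule card_subset_eq[symmetric])
  show "pw ` {..<k} \<subseteq> pv ` {..<k}"
  proof
    fix x assume "x \<in> pw ` {..<k}"
    then obtain h where h: "h < k" "x = pw h" by auto
    note G = echelon_full[OF EG h(1)]
    define p where "p = pw h - 1"
    show "x \<in> pv ` {..<k}"
    proof (rule ccontr)
      assume no: "x \<notin> pv ` {..<k}"
      have "M' p j * (d (pv j - 1) * G' (pv j - 1) h) = 0" if "j < k" for j
      proof -
        note Mj = echelon_full[OF EM that]
        have "pv j \<noteq> pw h" using no h that by (metis image_eqI lessThan_iff)
        then consider "pv j - 1 < p" | "p < pv j - 1" using Mj(1) G(1) unfolding p_def by linarith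
        then show ?thesis using Mj(4)[of p] G(4)[of "pv j - 1"] by cases (auto simp: p_def)
      qed
      then have "(\<Sum>j<k. M' p j * (d (pv j - 1) * G' (pv j - 1) h)) = 0"
        by (intro sum.neutral ballI) (simp only: lessThan_iff)
      moreover have "G' p h = 1" using G(3)[OF h(1)] by (simp add: p_def)
      ultimately have "[d p = 0] (mod int q)"
        using column_G_coordinates[OF h(1), of p] G(2) by (simp add: p_def)
      from cong_scalar_left[OF this, of "d p"] show False
        using d_square[of p] G(2) not_cong_1_0 by (simp add: p_def)
    qed
  qed
  show "card (pw ` {..<k}) = card (pv ` {..<k})"
    using echelon_pivot_inj[OF EM] echelon_pivot_inj[OF EG] by (simp add: card_image)
qed simp

text \<open>All pivot rows of \<open>M'\<close> are pivot rows of \<open>G'\<close>, where column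
  \<open>h\<close> is zero except at its own; hence the expansion of the signed column retains a
  single term.\<close>

lemma matched_columns:
  assumes "j < k" "h < k" "pv j = pw h" "i \<le> n"
  shows "[d i * G' i h = M' i j * d (pv j - 1)] (mod int q)"
proof -
  have "G' (pv l - 1) h = (if l = j then 1 else 0)" if l: "l < k" for l
  proof -
    have "pv l \<in> pw ` {..<k}" using l unfolding same_pivots[symmetric] by simp
    then obtain h' where h': "h' < k" "pv l = pw h'" by auto
    have "l = j \<longleftrightarrow> h = h'"
      using echelon_pivot_inj[OF EM] echelon_pivot_inj[OF EG] assms h' l
      by (metis inj_onD lessThan_iff)
    then show ?thesis using echelon_full(3)[OF EG h'(1) assms(2)] h' by simp
  qed
  then have "(\<Sum>l<k. M' i l * (d (pv l - 1) * G' (pv l - 1) h)) =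
      (\<Sum>l<k. if l = j then M' i l * d (pv l - 1) else 0)"
    by (intro sum.cong) auto
  then show ?thesis using column_G_coordinates[OF assms(2,4)] assms(1) by simp
qed

text \<open>The two entries agree up to the sign in question, and for odd \<open>q\<close> a nonzero
  residue differs from its negative.\<close>

lemma matched_sign:
  assumes "j < k" "h < k" "pv j = pw h" "i \<le> n" "M' i j \<noteq> 0"
  shows "d i * d (pv j - 1) = (if M' i j = G' i h then 1 else -1)"
proof -
  let ?b = "pv j - 1"
  have b: "?b \<le> n" using echelon_full(2)[OF EM assms(1)] by simp
  have red: "0 \<le> M' i j" "M' i j < int q" "0 \<le> G' i h" "G' i h < int q"
    using EM EG assms by (auto simp: echelon_def)
  have "[d i * (d i * G' i h) = d i * (M' i j * d ?b)] (mod int q)"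
    using matched_columns[OF assms(1-4)] by (rule cong_scalar_left)
  then have G: "[G' i h = (d i * d ?b) * M' i j] (mod int q)"
    using d_square[OF assms(4)] by (simp add: mult.assoc[symmetric]) (simp add: mult_ac)
  have "d i * d ?b \<in> {-1, 1}" using d[OF assms(4)] d[OF b] by auto
  moreover have "M' i j = G' i h" if "d i * d ?b = 1"
    using G that red by (auto intro!: cong_reduced_eq[of _ _ q] cong_sym)
  moreover have "M' i j \<noteq> G' i h" if "d i * d ?b = -1"
  proof
    assume "M' i j = G' i h"
    then have "[2 * M' i j = 0] (mod int q)" using G that by (simp add: cong_iff_dvd_diff)
    then have "[2 = 0] (mod int q) \<or> [M' i j = 0] (mod int q)" using prime_cong_0_mult[OF q(1)] by blast
    then show False using red assms(5) q_gt_2 by (auto simp: cong_def)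
  qed
  ultimately show ?thesis by auto
qed

text \<open>Columns of \<open>M'\<close> are combinations of columns of \<open>M\<close> on all rows
  at once, and on the identity rows such a combination shows its own coefficient vector.\<close>

lemma M'_from_identity_rows:
  assumes "i \<le> n" "j < k"
  shows "[M' i j = (\<Sum>a<k. M i a * M' (n + 1 + a) j)] (mod int q)"
proof -
  have "(\<lambda>i. M' i j) \<in> colspan q (n + 1 + k) k M"
    using column_in_colspan[OF assms(2), of M' q "n + 1 + k"] EM by (simp add: echelon_def)
  then obtain y where y: "\<And>i. i < n + 1 + k \<Longrightarrow> [M' i j = (\<Sum>a<k. M i a * y a)] (mod int q)"
    by (auto simp: colspan_def)
  have "[M' (n + 1 + a) j = y a] (mod int q)" if "a < k" for a
  proof -
    have "(\<Sum>c<k. M (n + 1 + a) c * y c) = (\<Sum>c<k. if c = a then y c else 0)"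
      using ident[OF that] by (intro sum.cong) auto
    then show ?thesis using y[of "n + 1 + a"] that by simp
  qed
  then have "[(\<Sum>a<k. M i a * y a) = (\<Sum>a<k. M i a * M' (n + 1 + a) j)] (mod int q)"
    by (intro cong_sum cong_scalar_left) (auto intro: cong_sym)
  then show ?thesis using y[of i] assms cong_trans by simp blast
qed

lemma M_from_pivot_rows:
  assumes "i < n + 1 + k" "a < k"
  shows "[M i a = (\<Sum>j<k. M' i j * M (pv j - 1) a)] (mod int q)"
proof (rule echelon_coordinates[OF EM])
  show "(\<lambda>i. M i a) \<in> colspan q (n + 1 + k) k M'"
    using column_in_colspan[OF assms(2), of M q "n + 1 + k"] EM by (simp add: echelon_def)
qed (use assms in auto)

text \<open>Let E be the identity rows of \<open>M'\<close> and let index p denote restriction to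
  pivot rows. Then M' = M E, G_p = diag(d_p) M_p U and M = M' M_p. The edge condition gives e_b d_b
  = e_i d_i for every pivot row b whose column is nonzero in row i, so this factor leaves the sum,
  and what remains is e_i d_i (M U)_i = e_i G_i.\<close>

lemma recovered_basis:
  assumes e: "\<And>i. i \<le> n \<Longrightarrow> e i * e i = 1"
    and edge: "\<And>i j. \<lbrakk>i \<le> n; j < k; M' i j \<noteq> 0\<rbrakk> \<Longrightarrow> e i * e (pv j - 1) = d i * d (pv j - 1)"
    and i: "i \<le> n" and c: "c < k"
  shows "[(\<Sum>a<k. M i a * (\<Sum>j<k. M' (n + 1 + a) j * e (pv j - 1) * G (pv j - 1) c)) = e i * G i c] (mod int q)"
proof -
  define p where "p j = pv j - 1" for j
  have p: "p j \<le> n" if "j < k" for j using echelon_full(2)[OF EM that] by (simp add: p_def)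
  have "(\<Sum>a<k. M i a * (\<Sum>j<k. M' (n + 1 + a) j * e (p j) * G (p j) c))
     = (\<Sum>j<k. (\<Sum>a<k. M i a * M' (n + 1 + a) j) * (e (p j) * G (p j) c))"
    by (simp add: sum_distrib_left sum_distrib_right mult_ac) (rule sum.swap)
  also have "[\<dots> = (\<Sum>j<k. M' i j * (e (p j) * G (p j) c))] (mod int q)"
    using M'_from_identity_rows[OF i] by (intro cong_sum cong_scalar_right) (auto intro: cong_sym)
  also have "[(\<Sum>j<k. M' i j * (e (p j) * G (p j) c)) =
      (\<Sum>j<k. M' i j * (e (p j) * (d (p j) * (\<Sum>a<k. M (p j) a * U a c))))] (mod int q)"
    using rel[OF p c] by (intro cong_sum cong_scalar_left) auto
  also have "(\<Sum>j<k. M' i j * (e (p j) * (d (p j) * (\<Sum>a<k. M (p j) a * U a c)))) =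
      (\<Sum>j<k. e i * d i * (M' i j * (\<Sum>a<k. M (p j) a * U a c)))"
  proof (rule sum.cong)
    fix j assume "j \<in> {..<k}"
    then have j: "j < k" by simp
    show "M' i j * (e (p j) * (d (p j) * (\<Sum>a<k. M (p j) a * U a c))) =
      e i * d i * (M' i j * (\<Sum>a<k. M (p j) a * U a c))"
    proof (cases "M' i j = 0")
      case False
      have "e (p j) * d (p j) = (e i * e i) * (d (p j) * e (p j))" using e[OF i] by simp
      also have "\<dots> = e i * (e i * e (p j)) * d (p j)" by (simp add: mult_ac)
      also have "\<dots> = e i * d i * (d (p j) * d (p j))" using edge[OF i j False] by (simp add: p_def mult_ac)
      also have "\<dots> = e i * d i" using d_square[OF p[OF j]] by simp
      finally show ?thesis by (simp add: mult.assoc[symmetric])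
    qed simp
  qed simp
  also have "\<dots> = e i * (d i * (\<Sum>a<k. (\<Sum>j<k. M' i j * M (p j) a) * U a c))"
    by (simp add: sum_distrib_left sum_distrib_right mult_ac) (rule sum.swap)
  also have "[\<dots> = e i * (d i * (\<Sum>a<k. M i a * U a c))] (mod int q)"
    using M_from_pivot_rows[of i] i unfolding p_def
    by (intro cong_scalar_left cong_sum cong_scalar_right) (auto intro: cong_sym)
  also have "[e i * (d i * (\<Sum>a<k. M i a * U a c)) = e i * G i c] (mod int q)"
    using rel[OF i c] by (intro cong_scalar_left) (rule cong_sym)
  finally show ?thesis unfolding p_def .
qed

end

section \<open>Invertible matrices modulo \<open>q\<close>\<close>

lemma mat_mod_carrier [simp]: "mat_mod q X \<in> carrier_mat a b \<longleftrightarrow> X \<in> carrier_mat a b"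
  by (simp add: mat_mod_def)

lemma mat_mod_idem [simp]: "mat_mod q (mat_mod q X) = mat_mod q X"
  by (auto simp: mat_mod_def)

lemma mat_mod_eqI:
  assumes "X \<in> carrier_mat a b" "Y \<in> carrier_mat a b"
    and "\<And>i j. \<lbrakk>i < a; j < b\<rbrakk> \<Longrightarrow> [X $$ (i, j) = Y $$ (i, j)] (mod int q)"
  shows "mat_mod q X = mat_mod q Y"
  using assms by (auto simp: mat_mod_def cong_def intro!: eq_matI)

lemma mat_mod_eqD:
  assumes "mat_mod q X = mat_mod q Y" "X \<in> carrier_mat a b" "Y \<in> carrier_mat a b" "i < a" "j < b"
  shows "[X $$ (i, j) = Y $$ (i, j)] (mod int q)"
proof -
  have "mat_mod q X $$ (i, j) = mat_mod q Y $$ (i, j)" using assms by simp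
  then show ?thesis using assms by (simp add: mat_mod_def cong_def)
qed

lemma index_mult_sum:
  assumes "X \<in> carrier_mat a b" "Y \<in> carrier_mat b c" "i < a" "j < c"
  shows "(X * Y) $$ (i, j) = (\<Sum>l<b. X $$ (i, l) * Y $$ (l, j))"
  using assms by (simp add: scalar_prod_def atLeast0LessThan)

lemma mat_mod_mult_cong:
  assumes "mat_mod q X = mat_mod q X'" "mat_mod q Y = mat_mod q Y'"
    and "X \<in> carrier_mat a b" "X' \<in> carrier_mat a b" "Y \<in> carrier_mat b c" "Y' \<in> carrier_mat b c"
  shows "mat_mod q (X * Y) = mat_mod q (X' * Y')"
proof (rule mat_mod_eqI)
  fix i j assume "i < a" "j < c"
  then show "[(X * Y) $$ (i, j) = (X' * Y') $$ (i, j)] (mod int q)"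
    using assms mat_mod_eqD[OF assms(1,3,4)] mat_mod_eqD[OF assms(2,5,6)]
    unfolding index_mult_sum[OF assms(3,5) \<open>i < a\<close> \<open>j < c\<close>] index_mult_sum[OF assms(4,6) \<open>i < a\<close> \<open>j < c\<close>]
    by (intro cong_sum cong_mult) auto
qed (use assms in auto)

text \<open>Unlike \<open>GL\<close> this does not ask for reduced entries, so integer products can
  be formed and compared before a final reduction.\<close>

definition invertible_mod :: "nat \<Rightarrow> nat \<Rightarrow> int mat \<Rightarrow> bool" where
  "invertible_mod q k X \<longleftrightarrow> X \<in> carrier_mat k k \<and>
     (\<exists>Y\<in>carrier_mat k k. mat_mod q (X * Y) = mat_mod q (1\<^sub>m k) \<and> mat_mod q (Y * X) = mat_mod q (1\<^sub>m k))"

lemma invertible_mod_cong: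
  assumes "invertible_mod q k X" "mat_mod q X = mat_mod q X'" "X' \<in> carrier_mat k k"
  shows "invertible_mod q k X'"
proof -
  obtain Y where Y: "X \<in> carrier_mat k k" "Y \<in> carrier_mat k k"
    "mat_mod q (X * Y) = mat_mod q (1\<^sub>m k)" "mat_mod q (Y * X) = mat_mod q (1\<^sub>m k)"
    using assms(1) by (auto simp: invertible_mod_def)
  have "mat_mod q (X' * Y) = mat_mod q (X * Y)"
    by (rule mat_mod_mult_cong[OF assms(2)[symmetric] refl assms(3) Y(1,2,2)])
  moreover have "mat_mod q (Y * X') = mat_mod q (Y * X)"
    by (rule mat_mod_mult_cong[OF refl assms(2)[symmetric] Y(2,2) assms(3) Y(1)])
  ultimately have "mat_mod q (X' * Y) = mat_mod q (1\<^sub>m k)" "mat_mod q (Y * X') = mat_mod q (1\<^sub>m k)"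
    using Y by simp_all
  with Y(2) assms(3) show ?thesis unfolding invertible_mod_def by blast
qed

lemma invertible_mod_mult:
  assumes "invertible_mod q k X" "invertible_mod q k X'"
  shows "invertible_mod q k (X * X')"
proof -
  obtain Y where Y: "X \<in> carrier_mat k k" "Y \<in> carrier_mat k k"
    "mat_mod q (X * Y) = mat_mod q (1\<^sub>m k)" "mat_mod q (Y * X) = mat_mod q (1\<^sub>m k)"
    using assms(1) by (auto simp: invertible_mod_def)
  obtain Y' where Y': "X' \<in> carrier_mat k k" "Y' \<in> carrier_mat k k"
    "mat_mod q (X' * Y') = mat_mod q (1\<^sub>m k)" "mat_mod q (Y' * X') = mat_mod q (1\<^sub>m k)"
    using assms(2) by (auto simp: invertible_mod_def)
  have cancel: "mat_mod q ((B * C) * (C' * B')) = mat_mod q (1\<^sub>m k)"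
    if c: "B \<in> carrier_mat k k" "C \<in> carrier_mat k k" "C' \<in> carrier_mat k k" "B' \<in> carrier_mat k k"
      and "mat_mod q (C * C') = mat_mod q (1\<^sub>m k)" "mat_mod q (B * B') = mat_mod q (1\<^sub>m k)" for B C C' B'
  proof -
    have "(B * C) * (C' * B') = B * ((C * C') * B')"
      using c by (simp add: assoc_mult_mat[of _ k k _ k _ k])
    moreover have "mat_mod q (B * ((C * C') * B')) = mat_mod q (B * (1\<^sub>m k * B'))"
      using c that(5) by (intro mat_mod_mult_cong[where a = k and b = k and c = k]) auto
    ultimately show ?thesis using c that(6) by simp
  qed
  show ?thesis
    unfolding invertible_mod_def
  proof (intro conjI bexI)
    show "mat_mod q (X * X' * (Y' * Y)) = mat_mod q (1\<^sub>m k)" using Y Y' by (intro cancel)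
    show "mat_mod q ((Y' * Y) * (X * X')) = mat_mod q (1\<^sub>m k)" using Y Y' by (intro cancel)
  qed (use Y Y' in auto)
qed

lemma mat_mod_one: "1 < q \<Longrightarrow> mat_mod q (1\<^sub>m k) = 1\<^sub>m k"
  by (auto simp: mat_mod_def intro!: eq_matI)

lemma GL_iff_invertible_mod:
  assumes "1 < q"
  shows "U \<in> GL q k \<longleftrightarrow> U \<in> Fq_mat q k k \<and> invertible_mod q k U"
proof
  assume "U \<in> GL q k"
  then show "U \<in> Fq_mat q k k \<and> invertible_mod q k U"
    using assms by (auto simp: GL_def invertible_mod_def mat_mod_one Fq_mat_def)
next
  assume U: "U \<in> Fq_mat q k k \<and> invertible_mod q k U"
  then obtain Y where Y: "U \<in> carrier_mat k k" "Y \<in> carrier_mat k k"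
    "mat_mod q (U * Y) = mat_mod q (1\<^sub>m k)" "mat_mod q (Y * U) = mat_mod q (1\<^sub>m k)"
    by (auto simp: invertible_mod_def)
  have "mat_mod q Y \<in> Fq_mat q k k"
    using Y assms by (auto simp: Fq_mat_def Fq_def mat_mod_def)
  moreover have "mat_mod q (U * mat_mod q Y) = mat_mod q (U * Y)" "mat_mod q (mat_mod q Y * U) = mat_mod q (Y * U)"
    using Y(1,2) by (simp_all only: mat_mod_carrier
      mat_mod_mult_cong[OF refl mat_mod_idem, where a = k and b = k and c = k]
      mat_mod_mult_cong[OF mat_mod_idem refl, where a = k and b = k and c = k])
  ultimately show "U \<in> GL q k" using Y U assms by (auto simp: GL_def mat_mod_one)
qed

lemma invertible_mod_diag:
  assumes "\<And>i. i < k \<Longrightarrow> f i * f i = 1"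
  shows "invertible_mod q k (mat_diag k f)"
proof -
  have "mat_diag k f * mat_diag k f = 1\<^sub>m k"
    unfolding mat_diag_diag using assms by (auto simp: mat_diag_def intro!: eq_matI)
  then show ?thesis by (auto simp: invertible_mod_def intro!: bexI[of _ "mat_diag k f"])
qed

text \<open>Multiplication by the inverse from the right. It serves to cancel the recovered basis
  from an equation between row vectors.\<close>

lemma invertible_mod_row_cancel:
  assumes "invertible_mod q k X" "\<And>c. c < k \<Longrightarrow> [(\<Sum>a<k. x a * X $$ (a, c)) = 0] (mod int q)" "a < k"
  shows "[x a = 0] (mod int q)"
proof -
  obtain Y where Y: "X \<in> carrier_mat k k" "Y \<in> carrier_mat k k" "mat_mod q (X * Y) = mat_mod q (1\<^sub>m k)"
    using assms(1) by (auto simp: invertible_mod_def)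
  have XY: "[(\<Sum>c<k. X $$ (b, c) * Y $$ (c, a)) = (if b = a then 1 else 0)] (mod int q)" if "b < k" for b
    using mat_mod_eqD[OF Y(3), of k k b a] that assms(3) Y
    by (simp add: index_mult_sum[OF Y(1,2)] del: index_mult_mat(1))
  have "x a = (\<Sum>b<k. x b * (if b = a then 1 else 0))"
    using assms(3) by (simp add: if_distrib[of "\<lambda>y. _ * y"] cong: if_cong)
  also have "[\<dots> = (\<Sum>b<k. x b * (\<Sum>c<k. X $$ (b, c) * Y $$ (c, a)))] (mod int q)"
    by (intro cong_sum cong_scalar_left cong_sym[OF XY]) simp
  also have "(\<Sum>b<k. x b * (\<Sum>c<k. X $$ (b, c) * Y $$ (c, a))) =
      (\<Sum>c<k. (\<Sum>b<k. x b * X $$ (b, c)) * Y $$ (c, a))"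
    by (simp add: sum_distrib_left sum_distrib_right mult_ac) (rule sum.swap)
  also have "[\<dots> = (\<Sum>c<k. 0 * Y $$ (c, a))] (mod int q)"
    using assms(2) by (intro cong_sum cong_scalar_right) auto
  finally show ?thesis by simp
qed

context equivalent_up_to_signs
begin

text \<open>The recovered matrix is E diag(e d) B U, with \<open>E\<close> the identity rows of
  \<open>M'\<close> and \<open>B\<close> the pivot rows of \<open>M\<close>. These two are inverse
  to each other: E B gives back the identity rows of \<open>M\<close>, and B E the pivot rows of
  \<open>M'\<close>, which are unit rows.\<close>

lemma recovered_basis_invertible:
  assumes U: "invertible_mod q k (mat k k (\<lambda>(a, c). U a c))"
    and e: "\<And>i. i \<le> n \<Longrightarrow> e i * e i = 1"
  shows "invertible_mod q k (mat k k (\<lambda>(a, c). \<Sum>j<k. M' (n + 1 + a) j * e (pv j - 1) * G (pv j - 1) c))"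
proof -
  define p where "p j = pv j - 1" for j
  have p: "p j \<le> n" if "j < k" for j using echelon_full(2)[OF EM that] by (simp add: p_def)
  define E where "E = mat k k (\<lambda>(a, j). M' (n + 1 + a) j)"
  define B where "B = mat k k (\<lambda>(j, a). M (p j) a)"
  define Um where "Um = mat k k (\<lambda>(a, c). U a c)"
  have carr: "E \<in> carrier_mat k k" "B \<in> carrier_mat k k" "Um \<in> carrier_mat k k"
    by (auto simp: E_def B_def Um_def)
  have EB: "mat_mod q (E * B) = mat_mod q (1\<^sub>m k)"
  proof (rule mat_mod_eqI)
    fix a c assume ac: "a < k" "c < k"
    have "(E * B) $$ (a, c) = (\<Sum>j<k. M' (n + 1 + a) j * M (p j) c)"
      unfolding index_mult_sum[OF carr(1,2) ac] using ac by (simp add: E_def B_def)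
    then show "[(E * B) $$ (a, c) = 1\<^sub>m k $$ (a, c)] (mod int q)"
      using cong_sym[OF M_from_pivot_rows[of "n + 1 + a" c]] ident[OF ac] ac by (simp add: p_def)
  qed (use carr in auto)
  have BE: "mat_mod q (B * E) = mat_mod q (1\<^sub>m k)"
  proof (rule mat_mod_eqI)
    fix a c assume ac: "a < k" "c < k"
    have "(B * E) $$ (a, c) = (\<Sum>j<k. M (p a) j * M' (n + 1 + j) c)"
      unfolding index_mult_sum[OF carr(2,1) ac] using ac by (simp add: E_def B_def)
    then show "[(B * E) $$ (a, c) = 1\<^sub>m k $$ (a, c)] (mod int q)"
      using cong_sym[OF M'_from_identity_rows[OF p[OF ac(1)] ac(2)]] echelon_full(3)[OF EM ac] ac
      by (simp add: p_def eq_commute)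
  qed (use carr in auto)
  have inv: "invertible_mod q k E" "invertible_mod q k B"
    using EB BE carr by (auto simp: invertible_mod_def)
  have square: "(e (p i) * d (p i)) * (e (p i) * d (p i)) = 1" if "i < k" for i
  proof -
    have "(e (p i) * d (p i)) * (e (p i) * d (p i)) = (e (p i) * e (p i)) * (d (p i) * d (p i))"
      by (simp only: mult_ac)
    then show ?thesis using e d_square p[OF that] by simp
  qed
  let ?X = "E * (mat_diag k (\<lambda>j. e (p j) * d (p j)) * (B * Um))"
  have "invertible_mod q k ?X"
    using inv U square by (intro invertible_mod_mult invertible_mod_diag) (auto simp: Um_def)
  then show ?thesis
  proof (rule invertible_mod_cong)
    show "mat_mod q ?X = mat_mod q (mat k k (\<lambda>(a, c). \<Sum>j<k. M' (n + 1 + a) j * e (pv j - 1) * G (pv j - 1) c))"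
    proof (rule mat_mod_eqI)
      fix a c assume ac: "a < k" "c < k"
      have BU: "B * Um \<in> carrier_mat k k" using carr by simp
      have DBU: "mat_diag k (\<lambda>j. e (p j) * d (p j)) * (B * Um) \<in> carrier_mat k k"
        by (rule mult_carrier_mat[OF mat_diag_dim BU])
      have "?X $$ (a, c) = (\<Sum>j<k. M' (n + 1 + a) j * ((e (p j) * d (p j)) * (\<Sum>b<k. M (p j) b * U b c)))"
        unfolding index_mult_sum[OF carr(1) DBU ac]
        unfolding mat_diag_mult_left[OF BU]
      proof (rule sum.cong)
        fix j assume "j \<in> {..<k}"
        then have j: "j < k" by simp
        have "(B * Um) $$ (j, c) = (\<Sum>b<k. M (p j) b * U b c)"
          unfolding index_mult_sum[OF carr(2,3) j ac(2)] using j ac by (simp add: B_def Um_def)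
        then show "E $$ (a, j) * mat k k (\<lambda>(i, j). e (p i) * d (p i) * (B * Um) $$ (i, j)) $$ (j, c) =
            M' (n + 1 + a) j * (e (p j) * d (p j) * (\<Sum>b<k. M (p j) b * U b c))"
          using j ac by (simp add: E_def)
      qed simp
      also have "\<dots> = (\<Sum>j<k. (M' (n + 1 + a) j * e (p j)) * (d (p j) * (\<Sum>b<k. M (p j) b * U b c)))"
        by (simp add: mult_ac)
      finally have X: "?X $$ (a, c) = (\<Sum>j<k. (M' (n + 1 + a) j * e (p j)) * (d (p j) * (\<Sum>b<k. M (p j) b * U b c)))" .
      have "[(\<Sum>j<k. (M' (n + 1 + a) j * e (p j)) * (d (p j) * (\<Sum>b<k. M (p j) b * U b c))) =
          (\<Sum>j<k. (M' (n + 1 + a) j * e (p j)) * G (p j) c)] (mod int q)"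
        by (intro cong_sum cong_scalar_left cong_sym[OF rel[OF p ac(2)]]) simp
      then show "[?X $$ (a, c) = mat k k (\<lambda>(a, c). \<Sum>j<k. M' (n + 1 + a) j * e (pv j - 1) * G (pv j - 1) c) $$ (a, c)] (mod int q)"
        unfolding X using ac by (simp add: p_def)
    qed (use carr in auto)
  qed simp
qed

end

section \<open>The attack\<close>

definition attack_program :: com where
  "attack_program =
     Seq load
       (Seq (gauss ''M'' (NAdd (NAdd (NVar ''n'') (NConst 1)) (NVar ''k'')))
         (Seq (gauss ''G'' (NAdd (NVar ''n'') (NConst 1)))
           (Seq connect write_output)))"

lemma col_inj_cong:
  assumes "col_inj q n k X" "\<And>i j. \<lbrakk>i < n; j < k\<rbrakk> \<Longrightarrow> Y i j = X i j"
  shows "col_inj q n k Y"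
proof -
  have "(\<Sum>j<k. Y i j * y j) = (\<Sum>j<k. X i j * y j)" if "i < n" for i y
    using assms(2) that by (intro sum.cong) auto
  then show ?thesis using assms(1) by (simp add: col_inj_def)
qed

text \<open>Interface between program and algebra: the internal arrays are hidden behind existential
  quantifiers, and the relations from which the output is verified remain. The value of
  \<open>e n\<close> records the normalisation on the key row.\<close>

definition recovered ::
  "nat \<Rightarrow> nat \<Rightarrow> nat \<Rightarrow> (nat \<Rightarrow> nat \<Rightarrow> int) \<Rightarrow> (nat \<Rightarrow> int) \<Rightarrow> int memory \<Rightarrow> int memory \<Rightarrow> bool" where
  "recovered q n k U d s t \<longleftrightarrow> (\<exists>M G M' G' pv pw e.
     (\<forall>i<n. \<forall>j<k. M i j = fmem s ''A'' (nmem s ''P'' i) j) \<and>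
     (\<forall>j<k. M n j = fmem s ''u'' j 0) \<and>
     (\<forall>i<n. \<forall>j<k. G i j = fmem s ''H'' i j) \<and>
     (\<forall>j<k. G n j = (\<Sum>i<n. fmem s ''rs'' i 0 * fmem s ''H'' i j) mod int q) \<and>
     equivalent_up_to_signs q n k M G M' G' U d pv pw \<and>
     (\<forall>i\<le>n. e i \<in> {-1, 1}) \<and> e n = 1 \<and>
     (\<forall>i\<le>n. \<forall>j<k. M' i j \<noteq> 0 \<longrightarrow> e i * e (pv j - 1) = d i * d (pv j - 1)) \<and>
     (\<forall>i<n. fmem t ''D'' i 0 = e i mod int q) \<and>
     (\<forall>i<n. fmem t ''r'' (nmem s ''P'' i) 0 = (e i * fmem s ''rs'' i 0) mod int q) \<and>
     (\<forall>a<k. \<forall>c<k. fmem t ''U'' a c =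
        (\<Sum>j<k. M' (n + 1 + a) j * e (pv j - 1) * G (pv j - 1) c) mod int q))"

text \<open>All terms except the cubic one are compared with n k^2 through estimates such as n + 1 +
  k <= 3n and 2k + 1 <= 3k, which follow from 1 <= k <= n.\<close>

lemma attack_cost:
  fixes n k :: nat
  assumes "1 \<le> k" "k \<le> n"
  shows "k * (n * 2) + (k * (n * k + (n + 1 + k) * (2 * k + 1)) + (k * (n * k + (n + 1) * (2 * k + 1)) +
    (k * (k * (Suc n * 2)) + (2 * n + k * (k * (k * 3)))))) \<le> 25 * (k ^ 3 + n * k\<^sup>2)"
proof -
  have nk: "n * k \<le> n * k\<^sup>2" "n \<le> n * k\<^sup>2"
    using assms by (simp_all add: power2_eq_square)
  have "k * ((n + 1 + k) * (2 * k + 1)) \<le> k * ((3 * n) * (3 * k))"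
    using assms by (intro mult_le_mono le_refl) auto
  then have 1: "k * ((n + 1 + k) * (2 * k + 1)) \<le> 9 * (n * k\<^sup>2)" by (simp add: power2_eq_square mult_ac)
  have "k * ((n + 1) * (2 * k + 1)) \<le> k * ((2 * n) * (3 * k))"
    using assms by (intro mult_le_mono le_refl) auto
  then have 2: "k * ((n + 1) * (2 * k + 1)) \<le> 6 * (n * k\<^sup>2)" by (simp add: power2_eq_square mult_ac)
  have "k * (k * (Suc n * 2)) \<le> k * (k * ((2 * n) * 2))"
    using assms by (intro mult_le_mono le_refl) auto
  then have 3: "k * (k * (Suc n * 2)) \<le> 4 * (n * k\<^sup>2)" by (simp add: power2_eq_square mult_ac)
  have 4: "k * (n * k) = n * k\<^sup>2" "k * (k * (k * 3)) = 3 * k ^ 3" "k * (n * 2) = 2 * (n * k)"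
    by (simp_all add: power2_eq_square power3_eq_cube mult_ac)
  \<comment> \<open>The constant is 25 = 2 + 1 + 9 + 1 + 6 + 4 + 2, the sum of the coefficients of
    all terms bounded by \<open>y\<close>; the cubic term \<open>z\<close> has coefficient
    3.\<close>
  have lin: "2 * x + (y + a + (y + b + (c + (2 * m + 3 * z)))) \<le> 25 * (z + y)"
    if "x \<le> y" "m \<le> y" "a \<le> 9 * y" "b \<le> 6 * y" "c \<le> 4 * y" for x y z a b c m :: nat
  proof -
    have "3 * z \<le> 25 * z" by simp
    with that show ?thesis unfolding add_mult_distrib2 by linarith
  qed
  show ?thesis
    unfolding add_mult_distrib2[of k "n * k"] 4 by (intro lin nk 1 2 3)
qed

text \<open>\<open>rel\<close> and \<open>key\<close> together say that the second stack is the
  first one times \<open>U\<close> with signs \<open>d\<close>, the key row having sign 1. They are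
  congruences because the stored entries are reduced.\<close>

lemma wp_attack:
  fixes s :: "int memory"
  assumes q: "prime q" "odd q" and kn: "1 \<le> k" "k \<le> n"
    and n: "nmem s ''n'' 0 = n" and k: "nmem s ''k'' 0 = k"
    and P: "inj_on (nmem s ''P'') {..<n}" and pv0: "\<And>j. nmem s ''M'' j = 0" "\<And>j. nmem s ''G'' j = 0"
    and A_red: "\<And>i j. \<lbrakk>i < n; j < k\<rbrakk> \<Longrightarrow>
      0 \<le> fmem s ''A'' (nmem s ''P'' i) j \<and> fmem s ''A'' (nmem s ''P'' i) j < int q"
    and u_red: "\<And>j. j < k \<Longrightarrow> 0 \<le> fmem s ''u'' j 0 \<and> fmem s ''u'' j 0 < int q"
    and H_red: "\<And>i j. \<lbrakk>i < n; j < k\<rbrakk> \<Longrightarrow> 0 \<le> fmem s ''H'' i j \<and> fmem s ''H'' i j < int q"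
    and A_inj: "col_inj q n k (\<lambda>i. fmem s ''A'' (nmem s ''P'' i))"
    and H_inj: "col_inj q n k (fmem s ''H'')"
    and d: "\<And>i. i < n \<Longrightarrow> d i \<in> {-1, 1}" "d n = 1"
    and rel: "\<And>i c. \<lbrakk>i < n; c < k\<rbrakk> \<Longrightarrow>
      [fmem s ''H'' i c = d i * (\<Sum>a<k. fmem s ''A'' (nmem s ''P'' i) a * U a c)] (mod int q)"
    and key: "\<And>c. c < k \<Longrightarrow> [(\<Sum>i<n. fmem s ''rs'' i 0 * fmem s ''H'' i c) =
      (\<Sum>a<k. fmem s ''u'' a 0 * U a c)] (mod int q)"
  shows "wp (residue_ring (int q)) attack_program (25 * (k ^ 3 + n * k\<^sup>2)) (recovered q n k U d s) s"
proof -
  let ?R = "residue_ring (int q)"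
  let ?rest3 = "Seq connect write_output"
  let ?rest2 = "Seq (gauss ''G'' (NAdd (NVar ''n'') (NConst 1))) ?rest3"
  let ?w4 = "2 * n + k * (k * (k * 3))"
  let ?w3 = "k * (k * (Suc n * 2)) + ?w4"
  let ?w2 = "k * (n * k + (n + 1) * (2 * k + 1)) + ?w3"
  let ?w1 = "k * (n * k + (n + 1 + k) * (2 * k + 1)) + ?w2"
  have q1: "1 < q" using prime_gt_1_nat[OF q(1)] .
  have "wp ?R attack_program (k * (n * 2) + ?w1) (recovered q n k U d s) s"
    unfolding attack_program_def
  proof (rule wp_Seq[OF wp_mono[OF wp_load[OF n k] le_refl] le_refl])
    fix s1 :: "int memory"
    assume load: "nmem s1 ''M'' = nmem s ''M'' \<and> nmem s1 ''G'' = nmem s ''G'' \<and>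
      (\<forall>i<n. \<forall>j<k. fmem s1 ''M'' i j = fmem s ''A'' (nmem s ''P'' i) j) \<and>
      (\<forall>j<k. fmem s1 ''M'' n j = fmem s ''u'' j 0) \<and>
      (\<forall>i<k. \<forall>j<k. fmem s1 ''M'' (n + 1 + i) j = (if i = j then 1 else 0)) \<and>
      (\<forall>i<n. \<forall>j<k. fmem s1 ''G'' i j = fmem s ''H'' i j) \<and>
      (\<forall>j<k. fmem s1 ''G'' n j = (\<Sum>i<n. fmem s ''rs'' i 0 * fmem s ''H'' i j) mod int q)"
      and "same (writes load) s s1"
    then have st1: "same {''i'', ''j'', ''M'', ''G''} s s1" by simp
    define M where "M = fmem s1 ''M''"
    define G where "G = fmem s1 ''G''"
    have M: "\<And>i j. \<lbrakk>i < n; j < k\<rbrakk> \<Longrightarrow> M i j = fmem s ''A'' (nmem s ''P'' i) j"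
      "\<And>j. j < k \<Longrightarrow> M n j = fmem s ''u'' j 0"
      "\<And>i j. \<lbrakk>i < k; j < k\<rbrakk> \<Longrightarrow> M (n + 1 + i) j = (if i = j then 1 else 0)"
      using load by (auto simp: M_def)
    have G: "\<And>i j. \<lbrakk>i < n; j < k\<rbrakk> \<Longrightarrow> G i j = fmem s ''H'' i j"
      "\<And>j. j < k \<Longrightarrow> G n j = (\<Sum>i<n. fmem s ''rs'' i 0 * fmem s ''H'' i j) mod int q"
      using load by (auto simp: G_def)
    have M_red: "0 \<le> M i j \<and> M i j < int q" if "i < n + 1 + k" "j < k" for i j
    proof (cases "i \<le> n")
      case True
      then show ?thesis using that A_red u_red M(1,2) by (cases "i = n") auto
    next
      case False
      then have "M i j = (if i - (n + 1) = j then 1 else 0)" using M(3)[of "i - (n + 1)" j] that by simp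
      then show ?thesis using q1 by simp
    qed
    have G_red: "0 \<le> G i j \<and> G i j < int q" if "i < n + 1" "j < k" for i j
      using that H_red[of i j] G(1)[of i j] G(2)[of j] q1 by (cases "i < n") (auto simp: less_Suc_eq)
    have gaussM: "wp ?R (gauss ''M'' (NAdd (NAdd (NVar ''n'') (NConst 1)) (NVar ''k'')))
        (k * (n * k + (n + 1 + k) * (2 * k + 1)))
        (\<lambda>t. echelon q n (n + 1 + k) k (fmem s1 ''M'') k (fmem t ''M'') (nmem t ''M'')) s1"
    proof (rule wp_gauss[OF _ q(1)])
      show "nval (NAdd (NAdd (NVar ''n'') (NConst 1)) (NVar ''k'')) t = n + 1 + k"
        if "same (writes (gauss ''M'' (NAdd (NAdd (NVar ''n'') (NConst 1)) (NVar ''k'')))) s1 t" for t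
        using that st1 n k by (auto simp: same_def)
      show "col_inj q n k (fmem s1 ''M'')" using col_inj_cong[OF A_inj] M(1) by (simp add: M_def)
    qed (use st1 n k load pv0 M_red in \<open>auto simp: same_def M_def\<close>)
    show "wp ?R (Seq (gauss ''M'' (NAdd (NAdd (NVar ''n'') (NConst 1)) (NVar ''k''))) ?rest2) ?w1
        (recovered q n k U d s) s1"
    proof (rule wp_Seq[OF wp_mono[OF gaussM le_refl] le_refl])
      fix s2 :: "int memory"
      assume "echelon q n (n + 1 + k) k (fmem s1 ''M'') k (fmem s2 ''M'') (nmem s2 ''M'')"
        and st2: "same (writes (gauss ''M'' (NAdd (NAdd (NVar ''n'') (NConst 1)) (NVar ''k'')))) s1 s2"
      then have EM: "echelon q n (n + 1 + k) k M k (fmem s2 ''M'') (nmem s2 ''M'')" by (simp add: M_def)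
      have s2: "nmem s2 ''n'' 0 = n" "nmem s2 ''k'' 0 = k" "nmem s2 ''G'' = nmem s ''G''" "fmem s2 ''G'' = G"
        "nmem s2 ''P'' = nmem s ''P''" "fmem s2 ''rs'' = fmem s ''rs''" "fmem s2 ''H'' = fmem s ''H''"
        using st1 st2 n k load by (auto simp: same_def G_def)
      have gaussG: "wp ?R (gauss ''G'' (NAdd (NVar ''n'') (NConst 1))) (k * (n * k + (n + 1) * (2 * k + 1)))
        (\<lambda>t. echelon q n (n + 1) k (fmem s2 ''G'') k (fmem t ''G'') (nmem t ''G'')) s2"
      proof (rule wp_gauss[OF _ q(1)])
        show "nval (NAdd (NVar ''n'') (NConst 1)) t = n + 1"
          if "same (writes (gauss ''G'' (NAdd (NVar ''n'') (NConst 1)))) s2 t" for t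
          using that s2 by (auto simp: same_def)
        show "col_inj q n k (fmem s2 ''G'')" using col_inj_cong[OF H_inj G(1)] s2 by simp
      qed (use s2 pv0 G_red in auto)
      show "wp ?R ?rest2 ?w2 (recovered q n k U d s) s2"
      proof (rule wp_Seq[OF wp_mono[OF gaussG le_refl] le_refl])
        fix s3 :: "int memory"
        assume "echelon q n (n + 1) k (fmem s2 ''G'') k (fmem s3 ''G'') (nmem s3 ''G'')"
          and st3: "same (writes (gauss ''G'' (NAdd (NVar ''n'') (NConst 1)))) s2 s3"
        moreover define M' G' pv pw where "M' = fmem s3 ''M''" and "G' = fmem s3 ''G''"
          and "pv = nmem s3 ''M''" and "pw = nmem s3 ''G''"
        ultimately have EG: "echelon q n (n + 1) k G k G' pw" using s2 by simp
        have s3: "nmem s3 ''n'' 0 = n" "nmem s3 ''k'' 0 = k" "nmem s3 ''P'' = nmem s ''P''"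
          "fmem s3 ''rs'' = fmem s ''rs''" "fmem s3 ''H'' = fmem s ''H''" "fmem s3 ''M'' = fmem s2 ''M''"
          "nmem s3 ''M'' = nmem s2 ''M''"
          using s2 st3 by (auto simp: same_def)
        have EM': "echelon q n (n + 1 + k) k M k M' pv" using EM s3 by (simp add: M'_def pv_def)
        interpret equivalent_up_to_signs q n k M G M' G' U d pv pw
        proof
          show "d i \<in> {-1, 1}" if "i \<le> n" for i using that d by (cases "i = n") auto
          show "[G i c = d i * (\<Sum>a<k. M i a * U a c)] (mod int q)" if "i \<le> n" "c < k" for i c
          proof (cases "i = n")
            case True
            then show ?thesis using key[OF that(2)] G(2)[OF that(2)] M(2) d(2) by (simp add: cong_def)
          next
            case False
            then show ?thesis using that rel G(1) M(1) by simp
          qed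
        qed (use q M EM' EG in auto)
        have piv: "pv j - 1 < n" if "j < k" for j using echelon_full(2)[OF EM' that] .
        have conn: "wp ?R connect (k * (k * (Suc n * 2)))
          (\<lambda>t. (\<forall>i\<le>n. nmem t ''sign'' i \<le> 1) \<and> (\<forall>i\<le>n. \<forall>j<k. fmem s3 ''M'' i j \<noteq> 0 \<longrightarrow>
             bit_sign (nmem t ''sign'' i) * bit_sign (nmem t ''sign'' (nmem s3 ''M'' j - 1)) =
             d i * d (nmem s3 ''M'' j - 1))) s3"
        proof (rule wp_connect)
          show "\<exists>h<k. nmem s3 ''M'' j = nmem s3 ''G'' h" if "j < k" for j
          proof -
            have "pv j \<in> pw ` {..<k}" using that unfolding same_pivots[symmetric] by simp
            then show ?thesis by (auto simp: pv_def pw_def)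
          qed
          show "d i * d (nmem s3 ''M'' j - 1) = (if fmem s3 ''M'' i j = fmem s3 ''G'' i h then 1 else -1)"
            if "i \<le> n" "j < k" "h < k" "nmem s3 ''M'' j = nmem s3 ''G'' h" "fmem s3 ''M'' i j \<noteq> 0" for i j h
            using matched_sign[of j h i] that by (simp add: M'_def G'_def pv_def pw_def)
          show "nmem s3 ''M'' j - 1 \<le> n" if "j < k" for j using piv[OF that] by (simp add: pv_def)
        qed (use s3 d_square in auto)
        show "wp ?R ?rest3 ?w3 (recovered q n k U d s) s3"
        proof (rule wp_Seq[OF wp_mono[OF conn le_refl] le_refl])
          fix s4 :: "int memory"
          assume signs: "(\<forall>i\<le>n. nmem s4 ''sign'' i \<le> 1) \<and> (\<forall>i\<le>n. \<forall>j<k. fmem s3 ''M'' i j \<noteq> 0 \<longrightarrow>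
             bit_sign (nmem s4 ''sign'' i) * bit_sign (nmem s4 ''sign'' (nmem s3 ''M'' j - 1)) =
             d i * d (nmem s3 ''M'' j - 1))"
            and st4: "same (writes connect) s3 s4"
          have s4: "nmem s4 ''n'' 0 = n" "nmem s4 ''k'' 0 = k" "nmem s4 ''P'' = nmem s ''P''"
            "nmem s4 ''M'' = pv" "fmem s4 ''M'' = M'" "fmem s4 ''rs'' = fmem s ''rs''"
            "fmem s4 ''H'' = fmem s ''H''"
            using st4 s3 by (auto simp: same_def pv_def M'_def)
          \<comment> \<open>Dividing all signs by that of the key row changes no product of two
            signs and makes \<open>e n\<close> equal to 1.\<close>
          define e :: "nat \<Rightarrow> int"
            where "e i = (if nmem s4 ''sign'' i = nmem s4 ''sign'' n then 1 else -1)" for i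
          have e_bits: "e i * e b = bit_sign (nmem s4 ''sign'' i) * bit_sign (nmem s4 ''sign'' b)"
            if "i \<le> n" "b \<le> n" for i b
          proof -
            have "nmem s4 ''sign'' i = 0 \<or> nmem s4 ''sign'' i = 1" "nmem s4 ''sign'' b = 0 \<or> nmem s4 ''sign'' b = 1"
              "nmem s4 ''sign'' n = 0 \<or> nmem s4 ''sign'' n = 1"
              using signs that by (auto simp: le_Suc_eq)
            then show ?thesis by (auto simp: e_def bit_sign_def)
          qed
          have e_edge: "e i * e (pv j - 1) = d i * d (pv j - 1)" if "i \<le> n" "j < k" "M' i j \<noteq> 0" for i j
            using signs e_bits[OF that(1), of "pv j - 1"] piv[OF that(2)] that by (simp add: M'_def pv_def)
          have out: "wp ?R write_output ?w4
            (\<lambda>t. (\<forall>i<n. fmem t ''D'' i 0 = e i mod int q) \<and>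
              (\<forall>i<n. fmem t ''r'' (nmem s4 ''P'' i) 0 = ((e i mod int q) * fmem s4 ''rs'' i 0) mod int q) \<and>
              (\<forall>i<k. \<forall>j<k. fmem t ''U'' i j = (\<Sum>h<k. fmem s4 ''M'' (n + 1 + i) h * (e (nmem s4 ''M'' h - 1) mod int q) *
                fmem s4 ''H'' (nmem s4 ''M'' h - 1) j) mod int q)) s4"
            unfolding e_def by (rule wp_write_output[OF q1 s4(1,2)]) (use s4 P piv in auto)
          show "wp ?R write_output ?w4 (recovered q n k U d s) s4"
          proof (rule wp_mono[OF out le_refl])
            fix t :: "int memory"
            assume t: "(\<forall>i<n. fmem t ''D'' i 0 = e i mod int q) \<and>
              (\<forall>i<n. fmem t ''r'' (nmem s4 ''P'' i) 0 = ((e i mod int q) * fmem s4 ''rs'' i 0) mod int q) \<and>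
              (\<forall>i<k. \<forall>j<k. fmem t ''U'' i j = (\<Sum>h<k. fmem s4 ''M'' (n + 1 + i) h * (e (nmem s4 ''M'' h - 1) mod int q) *
                fmem s4 ''H'' (nmem s4 ''M'' h - 1) j) mod int q)"
            \<comment> \<open>The program multiplies by residues of the signs and reads
              \<open>H\<close>; pivot rows have index less than \<open>n\<close>, where
              \<open>H\<close> and \<open>G\<close> agree.\<close>
            have "(\<Sum>h<k. M' (n + 1 + a) h * (e (pv h - 1) mod int q) * fmem s ''H'' (pv h - 1) c) mod int q =
                (\<Sum>h<k. M' (n + 1 + a) h * e (pv h - 1) * G (pv h - 1) c) mod int q" if "c < k" for a c
            proof -
              have "[(\<Sum>h<k. M' (n + 1 + a) h * (e (pv h - 1) mod int q) * fmem s ''H'' (pv h - 1) c) =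
                (\<Sum>h<k. M' (n + 1 + a) h * e (pv h - 1) * G (pv h - 1) c)] (mod int q)"
                using G(1) piv that by (intro cong_sum cong_mult cong_refl) (auto simp: cong_def)
              then show ?thesis by (simp add: cong_def)
            qed
            then have "\<forall>a<k. \<forall>c<k. fmem t ''U'' a c =
                (\<Sum>j<k. M' (n + 1 + a) j * e (pv j - 1) * G (pv j - 1) c) mod int q"
              using t s4 by simp
            moreover have "\<forall>i<n. fmem t ''r'' (nmem s ''P'' i) 0 = (e i * fmem s ''rs'' i 0) mod int q"
              using t s4 by (simp add: mod_simps)
            moreover have "\<forall>i<n. fmem t ''D'' i 0 = e i mod int q" using t by simp
            moreover have "\<forall>i\<le>n. e i \<in> {-1, 1}" "e n = 1" by (auto simp: e_def)
            moreover have "\<forall>i\<le>n. \<forall>j<k. M' i j \<noteq> 0 \<longrightarrow> e i * e (pv j - 1) = d i * d (pv j - 1)"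
              using e_edge by blast
            moreover have "\<forall>i<n. \<forall>j<k. M i j = fmem s ''A'' (nmem s ''P'' i) j"
              "\<forall>j<k. M n j = fmem s ''u'' j 0" "\<forall>i<n. \<forall>j<k. G i j = fmem s ''H'' i j"
              "\<forall>j<k. G n j = (\<Sum>i<n. fmem s ''rs'' i 0 * fmem s ''H'' i j) mod int q"
              using M(1,2) G by blast+
            ultimately show "recovered q n k U d s t"
              unfolding recovered_def
              using equivalent_up_to_signs_axioms
              by (intro exI[of _ M] exI[of _ G] exI[of _ M'] exI[of _ G'] exI[of _ pv] exI[of _ pw] exI[of _ e] conjI)
          qed
        qed
      qed
    qed
  qed
  then show ?thesis by (rule wp_mono) (rule attack_cost[OF kn])
qed

section \<open>From hypotheses on matrices, rank and ciphertexts to congruences between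
  entries\<close>

lemma invertible_mod_col_cancel:
  assumes "invertible_mod q k X" "\<And>a. a < k \<Longrightarrow> [(\<Sum>c<k. X $$ (a, c) * y c) = 0] (mod int q)" "c < k"
  shows "[y c = 0] (mod int q)"
proof -
  obtain Y where Y: "X \<in> carrier_mat k k" "Y \<in> carrier_mat k k" "mat_mod q (Y * X) = mat_mod q (1\<^sub>m k)"
    using assms(1) by (auto simp: invertible_mod_def)
  have YX: "[(\<Sum>a<k. Y $$ (c, a) * X $$ (a, b)) = (if c = b then 1 else 0)] (mod int q)" if "b < k" for b
    using mat_mod_eqD[OF Y(3), of k k c b] that assms(3) Y
    by (simp add: index_mult_sum[OF Y(2,1)] del: index_mult_mat(1))
  have "y c = (\<Sum>b<k. (if c = b then 1 else 0) * y b)"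
    using assms(3) by (simp add: if_distrib[of "\<lambda>x. x * _"] cong: if_cong)
  moreover have "[(\<Sum>b<k. (if c = b then 1 else 0) * y b) =
      (\<Sum>b<k. (\<Sum>a<k. Y $$ (c, a) * X $$ (a, b)) * y b)] (mod int q)"
    by (intro cong_sum cong_scalar_right cong_sym[OF YX]) simp
  moreover have "(\<Sum>b<k. (\<Sum>a<k. Y $$ (c, a) * X $$ (a, b)) * y b) =
      (\<Sum>a<k. Y $$ (c, a) * (\<Sum>b<k. X $$ (a, b) * y b))"
    by (simp add: sum_distrib_left sum_distrib_right mult_ac) (rule sum.swap)
  moreover have "[(\<Sum>a<k. Y $$ (c, a) * (\<Sum>b<k. X $$ (a, b) * y b)) = (\<Sum>a<k. Y $$ (c, a) * 0)] (mod int q)"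
    by (intro cong_sum cong_scalar_left assms(2)) simp
  ultimately show ?thesis by (simp add: cong_def)
qed

text \<open>The maximum in \<open>Fq_rank\<close> is attained, and an independent set of
  \<open>k\<close> out of \<open>k\<close> columns consists of all of them. The coefficients of a
  relation are reduced first, since \<open>cols_indep\<close> quantifies over residues.\<close>

lemma col_inj_if_full_rank:
  assumes A: "A \<in> Fq_mat q n k" and rank: "Fq_rank q A = k" and q: "1 < q"
  shows "col_inj q n k (\<lambda>i j. A $$ (i, j))"
  unfolding col_inj_def
proof (intro allI impI)
  fix y j assume y: "\<forall>i<n. [(\<Sum>j<k. A $$ (i, j) * y j) = 0] (mod int q)" and j: "j < k"
  have dim: "dim_col A = k" "dim_row A = n" using A by (auto simp: Fq_mat_def)
  let ?S = "{card J | J. J \<subseteq> {..<k} \<and> cols_indep q A J}"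
  have fin: "finite ?S" by (rule finite_subset[of _ "card ` Pow {..<k}"]) auto
  have "cols_indep q A {}" by (simp add: cols_indep_def)
  then have "?S \<noteq> {}" by blast
  with fin have "Max ?S \<in> ?S" by (rule Max_in)
  then obtain J where J: "J \<subseteq> {..<k}" "cols_indep q A J" "card J = k"
    using rank dim by (auto simp: Fq_rank_def)
  then have J_eq: "J = {..<k}" by (intro card_subset_eq) auto
  have "\<forall>j\<in>{..<k}. y j mod int q = 0"
    using J(2) unfolding cols_indep_def J_eq dim
  proof (elim allE[of _ "\<lambda>j. y j mod int q"] mp, intro conjI ballI allI impI)
    show "y j mod int q \<in> Fq q" for j using q by (simp add: Fq_def)
    fix i assume "i < n"
    have "[(\<Sum>j<k. y j mod int q * A $$ (i, j)) = (\<Sum>j<k. A $$ (i, j) * y j)] (mod int q)"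
      by (intro cong_sum) (simp add: cong_def mod_simps mult.commute)
    then show "(\<Sum>j<k. y j mod int q * A $$ (i, j)) mod int q = 0"
      using y \<open>i < n\<close> by (simp add: cong_def)
  qed
  then show "[y j = 0] (mod int q)" using j by (simp add: cong_def)
qed

lemma perm_mat_mult:
  assumes "X \<in> carrier_mat n k" "\<pi> permutes {..<n}"
  shows "perm_mat n \<pi> * X = mat n k (\<lambda>(i, j). X $$ (\<pi> i, j))"
proof (rule eq_matI)
  fix i j assume "i < dim_row (mat n k (\<lambda>(i, j). X $$ (\<pi> i, j)))" "j < dim_col (mat n k (\<lambda>(i, j). X $$ (\<pi> i, j)))"
  then have ij: "i < n" "j < k" by auto
  have P: "perm_mat n \<pi> \<in> carrier_mat n n" by (simp add: perm_mat_def)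
  have "\<pi> i < n" using permutes_in_image[OF assms(2)] ij by auto
  have "(perm_mat n \<pi> * X) $$ (i, j) = (\<Sum>l<n. (if l = \<pi> i then 1 else 0) * X $$ (l, j))"
    unfolding index_mult_sum[OF P assms(1) ij] using ij by (intro sum.cong) (auto simp: perm_mat_def)
  also have "\<dots> = X $$ (\<pi> i, j)" using \<open>\<pi> i < n\<close> by (simp add: if_distrib[of "\<lambda>x. x * _"] cong: if_cong)
  finally show "(perm_mat n \<pi> * X) $$ (i, j) = mat n k (\<lambda>(i, j). X $$ (\<pi> i, j)) $$ (i, j)" using ij by simp
qed (use assms in \<open>auto simp: perm_mat_def\<close>)

lemma index_signed_perm_mult:
  assumes X: "X \<in> carrier_mat n k" and Y: "Y \<in> carrier_mat k k" and \<pi>: "\<pi> permutes {..<n}"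
    and ic: "i < n" "c < k"
  shows "(mat_diag n f * perm_mat n \<pi> * X * Y) $$ (i, c) = f i * (\<Sum>a<k. X $$ (\<pi> i, a) * Y $$ (a, c))"
proof -
  have P: "perm_mat n \<pi> \<in> carrier_mat n n" by (simp add: perm_mat_def)
  let ?Z = "mat n k (\<lambda>(i, j). X $$ (\<pi> i, j))"
  have "mat_diag n f * perm_mat n \<pi> * X * Y = mat_diag n f * (?Z * Y)"
    using X Y P by (simp add: assoc_mult_mat[of _ n n _ n _ k] assoc_mult_mat[of _ n n _ k _ k] perm_mat_mult[OF X \<pi>])
  also have "\<dots> = mat n k (\<lambda>(i, j). f i * (?Z * Y) $$ (i, j))"
    using Y by (intro mat_diag_mult_left) auto
  finally have "(mat_diag n f * perm_mat n \<pi> * X * Y) $$ (i, c) = f i * (?Z * Y) $$ (i, c)" using ic by simp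
  also have "(?Z * Y) $$ (i, c) = (\<Sum>a<k. X $$ (\<pi> i, a) * Y $$ (a, c))"
    by (subst index_mult_sum[of _ n k _ k]) (use Y ic in auto)
  finally show ?thesis .
qed

lemma index_signed_perm_vec:
  assumes v: "v \<in> carrier_vec n" and \<pi>: "\<pi> permutes {..<n}" and i: "i < n"
  shows "(mat_diag n f * perm_mat n \<pi> *\<^sub>v v) $ i = f i * v $ (\<pi> i)"
proof -
  have P: "perm_mat n \<pi> \<in> carrier_mat n n" by (simp add: perm_mat_def)
  have pi: "\<pi> i < n" using permutes_in_image[OF \<pi>] i by auto
  have "mat_diag n f * perm_mat n \<pi> = mat n n (\<lambda>(i, j). f i * perm_mat n \<pi> $$ (i, j))"
    by (rule mat_diag_mult_left[OF P])
  then have "(mat_diag n f * perm_mat n \<pi> *\<^sub>v v) $ i = (\<Sum>l<n. f i * perm_mat n \<pi> $$ (i, l) * v $ l)"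
    using i v by (simp add: scalar_prod_def atLeast0LessThan)
  also have "\<dots> = (\<Sum>l<n. if l = \<pi> i then f i * v $ l else 0)"
    using i by (intro sum.cong) (auto simp: perm_mat_def)
  finally show ?thesis using pi by simp
qed

lemma index_transpose_mult_vec:
  assumes "A \<in> carrier_mat n k" "v \<in> carrier_vec n" "j < k"
  shows "(transpose_mat A *\<^sub>v v) $ j = (\<Sum>i<n. A $$ (i, j) * v $ i)"
  using assms by (simp add: scalar_prod_def atLeast0LessThan)

text \<open>Since <u, x> = <A^T r, x> = <r, A x>, the masking terms cancel modulo q. Only the
  equation for \<open>u\<close> and the signs of \<open>r\<close> are used, so honest and recovered
  keys are on the same footing.\<close>

lemma decryption_with_equivalent_key:
  fixes m p :: nat and e0 :: int
  assumes A: "A \<in> carrier_mat n k" and r: "r \<in> sign_vecs n" and u: "u = vec_mod q (transpose_mat A *\<^sub>v r)"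
    and x: "x \<in> carrier_vec k" and e: "e \<in> carrier_vec n"
    and c0_def: "c0 = vec_mod q (A *\<^sub>v x + e)" and c1_def: "c1 = (u \<bullet> x + e0 + scale q p * int m) mod int q"
  shows "(c1 - r \<bullet> c0) mod int q = (e0 - r \<bullet> e + scale q p * int m) mod int q"
    and "correctness_condition q p n e e0 m \<Longrightarrow> decrypt q p r c0 c1 = m"
proof -
  have rn: "r \<in> carrier_vec n" using r by (simp add: sign_vecs_def)
  have "u \<bullet> x = (\<Sum>j<k. ((\<Sum>i<n. A $$ (i, j) * r $ i) mod int q) * x $ j)"
    using A x rn unfolding u by (simp add: scalar_prod_def atLeast0LessThan vec_mod_def)
  moreover have "[(\<Sum>j<k. ((\<Sum>i<n. A $$ (i, j) * r $ i) mod int q) * x $ j) =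
      (\<Sum>j<k. (\<Sum>i<n. A $$ (i, j) * r $ i) * x $ j)] (mod int q)"
    by (intro cong_sum cong_scalar_right) (simp add: cong_def)
  moreover have "(\<Sum>j<k. (\<Sum>i<n. A $$ (i, j) * r $ i) * x $ j) = (\<Sum>i<n. r $ i * (\<Sum>j<k. A $$ (i, j) * x $ j))"
    by (simp add: sum_distrib_left sum_distrib_right mult_ac) (rule sum.swap)
  ultimately have ux: "[u \<bullet> x = (\<Sum>i<n. r $ i * (\<Sum>j<k. A $$ (i, j) * x $ j))] (mod int q)" by simp
  have "r \<bullet> c0 = (\<Sum>i<n. r $ i * (((\<Sum>j<k. A $$ (i, j) * x $ j) + e $ i) mod int q))"
    using A x e by (simp add: c0_def scalar_prod_def atLeast0LessThan vec_mod_def)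
  moreover have "[(\<Sum>i<n. r $ i * (((\<Sum>j<k. A $$ (i, j) * x $ j) + e $ i) mod int q)) =
     (\<Sum>i<n. r $ i * ((\<Sum>j<k. A $$ (i, j) * x $ j) + e $ i))] (mod int q)"
    by (intro cong_sum cong_scalar_left) (simp add: cong_def)
  moreover have "r \<bullet> e = (\<Sum>i<n. r $ i * e $ i)"
    using e by (simp add: scalar_prod_def atLeast0LessThan)
  ultimately have rc: "[r \<bullet> c0 = (\<Sum>i<n. r $ i * (\<Sum>j<k. A $$ (i, j) * x $ j)) + r \<bullet> e] (mod int q)"
    by (simp add: distrib_left sum.distrib)
  have "[c1 = u \<bullet> x + e0 + scale q p * int m] (mod int q)" by (simp add: c1_def cong_def)
  also have "[u \<bullet> x + e0 + scale q p * int m =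
      (\<Sum>i<n. r $ i * (\<Sum>j<k. A $$ (i, j) * x $ j)) + e0 + scale q p * int m] (mod int q)"
    by (intro cong_add ux cong_refl)
  finally have "[c1 - r \<bullet> c0 = ((\<Sum>i<n. r $ i * (\<Sum>j<k. A $$ (i, j) * x $ j)) + e0 + scale q p * int m) -
      ((\<Sum>i<n. r $ i * (\<Sum>j<k. A $$ (i, j) * x $ j)) + r \<bullet> e)] (mod int q)"
    using rc by (rule cong_diff)
  then show *: "(c1 - r \<bullet> c0) mod int q = (e0 - r \<bullet> e + scale q p * int m) mod int q"
    by (simp add: cong_def algebra_simps)
  show "decrypt q p r c0 c1 = m" if "correctness_condition q p n e e0 m"
    using that r unfolding decrypt_def * correctness_condition_def by blast
qed

text \<open>For \<open>q\<close> above 2 the shift by \<open>h\<close> keeps both signs between 0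
  and \<open>q - 1\<close>, so recentering returns the integer sign that was stored as a
  residue.\<close>

lemma cmod_sign:
  assumes "2 < q" "x \<in> {-1, 1}"
  shows "(x mod int q) cmod int q = x"
proof -
  define h where "h = int q div 2"
  have h: "1 \<le> h" "h + 1 < int q" using assms(1) by (auto simp: h_def)
  have "(x mod int q) cmod int q = (x + h) mod int q - h"
    by (simp add: centered_modulo_def h_def mod_simps)
  also have "(x + h) mod int q = x + h" using assms(2) h by (intro mod_pos_pos_trivial) auto
  finally show ?thesis by simp
qed

lemma col_inj_permuted:
  assumes "col_inj q n k X" "\<pi> permutes {..<n}"
  shows "col_inj q n k (\<lambda>i. X (\<pi> i))"
  unfolding col_inj_def
proof (intro allI impI)
  fix y j assume y: "\<forall>i<n. [(\<Sum>j<k. X (\<pi> i) j * y j) = 0] (mod int q)" and j: "j < k"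
  have "[(\<Sum>j<k. X l j * y j) = 0] (mod int q)" if "l < n" for l
  proof -
    obtain i where "i < n" "l = \<pi> i"
      using permutes_image[OF assms(2)] \<open>l < n\<close> by (metis imageE lessThan_iff)
    then show ?thesis using y by simp
  qed
  then show "[y j = 0] (mod int q)" using assms(1) j unfolding col_inj_def by blast
qed

text \<open>As signs are invertible, a kernel vector y of \<open>Y\<close> gives the kernel vector U
  y of \<open>X\<close>; it vanishes, and then \<open>U\<close> is cancelled. In this way H inherits
  full column rank from A.\<close>

lemma col_inj_transformed:
  assumes X: "col_inj q n k X" and U: "invertible_mod q k (mat k k (\<lambda>(a, c). U a c))"
    and d: "\<And>i. i < n \<Longrightarrow> d i * d i = 1"
    and Y: "\<And>i c. \<lbrakk>i < n; c < k\<rbrakk> \<Longrightarrow> [Y i c = d i * (\<Sum>a<k. X i a * U a c)] (mod int q)"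
  shows "col_inj q n k Y"
  unfolding col_inj_def
proof (intro allI impI)
  fix y c assume y: "\<forall>i<n. [(\<Sum>c<k. Y i c * y c) = 0] (mod int q)" and c: "c < k"
  have z: "[(\<Sum>a<k. X i a * (\<Sum>c<k. U a c * y c)) = 0] (mod int q)" if i: "i < n" for i
  proof -
    have 1: "[(\<Sum>c<k. Y i c * y c) = (\<Sum>c<k. (d i * (\<Sum>a<k. X i a * U a c)) * y c)] (mod int q)"
      using Y[OF i] by (intro cong_sum cong_scalar_right) simp
    have "(\<Sum>c<k. (d i * (\<Sum>a<k. X i a * U a c)) * y c) = d i * (\<Sum>c<k. \<Sum>a<k. X i a * (U a c * y c))"
      by (simp add: sum_distrib_left sum_distrib_right mult_ac)
    also have "(\<Sum>c<k. \<Sum>a<k. X i a * (U a c * y c)) = (\<Sum>a<k. X i a * (\<Sum>c<k. U a c * y c))"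
      unfolding sum_distrib_left by (rule sum.swap)
    finally have "[d i * (\<Sum>a<k. X i a * (\<Sum>c<k. U a c * y c)) = 0] (mod int q)"
      using 1 y i by (auto simp: cong_def)
    from cong_scalar_left[OF this, of "d i"] show ?thesis
      using d[OF i] by (simp add: mult.assoc[symmetric])
  qed
  have w: "[(\<Sum>c<k. U a c * y c) = 0] (mod int q)" if "a < k" for a
    by (rule X[unfolded col_inj_def, rule_format, of "\<lambda>a. \<Sum>c<k. U a c * y c" a, OF z that])
  show "[y c = 0] (mod int q)"
    by (rule invertible_mod_col_cancel[OF U, of y c]) (simp_all add: w c)
qed

lemma signed_perm_mult_carrier:
  assumes "X \<in> carrier_mat n k" "Y \<in> carrier_mat k m"
  shows "mat_diag n f * perm_mat n \<pi> * X * Y \<in> carrier_mat n m"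
proof -
  have "mat_diag n f * perm_mat n \<pi> \<in> carrier_mat n n"
    by (rule mult_carrier_mat[OF mat_diag_dim]) (simp add: perm_mat_def)
  then show ?thesis using assms by (meson mult_carrier_mat)
qed

lemma index_mat_mod_signed_perm_mult:
  assumes X: "X \<in> carrier_mat n k" and Y: "Y \<in> carrier_mat k k" and \<pi>: "\<pi> permutes {..<n}"
    and ic: "i < n" "c < k"
  shows "mat_mod q (mat_diag n f * perm_mat n \<pi> * X * Y) $$ (i, c) =
    (f i * (\<Sum>a<k. X $$ (\<pi> i, a) * Y $$ (a, c))) mod int q"
proof -
  have "mat_mod q Z $$ (i, c) = Z $$ (i, c) mod int q" if "Z \<in> carrier_mat n k" for Z
    using that ic by (simp add: mat_mod_def)
  from this[OF signed_perm_mult_carrier[OF X Y, of f \<pi>]] show ?thesis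
    unfolding index_signed_perm_mult[OF X Y \<pi> ic] .
qed

section \<open>A single attack instance: the program's input relations and the correctness of its
  output\<close>

context
  fixes q n k :: nat and A U :: "int mat" and \<pi> :: "nat \<Rightarrow> nat" and d :: "nat \<Rightarrow> int" and r :: "int vec"
  assumes q: "prime q" "odd q" and kn: "1 \<le> k" "k \<le> n" and A: "A \<in> Fq_mat q n k" "Fq_rank q A = k"
    and r: "r \<in> sign_vecs n" and \<pi>: "\<pi> permutes {..<n}" and d: "\<And>i. i < n \<Longrightarrow> d i \<in> {-1, 1}"
    and d_n: "d n = 1" and U: "U \<in> GL q k"
begin

private definition "u = vec_mod q (transpose_mat A *\<^sub>v r)"
private definition "H = mat_mod q (mat_diag n d * perm_mat n \<pi> * A * U)"
private definition "rs = mat_diag n d * perm_mat n \<pi> *\<^sub>v r"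
private definition "s = attack_input q n k A u H rs \<pi>"

private lemma q1: "1 < q"
  using prime_gt_1_nat[OF q(1)] .

private lemma carr: "A \<in> carrier_mat n k" "U \<in> carrier_mat k k" "r \<in> carrier_vec n"
  "H \<in> carrier_mat n k" "u \<in> carrier_vec k"
proof -
  show *: "A \<in> carrier_mat n k" "U \<in> carrier_mat k k" "r \<in> carrier_vec n"
    using A(1) U r by (auto simp: Fq_mat_def GL_def sign_vecs_def)
  show "H \<in> carrier_mat n k" unfolding H_def mat_mod_carrier by (rule signed_perm_mult_carrier[OF *(1,2)])
  show "u \<in> carrier_vec k" using * by (simp add: u_def vec_mod_def)
qed

private lemma \<pi>_lt: "i < n \<Longrightarrow> \<pi> i < n"
  using permutes_in_image[OF \<pi>] by auto

private lemma sum_\<pi>: "(\<Sum>i<n. f (\<pi> i)) = (\<Sum>i<n. f i :: int)"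
  using sum.permute[OF \<pi>, of f] by (simp add: comp_def)

private lemma d_square: "i < n \<Longrightarrow> d i * d i = 1"
  using d by force

private lemma H_entry:
  "\<lbrakk>i < n; c < k\<rbrakk> \<Longrightarrow> H $$ (i, c) = (d i * (\<Sum>a<k. A $$ (\<pi> i, a) * U $$ (a, c))) mod int q"
  unfolding H_def by (rule index_mat_mod_signed_perm_mult[OF carr(1,2) \<pi>])

private lemma rs_entry: "i < n \<Longrightarrow> rs $ i = d i * r $ (\<pi> i)"
  unfolding rs_def by (rule index_signed_perm_vec[OF carr(3) \<pi>])

private lemma rs_sign: "i < n \<Longrightarrow> rs $ i \<in> {-1, 1}"
  using rs_entry[of i] d[of i] r \<pi>_lt[of i] by (auto simp: sign_vecs_def)

private lemma u_entry: "a < k \<Longrightarrow> u $ a = (\<Sum>i<n. A $$ (i, a) * r $ i) mod int q"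
  using index_transpose_mult_vec[OF carr(1,3), of a] carr by (simp add: u_def vec_mod_def)

private lemma s_simps:
  "nmem s ''n'' 0 = n" "nmem s ''k'' 0 = k" "\<And>j. nmem s ''M'' j = 0" "\<And>j. nmem s ''G'' j = 0"
  "\<And>i. i < n \<Longrightarrow> nmem s ''P'' i = \<pi> i"
  "\<And>i j. \<lbrakk>i < n; j < k\<rbrakk> \<Longrightarrow> fmem s ''A'' i j = A $$ (i, j)"
  "\<And>i j. \<lbrakk>i < n; j < k\<rbrakk> \<Longrightarrow> fmem s ''H'' i j = H $$ (i, j)"
  "\<And>j. j < k \<Longrightarrow> fmem s ''u'' j 0 = u $ j"
  "\<And>i. i < n \<Longrightarrow> fmem s ''rs'' i 0 = rs $ i mod int q"
  by (simp_all add: s_def attack_input_def)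

private lemma U_inv: "invertible_mod q k (mat k k (\<lambda>(a, c). U $$ (a, c)))"
proof -
  have "mat k k (\<lambda>(a, c). U $$ (a, c)) = U" using carr by (intro eq_matI) auto
  then show ?thesis using U GL_iff_invertible_mod[OF q1] by simp
qed

private lemma wp_attack_input:
  "wp (residue_ring (int q)) attack_program (25 * (k ^ 3 + n * k\<^sup>2))
     (recovered q n k (\<lambda>a c. U $$ (a, c)) d s) s"
proof (rule wp_attack[OF q kn])
  have A_inj: "col_inj q n k (\<lambda>i j. A $$ (\<pi> i, j))"
    using col_inj_permuted[OF col_inj_if_full_rank[OF A q1] \<pi>] .
  show "col_inj q n k (\<lambda>i. fmem s ''A'' (nmem s ''P'' i))"
    using A_inj by (rule col_inj_cong) (simp add: s_simps \<pi>_lt)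
  have "col_inj q n k (\<lambda>i c. H $$ (i, c))"
    by (rule col_inj_transformed[OF A_inj U_inv d_square]) (simp_all add: H_entry cong_def)
  then show "col_inj q n k (fmem s ''H'')" by (rule col_inj_cong) (simp add: s_simps)
  show "inj_on (nmem s ''P'') {..<n}"
    using permutes_inj_on[OF \<pi>] by (auto simp: inj_on_def s_simps)
  \<comment> \<open>In matrix terms r*^T H = r^T P^T D D P A U: the two occurrences of D cancel, and
    reindexing along the permutation leaves r^T A U = u^T U.\<close>
  show "[(\<Sum>i<n. fmem s ''rs'' i 0 * fmem s ''H'' i c) = (\<Sum>a<k. fmem s ''u'' a 0 * U $$ (a, c))] (mod int q)"
    if c: "c < k" for c
  proof -
    have "(\<Sum>i<n. fmem s ''rs'' i 0 * fmem s ''H'' i c) =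
        (\<Sum>i<n. (rs $ i mod int q) * ((d i * (\<Sum>a<k. A $$ (\<pi> i, a) * U $$ (a, c))) mod int q))"
      using c by (intro sum.cong) (auto simp: s_simps H_entry)
    moreover have "[\<dots> = (\<Sum>i<n. rs $ i * (d i * (\<Sum>a<k. A $$ (\<pi> i, a) * U $$ (a, c))))] (mod int q)"
      by (intro cong_sum cong_mult) (simp_all add: cong_def)
    moreover have "(\<Sum>i<n. rs $ i * (d i * (\<Sum>a<k. A $$ (\<pi> i, a) * U $$ (a, c)))) =
        (\<Sum>i<n. r $ (\<pi> i) * (\<Sum>a<k. A $$ (\<pi> i, a) * U $$ (a, c)))"
    proof (rule sum.cong)
      fix i assume "i \<in> {..<n}"
      then have i: "i < n" by simp
      have "rs $ i * (d i * x) = (d i * d i) * (r $ (\<pi> i) * x)" for x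
        using rs_entry[OF i] by (simp add: mult_ac)
      then show "rs $ i * (d i * (\<Sum>a<k. A $$ (\<pi> i, a) * U $$ (a, c))) =
          r $ (\<pi> i) * (\<Sum>a<k. A $$ (\<pi> i, a) * U $$ (a, c))"
        using d_square[OF i] by simp
    qed simp
    moreover have "\<dots> = (\<Sum>i<n. r $ i * (\<Sum>a<k. A $$ (i, a) * U $$ (a, c)))"
      by (rule sum_\<pi>[of "\<lambda>i. r $ i * (\<Sum>a<k. A $$ (i, a) * U $$ (a, c))"])
    moreover have "\<dots> = (\<Sum>a<k. (\<Sum>i<n. A $$ (i, a) * r $ i) * U $$ (a, c))"
      by (simp add: sum_distrib_left sum_distrib_right mult_ac) (rule sum.swap)
    moreover have "[\<dots> = (\<Sum>a<k. fmem s ''u'' a 0 * U $$ (a, c))] (mod int q)"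
      by (intro cong_sum cong_scalar_right) (simp add: s_simps u_entry cong_def)
    ultimately show ?thesis by (simp add: cong_def)
  qed
qed (use q1 d d_n A in \<open>auto simp: s_simps \<pi>_lt H_entry u_entry cong_def Fq_mat_def Fq_def\<close>)

private lemma recovered_correct:
  assumes t: "recovered q n k (\<lambda>a c. U $$ (a, c)) d s t"
  shows "out_key q n t \<in> sign_vecs n" "vec_mod q (transpose_mat A *\<^sub>v out_key q n t) = u"
    "out_diag q n t \<in> sign_diags n" "out_basis k t \<in> GL q k"
    "H = mat_mod q (out_diag q n t * perm_mat n \<pi> * A * out_basis k t)"
proof -
  obtain M G M' G' pv pw e where
    M: "\<forall>i<n. \<forall>j<k. M i j = fmem s ''A'' (nmem s ''P'' i) j" "\<forall>j<k. M n j = fmem s ''u'' j 0"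
    and G: "\<forall>i<n. \<forall>j<k. G i j = fmem s ''H'' i j"
      "\<forall>j<k. G n j = (\<Sum>i<n. fmem s ''rs'' i 0 * fmem s ''H'' i j) mod int q"
    and eq: "equivalent_up_to_signs q n k M G M' G' (\<lambda>a c. U $$ (a, c)) d pv pw"
    and e: "\<forall>i\<le>n. e i \<in> {-1, 1}" "e n = 1"
      "\<forall>i\<le>n. \<forall>j<k. M' i j \<noteq> 0 \<longrightarrow> e i * e (pv j - 1) = d i * d (pv j - 1)"
    and tD: "\<forall>i<n. fmem t ''D'' i 0 = e i mod int q"
    and tr: "\<forall>i<n. fmem t ''r'' (nmem s ''P'' i) 0 = (e i * fmem s ''rs'' i 0) mod int q"
    and tU: "\<forall>a<k. \<forall>c<k. fmem t ''U'' a c =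
        (\<Sum>j<k. M' (n + 1 + a) j * e (pv j - 1) * G (pv j - 1) c) mod int q"
    using t unfolding recovered_def by (elim exE conjE) (rule that)
  interpret E: equivalent_up_to_signs q n k M G M' G' "\<lambda>a c. U $$ (a, c)" d pv pw by (rule eq)
  have e_square: "e i * e i = 1" if "i \<le> n" for i using e(1) that by force
  let ?r = "out_key q n t" and ?U = "out_basis k t"
  have r': "?r $ (\<pi> i) = e i * rs $ i" if i: "i < n" for i
  proof -
    have "fmem t ''r'' (\<pi> i) 0 = (e i * rs $ i) mod int q"
      using tr i by (simp add: s_simps mod_simps)
    moreover have "e i * rs $ i \<in> {-1, 1}" using e(1) rs_sign[OF i] i by (auto dest!: spec[of _ i])
    ultimately show ?thesis using cmod_sign[OF E.q_gt_2] \<pi>_lt[OF i] by (simp add: out_key_def)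
  qed
  show key: "?r \<in> sign_vecs n"
    unfolding sign_vecs_def
  proof (intro CollectI conjI allI impI)
    fix l assume "l < n"
    then obtain i where i: "i < n" "l = \<pi> i"
      using permutes_image[OF \<pi>] by (metis imageE lessThan_iff)
    have "e i \<in> {-1, 1}" using e(1) i by simp
    then show "?r $ l \<in> {-1, 1}" using r'[OF i(1)] rs_sign[OF i(1)] i(2) by auto
  qed (simp add: out_key_def)
  have "out_diag q n t = mat_diag n e"
    unfolding out_diag_def mat_diag_def
    using tD e(1)[rule_format, OF less_imp_le] cmod_sign[OF E.q_gt_2] by (intro eq_matI) auto
  note diag = this
  show "out_diag q n t \<in> sign_diags n"
    unfolding diag sign_diags_def using e(1)[rule_format, OF less_imp_le] by blast
  have U'_entry: "?U $$ (a, c) = (\<Sum>j<k. M' (n + 1 + a) j * e (pv j - 1) * G (pv j - 1) c) mod int q"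
    if "a < k" "c < k" for a c
    using tU that by (simp add: out_basis_def)
  have U'_carr: "?U \<in> carrier_mat k k" by (simp add: out_basis_def)
  have U'_inv: "invertible_mod q k ?U"
  proof (rule invertible_mod_cong[OF E.recovered_basis_invertible[OF U_inv, of e]])
    show "mat_mod q (mat k k (\<lambda>(a, c). \<Sum>j<k. M' (n + 1 + a) j * e (pv j - 1) * G (pv j - 1) c)) = mat_mod q ?U"
      by (rule mat_mod_eqI[OF _ U'_carr]) (simp_all add: U'_entry cong_def)
  qed (use e_square U'_carr in auto)
  show "?U \<in> GL q k"
    unfolding GL_iff_invertible_mod[OF q1]
    using U'_inv U'_carr q1 by (auto simp: Fq_mat_def Fq_def U'_entry)
  \<comment> \<open>The rows \<open>i < n\<close> will yield the factorisation of \<open>H\<close>,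
    and row \<open>n\<close> the equation u^T U' = r*^T H.\<close>
  have MU: "[(\<Sum>a<k. M i a * ?U $$ (a, c)) = e i * G i c] (mod int q)" if "i \<le> n" "c < k" for i c
  proof -
    have "[(\<Sum>a<k. M i a * ?U $$ (a, c)) =
        (\<Sum>a<k. M i a * (\<Sum>j<k. M' (n + 1 + a) j * e (pv j - 1) * G (pv j - 1) c))] (mod int q)"
      using that by (intro cong_sum cong_scalar_left) (simp add: U'_entry cong_def)
    then show ?thesis
      using E.recovered_basis[of e i c] e e_square that cong_trans by blast
  qed
  have AU: "[(\<Sum>a<k. A $$ (\<pi> i, a) * ?U $$ (a, c)) = e i * H $$ (i, c)] (mod int q)" if "i < n" "c < k" for i c
    using MU[of i c] M(1) G(1) that by (simp add: s_simps \<pi>_lt)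
  show "H = mat_mod q (out_diag q n t * perm_mat n \<pi> * A * ?U)"
  proof (rule eq_matI)
    have Z: "mat_mod q (out_diag q n t * perm_mat n \<pi> * A * ?U) \<in> carrier_mat n k"
      unfolding diag mat_mod_carrier by (rule signed_perm_mult_carrier[OF carr(1) U'_carr])
    then show "dim_row H = dim_row (mat_mod q (out_diag q n t * perm_mat n \<pi> * A * ?U))"
      "dim_col H = dim_col (mat_mod q (out_diag q n t * perm_mat n \<pi> * A * ?U))"
      using carr(4) by (simp_all only: carrier_matD)
    fix i c assume "i < dim_row (mat_mod q (out_diag q n t * perm_mat n \<pi> * A * ?U))"
      "c < dim_col (mat_mod q (out_diag q n t * perm_mat n \<pi> * A * ?U))"
    then have ic: "i < n" "c < k" using Z by (simp_all only: carrier_matD)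
    have "[e i * (\<Sum>a<k. A $$ (\<pi> i, a) * ?U $$ (a, c)) = e i * (e i * H $$ (i, c))] (mod int q)"
      by (intro cong_scalar_left AU ic)
    then have "[e i * (\<Sum>a<k. A $$ (\<pi> i, a) * ?U $$ (a, c)) = H $$ (i, c)] (mod int q)"
      using e_square[of i] ic by (simp add: mult.assoc[symmetric])
    moreover have "H $$ (i, c) mod int q = H $$ (i, c)" using ic by (simp add: H_entry)
    moreover have "mat_mod q (out_diag q n t * perm_mat n \<pi> * A * ?U) $$ (i, c) =
        (e i * (\<Sum>a<k. A $$ (\<pi> i, a) * ?U $$ (a, c))) mod int q"
      unfolding diag by (rule index_mat_mod_signed_perm_mult[OF carr(1) U'_carr \<pi> ic])
    ultimately show "H $$ (i, c) = mat_mod q (out_diag q n t * perm_mat n \<pi> * A * ?U) $$ (i, c)"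
      by (simp add: cong_def)
  qed
  have r'_carr: "?r \<in> carrier_vec n" by (simp add: out_key_def)
  \<comment> \<open>Both u^T U' and r'^T A U' are congruent to r*^T H, and the invertible U' is
    cancelled from their difference.\<close>
  have u_cong: "[u $ a - (\<Sum>i<n. A $$ (i, a) * ?r $ i) = 0] (mod int q)" if "a < k" for a
  proof (rule invertible_mod_row_cancel[OF U'_inv _ that])
    fix c assume c: "c < k"
    have "[(\<Sum>a<k. u $ a * ?U $$ (a, c)) = G n c] (mod int q)"
      using MU[of n c] M(2) e(2) c by (simp add: s_simps)
    moreover have "[G n c = (\<Sum>i<n. rs $ i * H $$ (i, c))] (mod int q)"
    proof -
      have "G n c = (\<Sum>i<n. (rs $ i mod int q) * H $$ (i, c)) mod int q"
        using G(2) c by (simp add: s_simps)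
      moreover have "[(\<Sum>i<n. (rs $ i mod int q) * H $$ (i, c)) = (\<Sum>i<n. rs $ i * H $$ (i, c))] (mod int q)"
        by (intro cong_sum cong_scalar_right) (simp add: cong_def)
      ultimately show ?thesis by (simp add: cong_def)
    qed
    moreover have "(\<Sum>a<k. (\<Sum>i<n. A $$ (i, a) * ?r $ i) * ?U $$ (a, c)) =
        (\<Sum>i<n. ?r $ i * (\<Sum>a<k. A $$ (i, a) * ?U $$ (a, c)))"
      by (simp add: sum_distrib_left sum_distrib_right mult_ac) (rule sum.swap)
    moreover have "\<dots> = (\<Sum>i<n. ?r $ (\<pi> i) * (\<Sum>a<k. A $$ (\<pi> i, a) * ?U $$ (a, c)))"
      by (rule sum_\<pi>[of "\<lambda>i. ?r $ i * (\<Sum>a<k. A $$ (i, a) * ?U $$ (a, c))", symmetric])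
    moreover have "[\<dots> = (\<Sum>i<n. rs $ i * H $$ (i, c))] (mod int q)"
    proof (rule cong_sum)
      fix i assume "i \<in> {..<n}"
      then have i: "i < n" by simp
      \<comment> \<open>One sign comes from the recovered key and one from \<open>AU\<close>; they
        cancel.\<close>
      have "(e i * rs $ i) * (e i * H $$ (i, c)) = (e i * e i) * (rs $ i * H $$ (i, c))"
        by (simp only: mult_ac)
      also have "\<dots> = rs $ i * H $$ (i, c)" using e_square[of i] i by simp
      finally have flip: "(e i * rs $ i) * (e i * H $$ (i, c)) = rs $ i * H $$ (i, c)" .
      show "[?r $ (\<pi> i) * (\<Sum>a<k. A $$ (\<pi> i, a) * ?U $$ (a, c)) = rs $ i * H $$ (i, c)] (mod int q)"
        using cong_scalar_left[OF AU[OF i c], of "e i * rs $ i"] unfolding r'[OF i] flip .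
    qed
    ultimately have "[(\<Sum>a<k. u $ a * ?U $$ (a, c)) = (\<Sum>a<k. (\<Sum>i<n. A $$ (i, a) * ?r $ i) * ?U $$ (a, c))] (mod int q)"
      by (simp add: cong_def)
    then show "[(\<Sum>a<k. (u $ a - (\<Sum>i<n. A $$ (i, a) * ?r $ i)) * ?U $$ (a, c)) = 0] (mod int q)"
      by (simp add: left_diff_distrib sum_subtractf cong_iff_dvd_diff)
  qed
  show "vec_mod q (transpose_mat A *\<^sub>v ?r) = u"
  proof (rule eq_vecI)
    fix a assume "a < dim_vec u"
    then have a: "a < k" using carr by simp
    have "u $ a mod int q = u $ a" using a by (simp add: u_entry)
    moreover have "vec_mod q (transpose_mat A *\<^sub>v ?r) $ a = (\<Sum>i<n. A $$ (i, a) * ?r $ i) mod int q"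
      using index_transpose_mult_vec[OF carr(1) r'_carr a] carr a by (simp add: vec_mod_def)
    moreover have "[u $ a = (\<Sum>i<n. A $$ (i, a) * ?r $ i)] (mod int q)"
      using u_cong[OF a] by (simp add: cong_iff_dvd_diff)
    ultimately show "vec_mod q (transpose_mat A *\<^sub>v ?r) $ a = u $ a" by (simp add: cong_def)
  qed (use carr in \<open>simp add: vec_mod_def\<close>)
qed

lemma attack_program_correct:
  defines "u' \<equiv> vec_mod q (transpose_mat A *\<^sub>v r)"
    and "H' \<equiv> mat_mod q (mat_diag n d * perm_mat n \<pi> * A * U)"
    and "rs' \<equiv> mat_diag n d * perm_mat n \<pi> *\<^sub>v r"
  shows "\<exists>t w. exec (residue_ring (int q)) attack_program (attack_input q n k A u' H' rs' \<pi>) w t \<and>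
     w \<le> 25 * (k ^ 3 + n * k\<^sup>2) \<and>
     out_key q n t \<in> sign_vecs n \<and> vec_mod q (transpose_mat A *\<^sub>v out_key q n t) = u' \<and>
     out_diag q n t \<in> sign_diags n \<and> out_basis k t \<in> GL q k \<and>
     H' = mat_mod q (out_diag q n t * perm_mat n \<pi> * A * out_basis k t)"
  using wp_attack_input recovered_correct
  unfolding wp_def s_def u_def H_def rs_def u'_def H'_def rs'_def by blast

end

theorem mainTheorem7:
  shows "\<exists>(attack :: com) (C :: nat). \<forall>(q :: nat) (n :: nat) (k :: nat) A r \<pi> D U.
    prime q \<and> odd q \<and> 1 \<le> k \<and> k \<le> n \<and>
    A \<in> Fq_mat q n k \<and> Fq_rank q A = k \<and> r \<in> sign_vecs n \<and>
    \<pi> permutes {..<n} \<and> D \<in> sign_diags n \<and> U \<in> GL q k \<longrightarrow>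
    (let u = vec_mod q (transpose_mat A *\<^sub>v r);
         P = perm_mat n \<pi>;
         H = mat_mod q (D * P * A * U);
         rs = D * P *\<^sub>v r
     in \<exists>t w. exec (residue_ring (int q)) attack (attack_input q n k A u H rs \<pi>) w t \<and>
          w \<le> C * (k ^ 3 + n * k ^ 2) \<and>
          (let r' = out_key q n t;
               D' = out_diag q n t;
               U' = out_basis k t
           in r' \<in> sign_vecs n \<and> vec_mod q (transpose_mat A *\<^sub>v r') = u \<and>
              D' \<in> sign_diags n \<and> U' \<in> GL q k \<and> H = mat_mod q (D' * P * A * U') \<and>
              (\<forall>(p :: nat) (m :: nat) x e (e0 :: int). m < p \<and> x \<in> Fq_vec q k \<and> e \<in> carrier_vec n \<longrightarrow>
                 (let c0 = vec_mod q (A *\<^sub>v x + e);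
                      c1 = (u \<bullet> x + e0 + scale q p * int m) mod int q
                  in (c1 - r' \<bullet> c0) mod int q = (e0 - r' \<bullet> e + scale q p * int m) mod int q \<and>
                     (correctness_condition q p n e e0 m \<longrightarrow> decrypt q p r' c0 c1 = m)))))"
proof (intro exI[of _ attack_program] exI[of _ 25] allI impI, elim conjE)
  fix q n k :: nat and A :: "int mat" and r :: "int vec" and \<pi> :: "nat \<Rightarrow> nat" and D U :: "int mat"
  assume q: "prime q" "odd q" and kn: "1 \<le> k" "k \<le> n" and A: "A \<in> Fq_mat q n k" "Fq_rank q A = k"
    and r: "r \<in> sign_vecs n" and \<pi>: "\<pi> permutes {..<n}" and D: "D \<in> sign_diags n" and U: "U \<in> GL q k"
  obtain f where f: "D = mat_diag n f" "\<forall>i<n. f i \<in> {-1, 1}" using D by (auto simp: sign_diags_def)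
  \<comment> \<open>The diagonal of \<open>D\<close> determines \<open>f\<close> below
    \<open>n\<close> only; the value at \<open>n\<close> is set to the sign of the key row, which
    leaves the matrix unchanged.\<close>
  define d where "d = f(n := 1)"
  have d: "\<And>i. i < n \<Longrightarrow> d i \<in> {-1, 1}" "d n = 1" using f by (auto simp: d_def)
  have D_eq: "D = mat_diag n d" unfolding f(1) mat_diag_def d_def by (intro eq_matI) auto
  have carr: "A \<in> carrier_mat n k" using A by (simp add: Fq_mat_def)
  obtain t w where t: "exec (residue_ring (int q)) attack_program
      (attack_input q n k A (vec_mod q (transpose_mat A *\<^sub>v r)) (mat_mod q (D * perm_mat n \<pi> * A * U))
        (D * perm_mat n \<pi> *\<^sub>v r) \<pi>) w t"
    "w \<le> 25 * (k ^ 3 + n * k\<^sup>2)"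
    "out_key q n t \<in> sign_vecs n"
    "vec_mod q (transpose_mat A *\<^sub>v out_key q n t) = vec_mod q (transpose_mat A *\<^sub>v r)"
    "out_diag q n t \<in> sign_diags n" "out_basis k t \<in> GL q k"
    "mat_mod q (D * perm_mat n \<pi> * A * U) = mat_mod q (out_diag q n t * perm_mat n \<pi> * A * out_basis k t)"
    using attack_program_correct[where d = d and n = n, OF q kn A r \<pi> d U] unfolding D_eq by blast
  \<comment> \<open>Instantiated with the recovered key, which satisfies the same equation A^T r' =
    u as the original one.\<close>
  note dec = decryption_with_equivalent_key[OF carr t(3) t(4)[symmetric] _ _ refl refl]
  show "let u = vec_mod q (transpose_mat A *\<^sub>v r);
         P = perm_mat n \<pi>;
         H = mat_mod q (D * P * A * U);
         rs = D * P *\<^sub>v r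
     in \<exists>t w. exec (residue_ring (int q)) attack_program (attack_input q n k A u H rs \<pi>) w t \<and>
          w \<le> 25 * (k ^ 3 + n * k ^ 2) \<and>
          (let r' = out_key q n t;
               D' = out_diag q n t;
               U' = out_basis k t
           in r' \<in> sign_vecs n \<and> vec_mod q (transpose_mat A *\<^sub>v r') = u \<and>
              D' \<in> sign_diags n \<and> U' \<in> GL q k \<and> H = mat_mod q (D' * P * A * U') \<and>
              (\<forall>(p :: nat) (m :: nat) x e (e0 :: int). m < p \<and> x \<in> Fq_vec q k \<and> e \<in> carrier_vec n \<longrightarrow>
                 (let c0 = vec_mod q (A *\<^sub>v x + e);
                      c1 = (u \<bullet> x + e0 + scale q p * int m) mod int q
                  in (c1 - r' \<bullet> c0) mod int q = (e0 - r' \<bullet> e + scale q p * int m) mod int q \<and>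
                     (correctness_condition q p n e e0 m \<longrightarrow> decrypt q p r' c0 c1 = m))))"
    unfolding Let_def
  proof (intro exI[of _ t] exI[of _ w] conjI allI impI t, goal_cases)
    case (1 p m x e e0)
    then show ?case by (intro dec(1)) (auto simp: Fq_vec_def)
  next
    case (2 p m x e e0)
    then show ?case by (intro dec(2)) (auto simp: Fq_vec_def)
  qed
qed

end
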